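(* Let $p$ be an odd prime. (i) If $G$ is the non-abelian group of order $p^3$ and exponent $p^2$, then $G$ has no faithful irreducible projective representation and $\tau(G)=p+1$. (ii) If $G$ is the non-abelian group of order $p^3$ and exponent $p$, then $\tau_{irr}(G)=\tau(G)=p$. (iii) For the quaternion group $Q_8$, there is no faithful irreducible projective representation and $\tau(Q_8)=3$. (iv) For the dihedral group $D_8$ of order $8$, $\tau_{irr}(D_8)=\tau(D_8)=2$.
   Context: A projective representation is an $\alpha$-representation for some cocycle $\alpha$: a map $\rho:G\to\mathrm{GL}_m(\mathbb{C})$ with $\rho(1)=I$ and $\rho(g)\rho(h)=\alpha(g,h)\rho(gh)$; it is faithful if the only $g$ with $\rho(g)$ scalar is $g=1$. $\tau(G)$ (resp. $\tau_{irr}(G)$) is the least degree of a faithful (resp. faithful irreducible) projective representation of $G$. *)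

theory Defs
  imports "HOL-Algebra.Group" "Jordan_Normal_Form.Matrix"
begin

text \<open>Projective representations of degree m (as m x m complex matrices),
  defined on the carrier of a (HOL-Algebra) group G.  A projective
  representation is an alpha-representation for some nowhere-zero
  function alpha on G x G (the cocycle identity follows from associativity).\<close>

definition proj_rep :: "('a, 'b) monoid_scheme \<Rightarrow> nat \<Rightarrow> ('a \<Rightarrow> complex mat) \<Rightarrow> bool" where
  "proj_rep G m \<rho> \<longleftrightarrow>
     0 < m \<and>
     (\<forall>g\<in>carrier G. \<rho> g \<in> carrier_mat m m \<and> invertible_mat (\<rho> g)) \<and>
     \<rho> \<one>\<^bsub>G\<^esub> = 1\<^sub>m m \<and>
     (\<exists>\<alpha> :: 'a \<Rightarrow> 'a \<Rightarrow> complex.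
        \<forall>g\<in>carrier G. \<forall>h\<in>carrier G.
          \<alpha> g h \<noteq> 0 \<and> \<rho> g * \<rho> h = \<alpha> g h \<cdot>\<^sub>m \<rho> (g \<otimes>\<^bsub>G\<^esub> h))"

definition faithful_proj_rep :: "('a, 'b) monoid_scheme \<Rightarrow> nat \<Rightarrow> ('a \<Rightarrow> complex mat) \<Rightarrow> bool" where
  "faithful_proj_rep G m \<rho> \<longleftrightarrow> proj_rep G m \<rho> \<and>
     (\<forall>g\<in>carrier G. (\<exists>c. \<rho> g = c \<cdot>\<^sub>m 1\<^sub>m m) \<longrightarrow> g = \<one>\<^bsub>G\<^esub>)"

definition invariant_subspace :: "nat \<Rightarrow> ('a \<Rightarrow> complex mat) \<Rightarrow> 'a set \<Rightarrow> complex vec set \<Rightarrow> bool" where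
  "invariant_subspace m \<rho> S W \<longleftrightarrow>
     W \<subseteq> carrier_vec m \<and> 0\<^sub>v m \<in> W \<and>
     (\<forall>v\<in>W. \<forall>w\<in>W. v + w \<in> W) \<and>
     (\<forall>c. \<forall>v\<in>W. c \<cdot>\<^sub>v v \<in> W) \<and>
     (\<forall>g\<in>S. \<forall>v\<in>W. \<rho> g *\<^sub>v v \<in> W)"

definition irreducible_proj_rep :: "('a, 'b) monoid_scheme \<Rightarrow> nat \<Rightarrow> ('a \<Rightarrow> complex mat) \<Rightarrow> bool" where
  "irreducible_proj_rep G m \<rho> \<longleftrightarrow> proj_rep G m \<rho> \<and>
     (\<forall>W. invariant_subspace m \<rho> (carrier G) W \<longrightarrow> W = {0\<^sub>v m} \<or> W = carrier_vec m)"

definition tau :: "('a, 'b) monoid_scheme \<Rightarrow> nat" where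
  "tau G = (LEAST m. \<exists>\<rho>. faithful_proj_rep G m \<rho>)"

definition tau_irr :: "('a, 'b) monoid_scheme \<Rightarrow> nat" where
  "tau_irr G = (LEAST m. \<exists>\<rho>. faithful_proj_rep G m \<rho> \<and> irreducible_proj_rep G m \<rho>)"

definition grp_exponent :: "('a, 'b) monoid_scheme \<Rightarrow> nat" where
  "grp_exponent G = (LEAST n. 0 < n \<and> (\<forall>x\<in>carrier G. x [^]\<^bsub>G\<^esub> n = \<one>\<^bsub>G\<^esub>))"

definition qI :: "complex mat" where "qI = mat_of_rows_list 2 [[\<i>, 0], [0, - \<i>]]"
definition qJ :: "complex mat" where "qJ = mat_of_rows_list 2 [[0, 1], [-1, 0]]"

definition Q8 :: "complex mat monoid" where
  "Q8 = \<lparr> carrier = {s \<cdot>\<^sub>m M | s M. s \<in> {1, -1} \<and> M \<in> {1\<^sub>m 2, qI, qJ, qI * qJ}},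
          mult = (*), one = 1\<^sub>m 2 \<rparr>"

definition dR :: "int mat" where "dR = mat_of_rows_list 2 [[0, -1], [1, 0]]"
definition dS :: "int mat" where "dS = mat_of_rows_list 2 [[1, 0], [0, -1]]"

definition D8 :: "int mat monoid" where
  "D8 = \<lparr> carrier = {M * E | M E. M \<in> {1\<^sub>m 2, dR, dR * dR, dR * dR * dR} \<and> E \<in> {1\<^sub>m 2, dS}},
          mult = (*), one = 1\<^sub>m 2 \<rparr>"

end

theory Submission
  imports Defs "HOL-Algebra.Group_Action" "HOL-Algebra.Multiplicative_Group"
    "HOL-Computational_Algebra.Primes" "Jordan_Normal_Form.Char_Poly"
begin

text \<open>
  Let \<open>\<rho>\<close> be a faithful projective representation of degree \<open>m\<close>, and suppose that \<open>a\<close> has order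
  \<open>p\<^sup>2\<close> and \<open>a b = b a\<^bsup>p+1\<^esup>\<close>; this covers case (i), and with \<open>p = 2\<close> also case (iii).
  Rescaling the matrix of \<open>a\<close> makes this relation hold exactly for the matrices \<open>A\<close>, \<open>B\<close>, and the
  relation for \<open>b\<^sup>p\<close> then forces \<open>A\<close> to the power \<open>p\<^sup>2\<close> to be the identity (vanishing of the Schur
  multiplier). So \<open>Z = A\<^sup>p\<close> commutes with everything, and Schur's lemma contradicts faithfulness
  for irreducible \<open>\<rho>\<close>. Otherwise \<open>Z\<close> has two distinct eigenvalues, one of them some \<open>\<zeta> \<noteq> 1\<close>;
  conjugation by \<open>B\<close> multiplies eigenvalues of \<open>A\<close> over \<open>\<zeta>\<close> by \<open>\<zeta>\<close>, so \<open>A\<close> has at least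
  \<open>p\<close> eigenvalues over \<open>\<zeta>\<close> and one more over the other eigenvalue, whence \<open>m \<ge> p + 1\<close>.
  The same orbit argument gives \<open>m \<ge> p\<close> in case (ii).

  The bounds are attained by monomial matrices. In case (i) one adds a trivial summand to the
  \<open>p\<close>-dimensional induced representation. In case (ii) the generators act as the cyclic shift, as
  the diagonal matrix with quadratic exponents \<open>s\<^sup>2/2\<close>, and as the diagonal matrix with exponents
  \<open>s\<close>: the centre acts by non-scalar matrices, which is what makes the representation faithful
  although it is irreducible.
\<close>

section \<open>Centres of p-groups\<close>

text \<open>With \<open>p = 2\<close> the relations \<open>a^4 = 1\<close> and
  \<open>a b = b a^3\<close> also hold in the dihedral group of order 8, where the conclusion fails;
  so the value of \<open>b^p\<close> must decide. Rescaling \<open>A\<close> by \<open>c\<close>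
  multiplies the sides of \<open>A B = B A^(p+1)\<close> by \<open>c\<close> and
  \<open>c^(p+1)\<close>, so a p-th root removes the scalar defect. For odd \<open>p\<close>,
  \<open>B^p\<close> is scalar and \<open>(1+p)^p\<close> is \<open>1 + p^2\<close> modulo
  \<open>p^3\<close>. For \<open>p = 2\<close> this congruence fails; in the quaternion group
  \<open>B^2\<close> is instead a multiple of \<open>A^2\<close>, which forces \<open>A^2\<close> to
  commute with \<open>B\<close>. In case (ii) the central element \<open>z\<close> need not be
  represented by a matrix that commutes with the others. If it fails to commute with the matrix of a
  generator, their commutator is a scalar p-th root of unity other than 1, and this scalar takes the
  place of the central element in the orbit argument; otherwise a multiple of the matrix of
  \<open>z\<close> does. Eigenvectors are always produced by averaging powers of a matrix of finite
  order, so neither diagonalization nor complete reducibility is invoked.\<close>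

definition group_center :: "('a, 'b) monoid_scheme \<Rightarrow> 'a set" where
  "group_center G = {z \<in> carrier G. \<forall>g\<in>carrier G. g \<otimes>\<^bsub>G\<^esub> z = z \<otimes>\<^bsub>G\<^esub> g}"

definition centralizer :: "('a, 'b) monoid_scheme \<Rightarrow> 'a \<Rightarrow> 'a set" where
  "centralizer G x = {g \<in> carrier G. g \<otimes>\<^bsub>G\<^esub> x = x \<otimes>\<^bsub>G\<^esub> g}"

context group
begin

lemma subgroup_centralizer:
  assumes "x \<in> carrier G"
  shows "subgroup (centralizer G x) G"
proof
  fix g h assume "g \<in> centralizer G x" "h \<in> centralizer G x"
  then show "g \<otimes> h \<in> centralizer G x"
    using assms unfolding centralizer_def by (auto simp: m_assoc) (metis m_assoc)
next
  fix g assume "g \<in> centralizer G x"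
  then have g: "g \<in> carrier G" and gx: "g \<otimes> x = x \<otimes> g"
    by (auto simp: centralizer_def)
  have "inv g \<otimes> x = inv g \<otimes> (x \<otimes> g) \<otimes> inv g"
    using assms g by (simp add: m_assoc)
  also have "\<dots> = inv g \<otimes> g \<otimes> x \<otimes> inv g"
    using assms g by (simp only: gx[symmetric] m_assoc m_closed inv_closed)
  also have "\<dots> = x \<otimes> inv g"
    using assms g by simp
  finally show "inv g \<in> centralizer G x"
    using g by (simp add: centralizer_def)
qed (use assms in \<open>auto simp: centralizer_def\<close>)

lemma group_center_eq: "group_center G = carrier G \<inter> (\<Inter>x\<in>carrier G. centralizer G x)"
  by (auto simp: group_center_def centralizer_def)

lemma subgroup_group_center: "subgroup (group_center G) G"
proof
  fix g h assume "g \<in> group_center G" "h \<in> group_center G"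
  then show "g \<otimes> h \<in> group_center G"
    using subgroup.m_closed[OF subgroup_centralizer] by (auto simp: group_center_eq)
next
  fix g assume "g \<in> group_center G"
  then show "inv g \<in> group_center G"
    using subgroup.m_inv_closed[OF subgroup_centralizer] by (auto simp: group_center_eq)
qed (auto simp: group_center_def)

lemma normal_group_center: "group_center G \<lhd> G"
  unfolding normal_inv_iff
proof (intro conjI ballI subgroup_group_center)
  fix x h assume x: "x \<in> carrier G" and h: "h \<in> group_center G"
  then have "x \<otimes> h \<otimes> inv x = h"
    by (auto simp: group_center_def m_assoc inv_solve_right')
  with h show "x \<otimes> h \<otimes> inv x \<in> group_center G" by simp
qed

text \<open>Class equation: class sizes divide \<open>p ^ n\<close>, the classes of size 1 are the
  central elements, and every other class has size divisible by \<open>p\<close>.\<close>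

lemma prime_dvd_card_group_center:
  assumes p: "prime p" and ord: "Coset.order G = p ^ n" and n: "n > 0"
  shows "p dvd card (group_center G)"
proof -
  let ?\<phi> = "\<lambda>g. (\<lambda>h \<in> carrier G. g \<otimes> h \<otimes> (inv g))"
  let ?O = "orbits G (carrier G) ?\<phi>"
  interpret conj: group_action G "carrier G" ?\<phi> by (rule action_by_conjugation)
  have fin: "finite (carrier G)"
    using ord p by (metis order_gt_0_iff_finite prime_gt_0_nat zero_less_power)
  have finO: "finite ?O"
    unfolding orbits_def using fin by (auto simp: setcompr_eq_image)
  have orb_sub: "orb \<subseteq> carrier G" if "orb \<in> ?O" for orb
    using that conj.orbits_coverture by blast
  have orb_conj: "\<exists>x\<in>carrier G. orb = {g \<otimes> x \<otimes> inv g | g. g \<in> carrier G}" if orb: "orb \<in> ?O" for orb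
  proof -
    obtain x where "x \<in> carrier G" "orb = orbit G ?\<phi> x"
      using orb by (auto simp: orbits_def)
    then show ?thesis by (intro bexI[of _ x]) (auto simp: orbit_def)
  qed
  have card_orb: "card orb = 1 \<or> p dvd card orb" if orb: "orb \<in> ?O" for orb
  proof -
    obtain x where x: "x \<in> carrier G" "orb = orbit G ?\<phi> x"
      using orb by (auto simp: orbits_def)
    have "card orb dvd p ^ n"
      unfolding x(2) using conj.orbit_stabilizer_theorem[OF x(1)] ord by (intro dvdI) (rule sym, simp)
    then obtain i where "card orb = p ^ i" using divides_primepow_nat[OF p] by blast
    then show ?thesis by (cases i) auto
  qed
  have singles: "{orb \<in> ?O. card orb = 1} = (\<lambda>z. {z}) ` group_center G"
  proof (intro equalityI subsetI)
    fix orb assume "orb \<in> {orb \<in> ?O. card orb = 1}"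
    then have orb: "orb \<in> ?O" "card orb = 1" by blast+
    obtain x where x: "x \<in> carrier G" "orb = {g \<otimes> x \<otimes> inv g | g. g \<in> carrier G}"
      using orb_conj[OF orb(1)] by blast
    obtain z where z: "orb = {z}"
      using orb(2) by (rule card_1_singletonE)
    have "\<one> \<otimes> x \<otimes> inv \<one> \<in> orb" unfolding x(2) by blast
    then have orbx: "orb = {x}" using z x(1) by simp
    have "g \<otimes> x = x \<otimes> g" if g: "g \<in> carrier G" for g
    proof -
      have "g \<otimes> x \<otimes> inv g \<in> orb" unfolding x(2) using g by blast
      then have "g \<otimes> x \<otimes> inv g = x" using orbx by simp
      then show ?thesis using g x(1) by (simp add: inv_solve_right')
    qed
    then show "orb \<in> (\<lambda>z. {z}) ` group_center G"
      using x(1) orbx by (auto simp: group_center_def)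
  next
    fix orb assume "orb \<in> (\<lambda>z. {z}) ` group_center G"
    then obtain z where z: "z \<in> group_center G" "orb = {z}" by auto
    have "orbit G ?\<phi> z = {z}"
      using z(1) by (auto simp: orbit_def group_center_def inv_solve_right' intro!: exI[of _ \<one>])
    then show "orb \<in> {orb \<in> ?O. card orb = 1}"
      using z by (auto simp: orbits_def group_center_def)
  qed
  have "(\<Sum>orb\<in>?O. card orb) = p ^ n"
    using conj.disjoint_sum[OF fin, of "\<lambda>_. 1::nat"] ord by (simp add: Coset.order_def)
  moreover have "(\<Sum>orb\<in>?O. card orb) = (\<Sum>orb\<in>{orb \<in> ?O. card orb = 1}. card orb) + (\<Sum>orb\<in>{orb \<in> ?O. card orb \<noteq> 1}. card orb)"
    by (subst sum.union_disjoint[symmetric]) (auto simp: finO intro!: sum.cong)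
  moreover have "(\<Sum>orb\<in>{orb \<in> ?O. card orb = 1}. card orb) = card (group_center G)"
    unfolding singles by (simp add: sum.reindex inj_on_def)
  moreover have "p dvd (\<Sum>orb\<in>{orb \<in> ?O. card orb \<noteq> 1}. card orb)"
    using card_orb by (intro dvd_sum) auto
  moreover have "p dvd p ^ n" using n by simp
  ultimately have "p ^ n = card (group_center G) + (\<Sum>orb\<in>{orb \<in> ?O. card orb \<noteq> 1}. card orb)"
    "p dvd (\<Sum>orb\<in>{orb \<in> ?O. card orb \<noteq> 1}. card orb)" "p dvd p ^ n" by linarith+
  then show ?thesis by (simp add: dvd_add_left_iff)
qed

text \<open>The centralizer of a noncentral \<open>x\<close> contains the center and also
  \<open>x\<close>, so it has more than \<open>p ^ n\<close> elements. By Lagrange it is then the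
  whole group, which makes \<open>x\<close> central after all.\<close>

lemma comm_if_large_center:
  assumes p: "prime p" and ord: "Coset.order G = p ^ Suc n" and c: "card (group_center G) \<ge> p ^ n"
    and x: "x \<in> carrier G" and y: "y \<in> carrier G"
  shows "x \<otimes> y = y \<otimes> x"
proof (rule ccontr)
  assume ne: "x \<otimes> y \<noteq> y \<otimes> x"
  have fin: "finite (carrier G)"
    using ord p by (metis order_gt_0_iff_finite prime_gt_0_nat zero_less_power)
  have "insert x (group_center G) \<subseteq> centralizer G x"
    using x by (auto simp: group_center_def centralizer_def)
  moreover have "x \<notin> group_center G" using ne x y unfolding group_center_def by fastforce
  moreover have fc: "finite (centralizer G x)" "finite (group_center G)"
    using fin by (auto simp: centralizer_def group_center_def)
  ultimately have gt: "card (centralizer G x) > p ^ n"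
    using c card_mono[OF fc(1), of "insert x (group_center G)"] by simp
  have "card (centralizer G x) dvd p ^ Suc n"
    using lagrange[OF subgroup_centralizer[OF x]] ord by (metis dvd_triv_right)
  then obtain i where i: "card (centralizer G x) = p ^ i" "i \<le> Suc n"
    using divides_primepow_nat[OF p] by blast
  have "i > n" using gt i(1) p by (metis not_less power_increasing prime_ge_1_nat)
  then have "i = Suc n" using i(2) by simp
  then have "card (centralizer G x) = card (carrier G)"
    using i ord by (simp add: Coset.order_def)
  then have "centralizer G x = carrier G"
    using fin by (intro card_subset_eq) (auto simp: centralizer_def)
  then have "y \<in> centralizer G x" using y by simp
  then show False using ne by (simp add: centralizer_def)
qed

text \<open>The center has at least \<open>p\<close> elements by the class equation, hence index at
  most \<open>p\<close>. The bound on \<open>n\<close> is an inequality because the lemma is applied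
  to a quotient whose order is known only up to a bound.\<close>

lemma comm_if_order_le_prime_sq:
  assumes p: "prime p" and ord: "Coset.order G = p ^ n" "n \<le> 2"
    and x: "x \<in> carrier G" and y: "y \<in> carrier G"
  shows "x \<otimes> y = y \<otimes> x"
proof (cases n)
  case 0
  then obtain e where "carrier G = {e}" using ord by (auto simp: Coset.order_def card_1_singleton_iff)
  then show ?thesis using x y by auto
next
  case (Suc k)
  have "card (group_center G) > 0"
    using subgroup.subset[OF subgroup_group_center] subgroup.one_closed[OF subgroup_group_center] ord p
    by (metis card_gt_0_iff empty_iff finite_subset order_gt_0_iff_finite prime_gt_0_nat zero_less_power)
  then have "p \<le> card (group_center G)"
    using prime_dvd_card_group_center[OF p ord(1)] Suc by (simp add: dvd_imp_le)
  moreover have "p ^ k \<le> p" using Suc ord(2) p prime_ge_1_nat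
    by (cases k) auto
  ultimately show ?thesis using comm_if_large_center[OF p _ _ x y, of k] ord(1) Suc by simp
qed

text \<open>The center is nontrivial, so the quotient by it has order at most \<open>p^2\<close> and
  is abelian; hence commutators are central.\<close>

lemma comm_in_center_if_order_prime_cube:
  assumes p: "prime p" and ord: "Coset.order G = p ^ 3"
    and x: "x \<in> carrier G" and y: "y \<in> carrier G"
  shows "\<exists>z\<in>group_center G. y \<otimes> x = x \<otimes> y \<otimes> z"
proof -
  let ?Z = "group_center G"
  interpret Z: normal ?Z G by (rule normal_group_center)
  interpret Q: group "G Mod ?Z" by (rule Z.factorgroup_is_group)
  have lag: "Coset.order (G Mod ?Z) * card ?Z = p ^ 3"
    using lagrange[OF subgroup_group_center] ord by (simp add: FactGroup_def Coset.order_def)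
  then obtain i where i: "Coset.order (G Mod ?Z) = p ^ i" "i \<le> 3"
    using divides_primepow_nat[OF p] by (metis dvd_triv_left)
  have "p dvd card ?Z" using prime_dvd_card_group_center[OF p ord] by simp
  have "i \<le> 2"
  proof (rule ccontr)
    assume "\<not> i \<le> 2"
    then have "i = 3" using i by simp
    then have "card ?Z = 1" using lag i p by simp
    then show False using \<open>p dvd card ?Z\<close> p by simp
  qed
  have "(?Z #> y) \<otimes>\<^bsub>G Mod ?Z\<^esub> (?Z #> x) = (?Z #> x) \<otimes>\<^bsub>G Mod ?Z\<^esub> (?Z #> y)"
    by (rule Q.comm_if_order_le_prime_sq[OF p i(1) \<open>i \<le> 2\<close>])
      (use x y in \<open>auto simp: FactGroup_def RCOSETS_def\<close>)
  then have "?Z #> (y \<otimes> x) = ?Z #> (x \<otimes> y)"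
    using x y by (simp add: FactGroup_def Z.rcos_sum)
  then have "y \<otimes> x \<in> ?Z #> (x \<otimes> y)"
    using x y by (metis m_closed rcos_self subgroup_group_center)
  then obtain z where z: "z \<in> ?Z" "y \<otimes> x = z \<otimes> (x \<otimes> y)" by (auto simp: r_coset_def)
  moreover have "z \<otimes> (x \<otimes> y) = x \<otimes> y \<otimes> z"
    using z(1) m_closed[OF x y] unfolding group_center_def by fastforce
  ultimately show ?thesis by auto
qed

text \<open>Order 1 is excluded by the class equation, and order at least \<open>p^2\<close> would
  make the group abelian.\<close>

lemma card_center_prime_cube:
  assumes p: "prime p" and ord: "Coset.order G = p ^ 3"
    and ne: "x \<otimes> y \<noteq> y \<otimes> x" and x: "x \<in> carrier G" and y: "y \<in> carrier G"
  shows "card (group_center G) = p"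
proof -
  have "card (group_center G) dvd p ^ 3"
    using lagrange[OF subgroup_group_center] ord by (metis dvd_triv_right)
  then obtain i where i: "card (group_center G) = p ^ i" "i \<le> 3"
    using divides_primepow_nat[OF p] by blast
  have "\<not> p ^ 2 \<le> card (group_center G)"
    using comm_if_large_center[OF p, of 2] ord ne x y by (auto simp: numeral_3_eq_3 numeral_2_eq_2)
  then have "i < 2" using i p by (metis not_less power_increasing prime_ge_1_nat)
  moreover have "i \<noteq> 0" using prime_dvd_card_group_center[OF p ord] i p by (metis not_prime_unit power_0 zero_less_numeral)
  ultimately have "i = 1" by simp
  then show ?thesis using i by simp
qed

end

section \<open>Generators and normal forms\<close>

context group
begin

text \<open>Each \<open>b\<close> that \<open>a\<close> passes leaves one commutator
  \<open>w\<close>. This and the following formulas are stated for an arbitrary group because they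
  are applied to the given group and to the group of invertible matrices.\<close>

lemma comm_pow_right:
  assumes ab: "a \<otimes> b = b \<otimes> a \<otimes> w" and wb: "w \<otimes> b = b \<otimes> w"
    and G: "a \<in> carrier G" "b \<in> carrier G" "w \<in> carrier G"
  shows "a \<otimes> b [^] (n::nat) = b [^] n \<otimes> a \<otimes> w [^] n"
proof (induction n)
  case (Suc n)
  have wbn: "w [^] n \<otimes> b = b \<otimes> w [^] n" using group_commutes_pow[OF wb] G by simp
  have "a \<otimes> b [^] Suc n = (a \<otimes> b [^] n) \<otimes> b" using G by (simp add: m_assoc)
  also have "\<dots> = b [^] n \<otimes> a \<otimes> (w [^] n \<otimes> b)" using G Suc by (simp add: m_assoc)
  also have "\<dots> = b [^] n \<otimes> (a \<otimes> b) \<otimes> w [^] n" using G wbn by (simp add: m_assoc)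
  also have "\<dots> = b [^] Suc n \<otimes> a \<otimes> (w \<otimes> w [^] n)" using G by (simp add: ab m_assoc)
  also have "w \<otimes> w [^] n = w [^] Suc n" using G by (metis nat_pow_Suc2)
  finally show ?case .
qed (use G in auto)

lemma comm_pow_left:
  assumes ab: "a \<otimes> b = b \<otimes> a \<otimes> w" and wa: "w \<otimes> a = a \<otimes> w"
    and G: "a \<in> carrier G" "b \<in> carrier G" "w \<in> carrier G"
  shows "a [^] (n::nat) \<otimes> b = b \<otimes> a [^] n \<otimes> w [^] n"
proof (induction n)
  case (Suc n)
  have wan: "w \<otimes> a [^] n = a [^] n \<otimes> w" using group_commutes_pow[OF wa[symmetric]] G by simp
  have "a [^] Suc n \<otimes> b = a [^] n \<otimes> (a \<otimes> b)" using G by (simp add: m_assoc)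
  also have "\<dots> = (a [^] n \<otimes> b) \<otimes> a \<otimes> w" using G by (simp add: ab m_assoc)
  also have "\<dots> = b \<otimes> a [^] n \<otimes> (w [^] n \<otimes> a) \<otimes> w" using G by (simp add: Suc m_assoc)
  also have "w [^] n \<otimes> a = a \<otimes> w [^] n" using group_commutes_pow[OF wa] G by simp
  finally show ?case using G by (simp add: m_assoc)
qed (use G in auto)

lemma comm_pow_both:
  assumes ab: "a \<otimes> b = b \<otimes> a \<otimes> w" and wa: "w \<otimes> a = a \<otimes> w" and wb: "w \<otimes> b = b \<otimes> w"
    and G: "a \<in> carrier G" "b \<in> carrier G" "w \<in> carrier G"
  shows "a [^] (m::nat) \<otimes> b [^] (n::nat) = b [^] n \<otimes> a [^] m \<otimes> w [^] (m * n)"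
  using comm_pow_right[of "a [^] m" b "w [^] m" n] comm_pow_left[OF ab wa G, of m]
    group_commutes_pow[OF wb] G by (simp add: nat_pow_pow)

text \<open>Collecting the \<open>b\<close>s on the left moves each \<open>a\<close> past every
  later \<open>b\<close>; there are \<open>n choose 2\<close> such pairs.\<close>

lemma mult_pow_class_two:
  assumes ab: "a \<otimes> b = b \<otimes> a \<otimes> w" and wa: "w \<otimes> a = a \<otimes> w" and wb: "w \<otimes> b = b \<otimes> w"
    and G: "a \<in> carrier G" "b \<in> carrier G" "w \<in> carrier G"
  shows "(b \<otimes> a) [^] (n::nat) = b [^] n \<otimes> a [^] n \<otimes> w [^] (n choose 2)"
proof (induction n)
  case (Suc n)
  let ?c = "n choose 2"
  have wc: "w [^] ?c \<otimes> (b \<otimes> a) = (b \<otimes> a) \<otimes> w [^] ?c"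
    using group_commutes_pow[of w "b \<otimes> a"] wa wb G by (metis m_assoc m_closed)
  have "(b \<otimes> a) [^] Suc n = b [^] n \<otimes> a [^] n \<otimes> (w [^] ?c \<otimes> (b \<otimes> a))"
    using G by (simp add: Suc m_assoc)
  also have "\<dots> = b [^] n \<otimes> (a [^] n \<otimes> b) \<otimes> a \<otimes> w [^] ?c"
    unfolding wc using G by (simp add: m_assoc)
  also have "\<dots> = b [^] n \<otimes> b \<otimes> a [^] n \<otimes> (w [^] n \<otimes> a) \<otimes> w [^] ?c"
    using G by (simp add: comm_pow_left[OF ab wa G] m_assoc)
  also have "w [^] n \<otimes> a = a \<otimes> w [^] n" using group_commutes_pow[OF wa] G by simp
  also have "b [^] n \<otimes> b \<otimes> a [^] n \<otimes> (a \<otimes> w [^] n) \<otimes> w [^] ?c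
      = b [^] Suc n \<otimes> a [^] Suc n \<otimes> (w [^] n \<otimes> w [^] ?c)"
    using G by (simp add: m_assoc)
  also have "w [^] n \<otimes> w [^] ?c = w [^] (Suc n choose 2)"
    using G by (simp add: nat_pow_mult numeral_2_eq_2)
  finally show ?case .
qed (use G in \<open>auto simp: binomial_eq_0\<close>)

lemma pow_card_subgroup_eq_one:
  assumes "subgroup H G" "x \<in> H"
  shows "x [^] card H = \<one>"
  using group.pow_order_eq_1[OF subgroup_imp_group[OF assms(1)], of x] assms(2)
  by (simp add: Coset.order_def nat_pow_consistent[symmetric])

lemma ord_eq_prime:
  assumes "prime p" "x \<in> carrier G" "x [^] p = \<one>" "x \<noteq> \<one>"
  shows "ord x = p"
  using assms by (metis pow_eq_id prime_nat_iff ord_eq_1)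

lemma ord_eq_prime_sq:
  assumes p: "prime p" and x: "x \<in> carrier G" and "x [^] (p\<^sup>2) = \<one>" and np: "x [^] p \<noteq> \<one>"
  shows "ord x = p\<^sup>2"
proof -
  have "ord x dvd p\<^sup>2" using assms by (simp add: pow_eq_id)
  then obtain i where i: "i \<le> 2" "ord x = p ^ i" using divides_primepow_nat[OF p] by blast
  have "\<not> p ^ i dvd p" using np x i(2) by (simp add: pow_eq_id)
  then have "i \<noteq> 0" "i \<noteq> 1" by (auto intro: ccontr)
  then have "i = 2" using i(1) by simp
  then show ?thesis using i by simp
qed

lemma pow_inj_iff:
  assumes "x \<in> carrier G" "i < ord x" "j < ord x"
  shows "x [^] i = x [^] j \<longleftrightarrow> i = j"
  using ord_inj[OF assms(1)] assms(2,3) by (auto simp: inj_on_def)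

end

section \<open>Normal form and generators for the groups of exponent \<open>p^2\<close>\<close>

locale metacyclic_pp = group +
  fixes p :: nat and a b
  assumes prime_p: "prime p"
    and a_closed [simp]: "a \<in> carrier G" and b_closed [simp]: "b \<in> carrier G"
    and a_pow_p2: "a [^] (p\<^sup>2) = \<one>" and a_pow_p: "a [^] p \<noteq> \<one>"
    and a_b: "a \<otimes> b = b \<otimes> a [^] Suc p"
    and order_G: "Coset.order G = p ^ 3"
begin

lemma ord_a: "ord a = p\<^sup>2"
  using ord_eq_prime_sq[OF prime_p a_closed a_pow_p2 a_pow_p] .

lemma a_pow_p_a: "a [^] p \<otimes> a = a \<otimes> a [^] p"
  using group_commutes_pow[of a a p] by simp

lemma a_b': "a \<otimes> b = b \<otimes> a \<otimes> a [^] p"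
  unfolding a_b by (simp add: a_pow_p_a m_assoc)

lemma a_pow_p_b: "a [^] p \<otimes> b = b \<otimes> a [^] p"
proof -
  have "(a [^] p) [^] p = \<one>" using a_pow_p2 by (simp add: nat_pow_pow power2_eq_square)
  then show ?thesis using comm_pow_left[OF a_b' a_pow_p_a] by simp
qed

lemma a_pow_b_pow: "a [^] (k::nat) \<otimes> b [^] (i::nat) = b [^] i \<otimes> a [^] (k + p * (k * i))"
  using comm_pow_both[OF a_b' a_pow_p_a a_pow_p_b, of k i]
  by (simp add: nat_pow_pow nat_pow_mult m_assoc)

lemma mult_normal_form:
  "(b [^] (i::nat) \<otimes> a [^] (k::nat)) \<otimes> (b [^] (i'::nat) \<otimes> a [^] (k'::nat)) = b [^] (i + i') \<otimes> a [^] (k * (1 + p * i') + k')"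
proof -
  have "(b [^] i \<otimes> a [^] k) \<otimes> (b [^] i' \<otimes> a [^] k') = b [^] i \<otimes> (a [^] k \<otimes> b [^] i') \<otimes> a [^] k'"
    by (simp add: m_assoc)
  also have "\<dots> = (b [^] i \<otimes> b [^] i') \<otimes> (a [^] (k + p * (k * i')) \<otimes> a [^] k')"
    unfolding a_pow_b_pow by (simp add: m_assoc)
  finally show ?thesis by (simp add: nat_pow_mult algebra_simps)
qed

text \<open>Only injectivity needs an argument, since there are \<open>p * p^2\<close> exponent
  pairs and as many group elements.\<close>

lemma bij_normal_form:
  "bij_betw (\<lambda>(i, k). b [^] i \<otimes> a [^] k) ({..<p} \<times> {..<p\<^sup>2}) (carrier G)"
proof -
  let ?f = "\<lambda>(i::nat, k::nat). b [^] i \<otimes> a [^] k"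
  have w: "ord (a [^] p) = p"
    using a_pow_p a_pow_p2 by (intro ord_eq_prime prime_p) (auto simp: nat_pow_pow power2_eq_square)
  have inj: "inj_on ?f ({..<p} \<times> {..<p\<^sup>2})"
  proof (rule inj_onI; clarify)
    fix i k i' k' :: nat
    assume eq: "b [^] i \<otimes> a [^] k = b [^] i' \<otimes> a [^] k'"
      and *: "i < p" "i' < p" "k < p\<^sup>2" "k' < p\<^sup>2"
    \<comment> \<open>Commuting with \<open>a\<close> reveals \<open>i\<close> through a power of
      \<open>a [^] p\<close>, which has order \<open>p\<close>. This works for every value of
      \<open>b [^] p\<close>, which the locale leaves open.\<close>
    have conj: "a \<otimes> (b [^] i \<otimes> a [^] k) = (b [^] i \<otimes> a [^] k) \<otimes> a \<otimes> (a [^] p) [^] i" for i k :: nat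
    proof -
      have a_Suc: "a \<otimes> a [^] n = a [^] Suc n" for n :: nat using nat_pow_Suc2[of a n] by simp
      have "a \<otimes> (b [^] i \<otimes> a [^] k) = (a \<otimes> b [^] i) \<otimes> a [^] k"
        by (simp add: m_assoc)
      also have "\<dots> = b [^] i \<otimes> a [^] (Suc (p * i + k))"
        using comm_pow_right[OF a_b' a_pow_p_b, of i]
        by (simp add: m_assoc nat_pow_mult nat_pow_pow a_Suc del: nat_pow_Suc Group.nat_pow_Suc)
      also have "\<dots> = (b [^] i \<otimes> a [^] k) \<otimes> a \<otimes> (a [^] p) [^] i"
        by (simp add: m_assoc nat_pow_mult nat_pow_pow a_Suc ac_simps del: nat_pow_Suc Group.nat_pow_Suc)
      finally show ?thesis .
    qed
    have "(a [^] p) [^] i = (a [^] p) [^] i'"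
      using conj[of i k] conj[of i' k'] unfolding eq by simp
    then have "i = i'" using pow_inj_iff[of "a [^] p" i i'] w * by simp
    moreover have "k = k'" using eq * pow_inj_iff[of a k k'] ord_a unfolding \<open>i = i'\<close> by simp
    ultimately show "i = i' \<and> k = k'" by simp
  qed
  have "?f ` ({..<p} \<times> {..<p\<^sup>2}) = carrier G"
  proof (rule card_subset_eq)
    show "finite (carrier G)"
      using order_G prime_p by (metis order_gt_0_iff_finite prime_gt_0_nat zero_less_power)
    show "card (?f ` ({..<p} \<times> {..<p\<^sup>2})) = card (carrier G)"
      using card_image[OF inj] order_G by (simp add: Coset.order_def card_cartesian_product power2_eq_square power3_eq_cube)
  qed auto
  with inj show ?thesis by (simp add: bij_betw_def)
qed

end

text \<open>An element \<open>b\<close> not commuting with \<open>a\<close> is corrected twice: a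
  power of \<open>a\<close> is multiplied on to make its p-th power trivial, and then a power is
  taken to turn the commutator into exactly \<open>a [^] p\<close>.\<close>

lemma (in group) exponent_prime_sq_generators:
  assumes p: "prime p" "odd p" and ord: "Coset.order G = p ^ 3"
    and ne: "x \<otimes> y \<noteq> y \<otimes> x" and xy: "x \<in> carrier G" "y \<in> carrier G"
    and exp: "\<And>g. g \<in> carrier G \<Longrightarrow> g [^] (p\<^sup>2) = \<one>"
    and a: "a \<in> carrier G" "a [^] p \<noteq> \<one>"
  shows "\<exists>b. b [^] p = \<one> \<and> metacyclic_pp G p a b"
proof -
  have fin: "finite (carrier G)"
    using ord p by (metis order_gt_0_iff_finite prime_gt_0_nat zero_less_power)
  have orda: "ord a = p\<^sup>2" using ord_eq_prime_sq[OF p(1) a(1) exp[OF a(1)] a(2)] .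
  have cardZ: "card (group_center G) = p" using card_center_prime_cube[OF p(1) ord ne xy] .
  have Zp: "z [^] p = \<one>" if "z \<in> group_center G" for z
    using pow_card_subgroup_eq_one[OF subgroup_group_center that] cardZ by simp
  have "a \<notin> group_center G" using Zp a(2) by blast
  then obtain b where b: "b \<in> carrier G" "a \<otimes> b \<noteq> b \<otimes> a"
    using a(1) unfolding group_center_def by fastforce
  obtain w where w: "w \<in> group_center G" "a \<otimes> b = b \<otimes> a \<otimes> w"
    using comm_in_center_if_order_prime_cube[OF p(1) ord b(1) a(1)] by auto
  have wc: "w \<otimes> g = g \<otimes> w" if "g \<in> carrier G" for g
    using w(1) that unfolding group_center_def by auto
  have wG: "w \<in> carrier G" using w(1) unfolding group_center_def by auto
  have ordw: "ord w = p"
    using w b a wG Zp by (intro ord_eq_prime p) auto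
  \<comment> \<open>The centralizer of \<open>a\<close> contains the \<open>p^2\<close> powers of
    \<open>a\<close> and misses \<open>b\<close>, so by Lagrange it consists of these
    powers.\<close>
  have cent: "\<exists>i::nat. g = a [^] i" if "g \<in> carrier G" "g \<otimes> a = a \<otimes> g" for g
  proof -
    let ?A = "(\<lambda>i::nat. a [^] i) ` {..<p\<^sup>2}"
    have cardA: "card ?A = p\<^sup>2"
      using pow_inj_iff[OF a(1)] orda by (subst card_image) (auto simp: inj_on_def)
    have sub: "?A \<subseteq> centralizer G a"
      using a(1) group_commutes_pow[of a a] by (auto simp: centralizer_def)
    have finC: "finite (centralizer G a)" using fin by (auto simp: centralizer_def)
    have "card (centralizer G a) dvd p ^ 3"
      using lagrange[OF subgroup_centralizer[OF a(1)]] ord by (metis dvd_triv_right)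
    then obtain i where i: "card (centralizer G a) = p ^ i" "i \<le> 3"
      using divides_primepow_nat[OF p(1)] by blast
    have "i \<noteq> 3"
    proof
      assume "i = 3"
      then have "card (centralizer G a) = card (carrier G)" using i ord by (simp add: Coset.order_def)
      then have "centralizer G a = carrier G"
        using fin by (intro card_subset_eq) (auto simp: centralizer_def)
      then have "b \<in> centralizer G a" using b by simp
      then show False using b by (simp add: centralizer_def)
    qed
    then have "card (centralizer G a) \<le> p\<^sup>2"
      using i prime_ge_1_nat[OF p(1)] by (simp add: power_increasing)
    then have "?A = centralizer G a"
      using sub finC cardA by (intro card_seteq) auto
    then show ?thesis using that by (auto simp: centralizer_def)
  qed
  obtain k :: nat where k: "w = a [^] k" using cent[OF wG] wc[OF a(1)] by auto
  have "a [^] (k * p) = \<one>" using Zp[OF w(1)] k a by (simp add: nat_pow_pow)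
  then have "p\<^sup>2 dvd k * p" using a orda pow_eq_id by simp
  then have "p dvd k" using p(1) by (auto simp: power2_eq_square dvd_def)
  then obtain t where t: "k = p * t" by auto
  have "\<not> p dvd t"
  proof
    assume "p dvd t"
    then have "ord a dvd k" using t orda by (auto simp: power2_eq_square)
    then have "w = \<one>" using k a pow_eq_id by simp
    then show False using w b a by simp
  qed
  then have "coprime t p" using p(1) by (metis coprime_commute prime_imp_coprime)
  \<comment> \<open>\<open>u\<close> is the inverse of \<open>t\<close> modulo \<open>p\<close>;
    since \<open>w\<close> is \<open>a\<close> to the power \<open>p * t\<close>, the power
    \<open>w [^] u\<close> will be \<open>a [^] p\<close>.\<close>
  then obtain u v where uv: "t * u = p * v + 1"
    using bezout_nat[of t p] p by (metis coprime_iff_gcd_eq_1 prime_gt_0_nat not_prime_0 dvd_0_right \<open>\<not> p dvd t\<close>)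
  \<comment> \<open>The commutator has order \<open>p\<close>, so \<open>b [^] p\<close> commutes
    with \<open>a\<close> and is a power of \<open>a\<close>. Because that power also commutes with
    \<open>b\<close>, its exponent \<open>l\<close> turns out to be a multiple of
    \<open>p\<close>.\<close>
  have "b [^] p \<otimes> a = a \<otimes> b [^] p"
    using comm_pow_right[OF w(2) wc[OF b(1)] a(1) b(1) wG, of p] Zp[OF w(1)] a b by simp
  then obtain l :: nat where l: "b [^] p = a [^] l" using cent[of "b [^] p"] b(1) by auto
  have "a [^] l \<otimes> b = b \<otimes> a [^] l \<otimes> w [^] l"
    using comm_pow_left[OF w(2) wc[OF a(1)] a(1) b(1) wG] .
  moreover have "a [^] l \<otimes> b = b \<otimes> a [^] l"
    unfolding l[symmetric] using group_commutes_pow[of b b p] b by simp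
  ultimately have "w [^] l = \<one>" using a b wG by (metis l_cancel_one' m_closed nat_pow_closed r_cancel_one')
  then obtain l' where l': "l = p * l'" using ordw wG by (auto simp: pow_eq_id)
  \<comment> \<open>The factor \<open>p - 1\<close> stands for -1 among natural exponents:
    \<open>l + n * p\<close> becomes \<open>p\<^sup>2 * l'\<close>, so the p-th power of
    \<open>c\<close> vanishes up to the commutator term.\<close>
  define n where "n = (p - 1) * l'"
  define c where "c = b \<otimes> a [^] n"
  have cG: "c \<in> carrier G" using a b by (simp add: c_def)
  have ac: "a \<otimes> c = c \<otimes> a \<otimes> w"
  proof -
    have "a \<otimes> c = b \<otimes> a \<otimes> (w \<otimes> a [^] n)" using w a b wG by (simp add: c_def m_assoc[symmetric])
    also have "\<dots> = b \<otimes> (a \<otimes> a [^] n) \<otimes> w" using wc[of "a [^] n"] a b wG by (simp add: m_assoc)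
    also have "a \<otimes> a [^] n = a [^] n \<otimes> a" using group_commutes_pow[of a a n] a by simp
    finally show ?thesis using a b wG by (simp add: c_def m_assoc)
  qed
  \<comment> \<open>Oddness of \<open>p\<close> enters here: it kills the commutator term in the
    p-th power of \<open>b \<otimes> a [^] n\<close>.\<close>
  have "p dvd (p choose 2)" using p prime_odd_nat[of p] prime_ge_2_nat[OF p(1)] by (intro dvd_choose_prime) (auto simp: le_less)
  then have wch: "(w [^] n) [^] (p choose 2) = \<one>" using wG ordw by (simp add: nat_pow_pow pow_eq_id)
  have "c [^] p = b [^] p \<otimes> (a [^] n) [^] p \<otimes> (w [^] n) [^] (p choose 2)"
    unfolding c_def
    using comm_pow_left[OF w(2) wc[OF a(1)] a(1) b(1) wG, of n] wc[of "a [^] n"] wc[OF b(1)] a b wG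
    by (intro mult_pow_class_two) (auto intro!: group_commutes_pow)
  also have "\<dots> = a [^] (l + n * p)" using wch a by (simp add: l nat_pow_pow nat_pow_mult)
  also have "l + n * p = p\<^sup>2 * l'"
    using prime_ge_1_nat[OF p(1)] by (simp add: l' n_def power2_eq_square algebra_simps)
  also have "a [^] (p\<^sup>2 * l') = \<one>" using a orda by (simp add: pow_eq_id)
  finally have cp: "c [^] p = \<one>" .
  have wu: "w [^] u = a [^] p"
  proof -
    have "w [^] u = a [^] (p * (t * u))" using k t a by (simp add: nat_pow_pow mult.assoc)
    also have "\<dots> = a [^] (p\<^sup>2 * v) \<otimes> a [^] p" using a by (simp add: uv nat_pow_mult power2_eq_square algebra_simps)
    also have "a [^] (p\<^sup>2 * v) = \<one>" using a orda by (simp add: pow_eq_id)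
    finally show ?thesis using a by simp
  qed
  have "a \<otimes> c [^] u = c [^] u \<otimes> a [^] Suc p"
    using comm_pow_right[OF ac wc[OF cG] a(1) cG wG, of u] a cG group_commutes_pow[of a a p]
    by (simp add: wu m_assoc)
  moreover have "(c [^] u) [^] p = \<one>" using cp cG by (metis mult.commute nat_pow_one nat_pow_pow)
  ultimately show ?thesis
    using a cG exp p ord by (intro exI[of _ "c [^] u"]) (auto simp: metacyclic_pp_def metacyclic_pp_axioms_def is_group)
qed

section \<open>Normal form and generators for the groups of exponent \<open>p\<close>\<close>

locale heisenberg_pp = group +
  fixes p :: nat and x y z
  assumes prime_p: "prime p"
    and x_closed [simp]: "x \<in> carrier G" and y_closed [simp]: "y \<in> carrier G"
    and z_closed [simp]: "z \<in> carrier G"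
    and x_pow_p: "x [^] p = \<one>" and y_pow_p: "y [^] p = \<one>" and z_pow_p: "z [^] p = \<one>"
    and y_x: "y \<otimes> x = x \<otimes> y \<otimes> z" and z_x: "z \<otimes> x = x \<otimes> z" and z_y: "z \<otimes> y = y \<otimes> z"
    and z_neq_one: "z \<noteq> \<one>"
    and order_G: "Coset.order G = p ^ 3"
begin

text \<open>The only noncommuting rearrangement moves \<open>y [^] j\<close> past
  \<open>x [^] i'\<close>; its \<open>j * i'\<close> crossings each leave one central
  \<open>z\<close>.\<close>

lemma mult_normal_form:
  "(x [^] (i::nat) \<otimes> y [^] (j::nat) \<otimes> z [^] (k::nat)) \<otimes> (x [^] (i'::nat) \<otimes> y [^] (j'::nat) \<otimes> z [^] (k'::nat))
   = x [^] (i + i') \<otimes> y [^] (j + j') \<otimes> z [^] (k + k' + j * i')"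
proof -
  have zx: "z [^] k \<otimes> (x [^] i \<otimes> u) = x [^] i \<otimes> (z [^] k \<otimes> u)"
    and zy: "z [^] k \<otimes> (y [^] i \<otimes> u) = y [^] i \<otimes> (z [^] k \<otimes> u)"
    and yx: "y [^] k \<otimes> (x [^] i \<otimes> u) = x [^] i \<otimes> (y [^] k \<otimes> (z [^] (k * i) \<otimes> u))"
    if u: "u \<in> carrier G" for u and i k :: nat
  proof -
    have "z [^] k \<otimes> x [^] i = x [^] i \<otimes> z [^] k"
      using group_commutes_pow[of z "x [^] i" k] group_commutes_pow[of x z i] z_x by simp
    then show "z [^] k \<otimes> (x [^] i \<otimes> u) = x [^] i \<otimes> (z [^] k \<otimes> u)"
      using u by (simp add: m_assoc[symmetric])
    have "z [^] k \<otimes> y [^] i = y [^] i \<otimes> z [^] k"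
      using group_commutes_pow[of z "y [^] i" k] group_commutes_pow[of y z i] z_y by simp
    then show "z [^] k \<otimes> (y [^] i \<otimes> u) = y [^] i \<otimes> (z [^] k \<otimes> u)"
      using u by (simp add: m_assoc[symmetric])
    show "y [^] k \<otimes> (x [^] i \<otimes> u) = x [^] i \<otimes> (y [^] k \<otimes> (z [^] (k * i) \<otimes> u))"
      using comm_pow_both[OF y_x z_y z_x, of k i] u by (simp add: m_assoc[symmetric])
  qed
  have add: "g [^] m \<otimes> (g [^] n \<otimes> u) = g [^] (m + n) \<otimes> u"
    if "u \<in> carrier G" "g \<in> carrier G" for u g and m n :: nat
    using that by (simp add: m_assoc[symmetric] nat_pow_mult)
  show ?thesis
    by (simp add: m_assoc zx zy yx add nat_pow_mult ac_simps)
qed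

lemma bij_normal_form:
  "bij_betw (\<lambda>(i, j, k). x [^] i \<otimes> y [^] j \<otimes> z [^] k) ({..<p} \<times> {..<p} \<times> {..<p}) (carrier G)"
proof -
  let ?f = "\<lambda>(i::nat, j::nat, k::nat). x [^] i \<otimes> y [^] j \<otimes> z [^] k"
  have ordz: "ord z = p" using z_pow_p z_neq_one by (intro ord_eq_prime prime_p) auto
  have inj: "inj_on ?f ({..<p} \<times> {..<p} \<times> {..<p})"
  proof (rule inj_onI)
    fix u v :: "nat \<times> nat \<times> nat"
    assume uv: "u \<in> {..<p} \<times> {..<p} \<times> {..<p}" "v \<in> {..<p} \<times> {..<p} \<times> {..<p}" "?f u = ?f v"
    obtain i j k i' j' k' where [simp]: "u = (i, j, k)" "v = (i', j', k')"
      by (metis prod_cases3)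
    let ?g = "x [^] i \<otimes> y [^] j \<otimes> z [^] k"
    have eq: "?g = x [^] i' \<otimes> y [^] j' \<otimes> z [^] k'"
      and *: "i < p" "i' < p" "j < p" "j' < p" "k < p" "k' < p" using uv by auto
    \<comment> \<open>Commuting with \<open>x\<close> reveals \<open>j\<close>, commuting with
      \<open>y\<close> reveals \<open>i\<close>, and then \<open>k\<close> follows by
      cancellation.\<close>
    have gx: "(x [^] i \<otimes> y [^] j \<otimes> z [^] k) \<otimes> x = x \<otimes> (x [^] i \<otimes> y [^] j \<otimes> z [^] k) \<otimes> z [^] j" for i j k :: nat
      using mult_normal_form[of i j k 1 0 0] mult_normal_form[of 1 0 0 i j k]
      by (simp add: m_assoc nat_pow_mult)
    have gy: "y \<otimes> (x [^] i \<otimes> y [^] j \<otimes> z [^] k) = (x [^] i \<otimes> y [^] j \<otimes> z [^] k) \<otimes> y \<otimes> z [^] i" for i j k :: nat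
      using mult_normal_form[of 0 1 0 i j k] mult_normal_form[of i j k 0 1 i]
      by (simp add: m_assoc nat_pow_mult)
    have "x \<otimes> ?g \<otimes> z [^] j = x \<otimes> ?g \<otimes> z [^] j'" using gx[of i j k] gx[of i' j' k'] eq by simp
    then have j: "j = j'" using pow_inj_iff[of z j j'] ordz * by simp
    have "?g \<otimes> y \<otimes> z [^] i = ?g \<otimes> y \<otimes> z [^] i'" using gy[of i j k] gy[of i' j' k'] eq by simp
    then have i: "i = i'" using pow_inj_iff[of z i i'] ordz * by simp
    have "k = k'" using eq pow_inj_iff[of z k k'] ordz * by (simp add: i j)
    with i j show "u = v" by simp
  qed
  have "?f ` ({..<p} \<times> {..<p} \<times> {..<p}) = carrier G"
  proof (rule card_subset_eq)
    show "finite (carrier G)"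
      using order_G prime_p by (metis order_gt_0_iff_finite prime_gt_0_nat zero_less_power)
    show "card (?f ` ({..<p} \<times> {..<p} \<times> {..<p})) = card (carrier G)"
      using card_image[OF inj] order_G by (simp add: Coset.order_def card_cartesian_product power3_eq_cube)
  qed auto
  with inj show ?thesis by (simp add: bij_betw_def)
qed

end

lemma (in group) exponent_prime_generators:
  assumes p: "prime p" and ord: "Coset.order G = p ^ 3"
    and ne: "x \<otimes> y \<noteq> y \<otimes> x" and xy: "x \<in> carrier G" "y \<in> carrier G"
    and exp: "\<And>g. g \<in> carrier G \<Longrightarrow> g [^] p = \<one>"
  shows "\<exists>z. heisenberg_pp G p x y z"
proof -
  obtain z where z: "z \<in> group_center G" "y \<otimes> x = x \<otimes> y \<otimes> z"
    using comm_in_center_if_order_prime_cube[OF p ord xy] by auto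
  then have "z \<in> carrier G" "z \<noteq> \<one>" "z \<otimes> x = x \<otimes> z" "z \<otimes> y = y \<otimes> z"
    using ne xy by (auto simp: group_center_def)
  then show ?thesis using z p ord xy exp
    by (auto simp: heisenberg_pp_def heisenberg_pp_axioms_def is_group)
qed

section \<open>Matrix groups and spectral projections\<close>

text \<open>Taking the units of the matrix ring makes the abstract power and commutator lemmas
  available for matrices.\<close>

definition GL :: "nat \<Rightarrow> complex mat monoid" where
  "GL m = units_of (ring_mat TYPE(complex) m ())"

definition scal :: "nat \<Rightarrow> complex \<Rightarrow> complex mat" where
  "scal m c = c \<cdot>\<^sub>m 1\<^sub>m m"

lemma group_GL: "group (GL m)"
proof -
  interpret R: ring "ring_mat TYPE(complex) m ()" by (rule ring_mat)
  show ?thesis unfolding GL_def by (rule R.units_group)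
qed

lemma mult_GL [simp]: "A \<otimes>\<^bsub>GL m\<^esub> B = A * B"
  by (simp add: GL_def units_of_def ring_mat_simps)

lemma one_GL [simp]: "\<one>\<^bsub>GL m\<^esub> = 1\<^sub>m m"
  by (simp add: GL_def units_of_def ring_mat_simps)

lemma carrier_GL_iff: "A \<in> carrier (GL m) \<longleftrightarrow> A \<in> carrier_mat m m \<and> invertible_mat A"
proof -
  have "A \<in> carrier (GL m) \<longleftrightarrow> A \<in> carrier_mat m m \<and> (\<exists>B\<in>carrier_mat m m. B * A = 1\<^sub>m m \<and> A * B = 1\<^sub>m m)"
    by (auto simp: GL_def units_of_def Units_def ring_mat_simps)
  also have "\<dots> \<longleftrightarrow> A \<in> carrier_mat m m \<and> invertible_mat A"
  proof (intro conj_cong refl iffI)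
    assume A: "A \<in> carrier_mat m m"
    assume "\<exists>B\<in>carrier_mat m m. B * A = 1\<^sub>m m \<and> A * B = 1\<^sub>m m"
    with A show "invertible_mat A"
      by (auto simp: invertible_mat_def inverts_mat_def square_mat.simps)
  next
    assume A: "A \<in> carrier_mat m m" and "invertible_mat A"
    then obtain B where B: "A * B = 1\<^sub>m (dim_row A)" "B * A = 1\<^sub>m (dim_row B)"
      by (auto simp: invertible_mat_def inverts_mat_def)
    have "dim_col (A * B) = dim_row A" "dim_col (B * A) = dim_row B" by (simp_all only: B index_one_mat)
    then have "B \<in> carrier_mat m m" using A by auto
    with A B show "\<exists>B\<in>carrier_mat m m. B * A = 1\<^sub>m m \<and> A * B = 1\<^sub>m m" by auto
  qed
  finally show ?thesis .
qed

lemma GL_carrier_mat: "A \<in> carrier (GL m) \<Longrightarrow> A \<in> carrier_mat m m"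
  by (simp add: carrier_GL_iff)

lemma scal_carrier [simp]: "scal m c \<in> carrier_mat m m" by (simp add: scal_def)

lemma scal_mult [simp]: "A \<in> carrier_mat m m \<Longrightarrow> scal m c * A = c \<cdot>\<^sub>m A"
  by (simp add: scal_def mult_smult_assoc_mat[of _ m m])

lemma mult_scal [simp]: "A \<in> carrier_mat m m \<Longrightarrow> A * scal m c = c \<cdot>\<^sub>m A"
  by (simp add: scal_def mult_smult_distrib[where n=m and nc=m])

lemma scal_mult_scal: "scal m c * scal m d = scal m (c * d)"
  by (rule eq_matI) (auto simp: scal_def)

lemma scal_1 [simp]: "scal m 1 = 1\<^sub>m m" 
  by (rule eq_matI) (auto simp: scal_def)

lemma scal_in_GL [simp]: "c \<noteq> 0 \<Longrightarrow> scal m c \<in> carrier (GL m)"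
  unfolding carrier_GL_iff invertible_mat_def inverts_mat_def
  by (auto simp: scal_mult_scal square_mat.simps intro!: exI[of _ "scal m (inverse c)"]) (simp_all add: scal_def)

lemma scal_pow: "scal m c [^]\<^bsub>GL m\<^esub> (n::nat) = scal m (c ^ n)"
  by (induction n) (simp_all add: scal_mult_scal mult.commute)

section \<open>Spectral projections by averaging powers\<close>

text \<open>For \<open>A\<^sup>n = 1\<close> and \<open>w\<^sup>n = 1\<close> this is \<open>n\<close> times the projection onto the \<open>w\<close>-eigenspace of \<open>A\<close>.\<close>

definition spectral_part :: "nat \<Rightarrow> nat \<Rightarrow> complex mat \<Rightarrow> complex \<Rightarrow> complex mat" where
  "spectral_part m n A w = mat m m (\<lambda>(i, j). \<Sum>k<n. inverse w ^ k * (A [^]\<^bsub>GL m\<^esub> k) $$ (i, j))"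

lemma spectral_part_carrier [simp]: "spectral_part m n A w \<in> carrier_mat m m"
  by (simp add: spectral_part_def)

lemma mult_spectral_part_index:
  assumes C: "C \<in> carrier_mat m m" and A: "A \<in> carrier (GL m)" and ij: "i < m" "j < m"
  shows "(C * spectral_part m n A w) $$ (i, j) = (\<Sum>k<n. inverse w ^ k * (C * A [^]\<^bsub>GL m\<^esub> k) $$ (i, j))"
proof -
  interpret group "GL m" by (rule group_GL)
  have Ak: "A [^]\<^bsub>GL m\<^esub> k \<in> carrier_mat m m" for k :: nat using A by (intro GL_carrier_mat) simp
  have "(C * spectral_part m n A w) $$ (i, j) = (\<Sum>l<m. C $$ (i, l) * (\<Sum>k<n. inverse w ^ k * (A [^]\<^bsub>GL m\<^esub> k) $$ (l, j)))"
    using C ij by (simp add: spectral_part_def scalar_prod_def lessThan_atLeast0)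
  also have "\<dots> = (\<Sum>k<n. inverse w ^ k * (\<Sum>l<m. C $$ (i, l) * (A [^]\<^bsub>GL m\<^esub> k) $$ (l, j)))"
    unfolding sum_distrib_left by (subst sum.swap) (simp add: ac_simps)
  also have "\<dots> = (\<Sum>k<n. inverse w ^ k * (C * A [^]\<^bsub>GL m\<^esub> k) $$ (i, j))"
    using C Ak ij by (simp add: scalar_prod_def lessThan_atLeast0 carrier_matD[OF Ak])
  finally show ?thesis .
qed

lemma spectral_part_mult_index:
  assumes C: "C \<in> carrier_mat m m" and A: "A \<in> carrier (GL m)" and ij: "i < m" "j < m"
  shows "(spectral_part m n A w * C) $$ (i, j) = (\<Sum>k<n. inverse w ^ k * (A [^]\<^bsub>GL m\<^esub> k * C) $$ (i, j))"
proof -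
  interpret group "GL m" by (rule group_GL)
  have Ak: "A [^]\<^bsub>GL m\<^esub> k \<in> carrier_mat m m" for k :: nat using A by (intro GL_carrier_mat) simp
  have "(spectral_part m n A w * C) $$ (i, j) = (\<Sum>l<m. (\<Sum>k<n. inverse w ^ k * (A [^]\<^bsub>GL m\<^esub> k) $$ (i, l)) * C $$ (l, j))"
    using C ij by (simp add: spectral_part_def scalar_prod_def lessThan_atLeast0)
  also have "\<dots> = (\<Sum>k<n. inverse w ^ k * (\<Sum>l<m. (A [^]\<^bsub>GL m\<^esub> k) $$ (i, l) * C $$ (l, j)))"
    unfolding sum_distrib_left sum_distrib_right by (subst sum.swap) (simp add: ac_simps)
  also have "\<dots> = (\<Sum>k<n. inverse w ^ k * (A [^]\<^bsub>GL m\<^esub> k * C) $$ (i, j))"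
    using C Ak ij by (simp add: scalar_prod_def lessThan_atLeast0 carrier_matD[OF Ak])
  finally show ?thesis .
qed

lemma spectral_part_commute:
  assumes C: "C \<in> carrier (GL m)" and A: "A \<in> carrier (GL m)" and CA: "C * A = A * C"
  shows "C * spectral_part m n A w = spectral_part m n A w * C"
proof -
  interpret group "GL m" by (rule group_GL)
  have "C * A [^]\<^bsub>GL m\<^esub> k = A [^]\<^bsub>GL m\<^esub> k * C" for k :: nat
    using group_commutes_pow[of A C k] assms by simp
  then show ?thesis
    using GL_carrier_mat[OF C]
    by (intro eq_matI) (simp_all add: mult_spectral_part_index spectral_part_mult_index A
        carrier_matD[OF spectral_part_carrier] del: index_mult_mat(1))
qed

text \<open>Multiplication by \<open>A\<close> shifts the sum by one power, up to the factor
  \<open>w\<close>; the new last term equals the lost first one because \<open>A\<close> and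
  \<open>w\<close> both have trivial n-th power.\<close>

lemma mult_spectral_part:
  assumes A: "A \<in> carrier (GL m)" and An: "A [^]\<^bsub>GL m\<^esub> n = 1\<^sub>m m" and w: "w ^ n = 1" "n > 0"
  shows "A * spectral_part m n A w = w \<cdot>\<^sub>m spectral_part m n A w"
proof (rule eq_matI)
  interpret group "GL m" by (rule group_GL)
  fix i j assume "i < dim_row (w \<cdot>\<^sub>m spectral_part m n A w)" "j < dim_col (w \<cdot>\<^sub>m spectral_part m n A w)"
  then have ij: "i < m" "j < m" by (simp_all add: spectral_part_def)
  have w0: "w \<noteq> 0" using w by (auto simp: power_0_left)
  let ?f = "\<lambda>k. inverse w ^ k * (A [^]\<^bsub>GL m\<^esub> k) $$ (i, j)"
  have S: "A * A [^]\<^bsub>GL m\<^esub> k = A [^]\<^bsub>GL m\<^esub> Suc k" for k :: nat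
    using nat_pow_Suc2[OF A, of k] by simp
  have "(A * spectral_part m n A w) $$ (i, j) = (\<Sum>k<n. inverse w ^ k * (A [^]\<^bsub>GL m\<^esub> Suc k) $$ (i, j))"
    using ij A by (simp only: mult_spectral_part_index GL_carrier_mat S)
  also have "\<dots> = (\<Sum>k<n. w * ?f (Suc k))" using w0 by (simp add: field_simps)
  also have "\<dots> = w * (\<Sum>k<n. ?f (Suc k))" by (simp only: sum_distrib_left)
  also have "(\<Sum>k<n. ?f (Suc k)) = (\<Sum>k<n. ?f k)"
  proof -
    have "?f n = ?f 0" using w An by (simp add: power_inverse del: nat_pow_Suc)
    then show ?thesis using sum.lessThan_Suc_shift[of ?f n] sum.lessThan_Suc[of ?f n] by simp
  qed
  also have "w * (\<Sum>k<n. ?f k) = (w \<cdot>\<^sub>m spectral_part m n A w) $$ (i, j)"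
    using ij by (simp add: spectral_part_def)
  finally show "(A * spectral_part m n A w) $$ (i, j) = (w \<cdot>\<^sub>m spectral_part m n A w) $$ (i, j)" .
qed (use GL_carrier_mat[OF A] in \<open>auto simp: spectral_part_def\<close>)

text \<open>Geometric series in \<open>j\<close> whose ratio is an n-th root of unity different from
  1.\<close>

lemma sum_roots_unity_power:
  assumes "n > 0" "0 < k" "k < n"
  shows "(\<Sum>j<n. inverse (cis (2 * pi * real j / real n)) ^ k) = 0"
proof -
  let ?q = "cis (- (2 * pi * real k / real n))"
  have "(\<Sum>j<n. inverse (cis (2 * pi * real j / real n)) ^ k) = (\<Sum>j<n. ?q ^ j)"
    by (intro sum.cong refl) (simp add: Complex.DeMoivre cis_inverse mult_ac)
  moreover have "?q ^ n = 1"
    using assms cis_multiple_2pi[of "- real k"] by (simp add: Complex.DeMoivre mult_ac)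
  moreover have "?q \<noteq> 1"
  proof
    assume "?q = 1"
    then have "cis (2 * pi * real k / real n) = 1" by (simp add: complex_eq_iff)
    then obtain x :: int where x: "2 * pi * real k / real n = 2 * real_of_int x * pi"
      by (auto simp: complex_eq_iff cos_one_2pi_int)
    then have "real k = real_of_int x * real n" using assms by (simp add: field_simps)
    then have "int k = x * int n" by (metis of_int_eq_iff of_int_mult of_int_of_nat_eq)
    then have "int n dvd int k" by simp
    then show False using assms by (auto dest: dvd_imp_le)
  qed
  ultimately show ?thesis by (simp add: geometric_sum)
qed

text \<open>After exchanging the sums, orthogonality of the roots of unity leaves only the zeroth
  power of \<open>A\<close>. This partition of unity stands in for diagonalizability.\<close>

lemma sum_spectral_part:
  assumes A: "A \<in> carrier (GL m)" and n: "n > 0" and ij: "i < m" "j < m"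
  shows "(\<Sum>l<n. spectral_part m n A (cis (2 * pi * real l / real n)) $$ (i, j)) = of_nat n * 1\<^sub>m m $$ (i, j)"
proof -
  let ?w = "\<lambda>l. inverse (cis (2 * pi * real l / real n))"
  have "(\<Sum>l<n. spectral_part m n A (cis (2 * pi * real l / real n)) $$ (i, j))
      = (\<Sum>k<n. (\<Sum>l<n. ?w l ^ k) * (A [^]\<^bsub>GL m\<^esub> k) $$ (i, j))"
    using ij unfolding spectral_part_def sum_distrib_right by simp (rule sum.swap)
  also have "\<dots> = (\<Sum>k<n. if k = 0 then of_nat n * (A [^]\<^bsub>GL m\<^esub> k) $$ (i, j) else 0)"
    using n sum_roots_unity_power[OF n] by (intro sum.cong refl) (auto simp del: cis_inverse)
  also have "\<dots> = of_nat n * 1\<^sub>m m $$ (i, j)" using n by simp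
  finally show ?thesis .
qed

lemma GL_mult_closed: "A \<in> carrier (GL m) \<Longrightarrow> B \<in> carrier (GL m) \<Longrightarrow> A * B \<in> carrier (GL m)"
  using monoid.m_closed[OF group.is_monoid[OF group_GL]] by fastforce

lemma GL_pow_closed: "A \<in> carrier (GL m) \<Longrightarrow> A [^]\<^bsub>GL m\<^esub> (n::nat) \<in> carrier (GL m)"
  using monoid.nat_pow_closed[OF group.is_monoid[OF group_GL]] by fastforce

lemma smult_mat_mult_vec:
  fixes A :: "'a :: comm_ring_1 mat"
  assumes "A \<in> carrier_mat m n" "v \<in> carrier_vec n"
  shows "(c \<cdot>\<^sub>m A) *\<^sub>v v = c \<cdot>\<^sub>v (A *\<^sub>v v)"
  using assms by (intro eq_vecI) (auto simp: scalar_prod_def sum_distrib_left mult_ac)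

lemma GL_mult_vec_nonzero:
  assumes X: "X \<in> carrier (GL m)" and v: "v \<in> carrier_vec m" "v \<noteq> 0\<^sub>v m"
  shows "X *\<^sub>v v \<noteq> 0\<^sub>v m"
proof
  interpret group "GL m" by (rule group_GL)
  assume *: "X *\<^sub>v v = 0\<^sub>v m"
  have Y: "inv\<^bsub>GL m\<^esub> X \<in> carrier_mat m m" using X by (intro GL_carrier_mat) simp
  have "v = (inv\<^bsub>GL m\<^esub> X * X) *\<^sub>v v" using l_inv[OF X] v by simp
  also have "\<dots> = inv\<^bsub>GL m\<^esub> X *\<^sub>v (X *\<^sub>v v)"
    using Y GL_carrier_mat[OF X] v by (simp add: assoc_mult_mat_vec[of _ m m _ m])
  also have "\<dots> = 0\<^sub>v m" unfolding * using Y by (intro eq_vecI) (auto simp: scalar_prod_def)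
  finally show False using v by simp
qed

lemma GL_smult: "A \<in> carrier (GL m) \<Longrightarrow> c \<noteq> 0 \<Longrightarrow> c \<cdot>\<^sub>m A \<in> carrier (GL m)"
  using GL_mult_closed[of "scal m c" m A] by (simp add: GL_carrier_mat)

lemma GL_smult_pow:
  assumes A: "A \<in> carrier (GL m)" and c: "c \<noteq> 0"
  shows "(c \<cdot>\<^sub>m A) [^]\<^bsub>GL m\<^esub> (n::nat) = c ^ n \<cdot>\<^sub>m (A [^]\<^bsub>GL m\<^esub> n)"
proof -
  interpret group "GL m" by (rule group_GL)
  have "(scal m c \<otimes>\<^bsub>GL m\<^esub> A) [^]\<^bsub>GL m\<^esub> n = scal m c [^]\<^bsub>GL m\<^esub> n \<otimes>\<^bsub>GL m\<^esub> A [^]\<^bsub>GL m\<^esub> n"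
    using A c by (intro pow_mult_distrib) (auto simp: GL_carrier_mat)
  then show ?thesis using A GL_carrier_mat[OF GL_pow_closed[OF A, of n]] by (simp add: scal_pow GL_carrier_mat)
qed

lemma exists_root: "0 < n \<Longrightarrow> \<exists>d. d ^ n = (c::complex)"
  by (intro exI[of _ "rcis (root n (cmod c)) (Arg c / of_nat n)"])
    (simp add: DeMoivre2 rcis_cmod_Arg)

text \<open>If all spectral parts killed \<open>v\<close>, so would their sum, which is
  \<open>n\<close> times the identity.\<close>

lemma exists_spectral_part_nonzero:
  assumes A: "A \<in> carrier (GL m)" and n: "n > 0" and v: "v \<in> carrier_vec m" "v \<noteq> 0\<^sub>v m"
  shows "\<exists>w. w ^ n = 1 \<and> spectral_part m n A w *\<^sub>v v \<noteq> 0\<^sub>v m"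
proof (rule ccontr)
  let ?P = "\<lambda>l. spectral_part m n A (cis (2 * pi * real l / real n))"
  assume "\<not> ?thesis"
  then have 0: "w ^ n = 1 \<Longrightarrow> spectral_part m n A w *\<^sub>v v = 0\<^sub>v m" for w by blast
  have "cis (2 * pi * real l / real n) ^ n = 1" for l
    using n cis_multiple_2pi[of "real l"] by (simp add: Complex.DeMoivre)
  then have P0: "?P l *\<^sub>v v = 0\<^sub>v m" for l using 0 by blast
  have "v $ i = 0" if i: "i < m" for i
  proof -
    have "0 = (\<Sum>l<n. (?P l *\<^sub>v v) $ i)" using i by (simp add: P0)
    also have "\<dots> = (\<Sum>l<n. \<Sum>j<m. ?P l $$ (i, j) * v $ j)"
      using i v by (simp add: scalar_prod_def lessThan_atLeast0 carrier_matD[OF spectral_part_carrier])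
    also have "\<dots> = (\<Sum>j<m. (\<Sum>l<n. ?P l $$ (i, j)) * v $ j)"
      unfolding sum_distrib_right by (rule sum.swap)
    also have "\<dots> = (\<Sum>j<m. if j = i then of_nat n * v $ j else 0)"
      using i by (intro sum.cong refl) (simp add: sum_spectral_part[OF A n])
    also have "\<dots> = of_nat n * v $ i" using i by simp
    finally show ?thesis using n by simp
  qed
  then have "v = 0\<^sub>v m" using v(1) by (intro eq_vecI) auto
  with v(2) show False by simp
qed

text \<open>A nonzero spectral part of \<open>A\<close> applied to \<open>v\<close> is an
  eigenvector of \<open>A\<close>, and it stays in the eigenspace of \<open>Z\<close> because
  spectral parts of \<open>A\<close> commute with \<open>Z\<close>.\<close>

lemma eigenvector_in_eigenspace:
  assumes A: "A \<in> carrier (GL m)" and An: "A [^]\<^bsub>GL m\<^esub> (n::nat) = scal m c" and n: "n > 0" and c: "c \<noteq> 0"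
    and v: "v \<in> carrier_vec m" "v \<noteq> 0\<^sub>v m"
    and Z: "Z \<in> carrier (GL m)" "Z * A = A * Z" "Z *\<^sub>v v = z \<cdot>\<^sub>v v"
  shows "\<exists>w u. u \<in> carrier_vec m \<and> u \<noteq> 0\<^sub>v m \<and> A *\<^sub>v u = w \<cdot>\<^sub>v u \<and> Z *\<^sub>v u = z \<cdot>\<^sub>v u"
proof -
  \<comment> \<open>Only a scalar power of \<open>A\<close> is given; this root rescales
    \<open>A\<close> to a matrix with trivial n-th power.\<close>
  obtain d where d: "d ^ n = inverse c" using exists_root[OF n] by blast
  have d0: "d \<noteq> 0" using d c n by (auto simp: power_0_left)
  define B where "B = d \<cdot>\<^sub>m A"
  have B: "B \<in> carrier (GL m)" unfolding B_def by (rule GL_smult[OF A d0])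
  have Bn: "B [^]\<^bsub>GL m\<^esub> n = 1\<^sub>m m"
    unfolding B_def GL_smult_pow[OF A d0] An d using c by (intro eq_matI) (auto simp: scal_def)
  have ZB: "Z * B = B * Z"
    using Z GL_carrier_mat[OF Z(1)] GL_carrier_mat[OF A]
    by (simp add: B_def mult_smult_assoc_mat[of _ m m] mult_smult_distrib[where n=m and nc=m])
  obtain w where w: "w ^ n = 1" "spectral_part m n B w *\<^sub>v v \<noteq> 0\<^sub>v m"
    using exists_spectral_part_nonzero[OF B n v] by blast
  let ?P = "spectral_part m n B w"
  let ?u = "?P *\<^sub>v v"
  have Am: "A \<in> carrier_mat m m" and Bm: "B \<in> carrier_mat m m" and Zm: "Z \<in> carrier_mat m m"
    using A B Z by (auto simp: GL_carrier_mat)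
  have u: "?u \<in> carrier_vec m" by (rule mult_mat_vec_carrier[OF spectral_part_carrier v(1)])
  have "d \<cdot>\<^sub>v (A *\<^sub>v ?u) = B *\<^sub>v ?u"
    using Am u by (simp add: B_def smult_mat_mult_vec)
  also have "\<dots> = (B * ?P) *\<^sub>v v"
    using Bm v by (intro assoc_mult_mat_vec[of _ m m _ m, symmetric]) auto
  also have "\<dots> = w \<cdot>\<^sub>v ?u"
    unfolding mult_spectral_part[OF B Bn w(1) n] by (rule smult_mat_mult_vec[OF spectral_part_carrier v(1)])
  finally have "inverse d \<cdot>\<^sub>v (d \<cdot>\<^sub>v (A *\<^sub>v ?u)) = inverse d \<cdot>\<^sub>v (w \<cdot>\<^sub>v ?u)" by simp
  then have Au: "A *\<^sub>v ?u = (inverse d * w) \<cdot>\<^sub>v ?u"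
    using d0 by (simp add: smult_smult_assoc)
  have "Z *\<^sub>v ?u = (Z * ?P) *\<^sub>v v"
    using Zm v by (intro assoc_mult_mat_vec[of _ m m _ m, symmetric]) auto
  also have "\<dots> = ?P *\<^sub>v (Z *\<^sub>v v)"
    unfolding spectral_part_commute[OF Z(1) B ZB] using Zm v by (intro assoc_mult_mat_vec[of _ m m _ m]) auto
  also have "\<dots> = z \<cdot>\<^sub>v ?u"
    unfolding Z(3) using v by (intro mult_mat_vec[of _ m m]) auto
  finally show ?thesis using u w(2) Au by blast
qed

text \<open>Each column of a spectral part is zero or an eigenvector, so \<open>A\<close> acts on
  every spectral part as \<open>z\<close>, and hence on their sum. Used contrapositively, it
  produces an eigenvalue different from a given \<open>z\<close>.\<close>

lemma eq_scal_if_unique_eigenvalue: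
  assumes A: "A \<in> carrier (GL m)" and An: "A [^]\<^bsub>GL m\<^esub> (n::nat) = 1\<^sub>m m" and n: "n > 0"
    and uniq: "\<And>w u. u \<in> carrier_vec m \<Longrightarrow> u \<noteq> 0\<^sub>v m \<Longrightarrow> A *\<^sub>v u = w \<cdot>\<^sub>v u \<Longrightarrow> w = z"
  shows "A = scal m z"
proof (rule eq_matI)
  have Am: "A \<in> carrier_mat m m" using A by (rule GL_carrier_mat)
  let ?P = "\<lambda>l. spectral_part m n A (cis (2 * pi * real l / real n))"
  have P: "A * ?P l = z \<cdot>\<^sub>m ?P l" for l
  proof (rule mat_col_eqI)
    let ?w = "cis (2 * pi * real l / real n)"
    have w: "?w ^ n = 1" using n cis_multiple_2pi[of "real l"] by (simp add: Complex.DeMoivre)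
    fix j assume "j < dim_col (z \<cdot>\<^sub>m ?P l)"
    then have j: "j < m" by (simp add: carrier_matD[OF spectral_part_carrier])
    have c: "col (?P l) j \<in> carrier_vec m" by (simp add: carrier_matD[OF spectral_part_carrier] carrier_vecI)
    have e: "A *\<^sub>v col (?P l) j = ?w \<cdot>\<^sub>v col (?P l) j"
      using arg_cong[OF mult_spectral_part[OF A An w n], of "\<lambda>M. col M j"] j
        col_mult2[OF Am spectral_part_carrier j]
      by (simp add: carrier_matD[OF spectral_part_carrier])
    have "?w \<cdot>\<^sub>v col (?P l) j = z \<cdot>\<^sub>v col (?P l) j"
    proof (cases "col (?P l) j = 0\<^sub>v m")
      case False
      then have "?w = z" using uniq[OF c False e] by simp
      then show ?thesis by simp
    qed (auto intro!: eq_vecI)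
    then show "col (A * ?P l) j = col (z \<cdot>\<^sub>m ?P l) j"
      using e col_mult2[OF Am spectral_part_carrier j] j
      by (metis carrier_matD(2) col_smult spectral_part_carrier)
  qed (use Am in \<open>auto simp: carrier_matD[OF spectral_part_carrier]\<close>)
  fix i j assume "i < dim_row (scal m z)" "j < dim_col (scal m z)"
  then have ij: "i < m" "j < m" by (simp_all add: scal_def)
  have "of_nat n * A $$ (i, j) = (\<Sum>k<m. if k = j then A $$ (i, k) * of_nat n else 0)"
    using ij by (simp add: mult.commute)
  also have "\<dots> = (\<Sum>k<m. A $$ (i, k) * (\<Sum>l<n. ?P l $$ (k, j)))"
    using ij by (intro sum.cong refl) (simp add: sum_spectral_part[OF A n])
  also have "\<dots> = (\<Sum>l<n. \<Sum>k<m. A $$ (i, k) * ?P l $$ (k, j))"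
    unfolding sum_distrib_left by (rule sum.swap)
  also have "\<dots> = (\<Sum>l<n. (A * ?P l) $$ (i, j))"
    using ij Am by (simp add: scalar_prod_def lessThan_atLeast0 carrier_matD[OF spectral_part_carrier])
  also have "\<dots> = z * (\<Sum>l<n. ?P l $$ (i, j))"
    unfolding P sum_distrib_left using ij by (simp add: carrier_matD[OF spectral_part_carrier])
  also have "\<dots> = of_nat n * scal m z $$ (i, j)"
    using ij by (simp add: sum_spectral_part[OF A n] scal_def)
  finally show "A $$ (i, j) = scal m z $$ (i, j)" using n by simp
qed (use GL_carrier_mat[OF A] in \<open>auto simp: scal_def\<close>)

section \<open>Orbits of eigenvalues and degree bounds\<close>

lemma card_eigenvalues_le:
  fixes A :: "complex mat"
  assumes A: "A \<in> carrier_mat m m"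
    and ev: "\<And>w. w \<in> E \<Longrightarrow> \<exists>u. u \<in> carrier_vec m \<and> u \<noteq> 0\<^sub>v m \<and> A *\<^sub>v u = w \<cdot>\<^sub>v u"
  shows "card E \<le> m"
proof -
  have "E \<subseteq> {w. poly (char_poly A) w = 0}"
    using ev A by (auto simp: eigenvalue_root_char_poly[OF A, symmetric] eigenvalue_def eigenvector_def)
  moreover have d: "degree (char_poly A) = m" "coeff (char_poly A) m = 1"
    using degree_monic_char_poly[OF A] by auto
  moreover have "char_poly A \<noteq> 0" using d by auto
  ultimately have "card E \<le> card {w. poly (char_poly A) w = 0}"
    by (intro card_mono poly_roots_finite)
  also have "\<dots> \<le> m" using card_poly_roots_bound[OF \<open>char_poly A \<noteq> 0\<close>] d by simp
  finally show ?thesis .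
qed

lemma root_unity_prime_eq_one:
  fixes z :: complex
  assumes p: "prime p" and z: "z ^ p = 1" "z ^ d = 1" and d: "0 < d" "d < p"
  shows "z = 1"
proof -
  have "coprime d p" using p d by (metis coprime_commute nat_dvd_not_less prime_imp_coprime)
  then obtain x y where "d * x = p * y + 1"
    using bezout_nat[of d p] d by auto
  then have "z ^ (d * x) = z ^ (p * y + 1)" by simp
  then show ?thesis using z by (simp add: power_mult power_add)
qed

text \<open>\<open>X\<close> carries an eigenvector of \<open>Y\<close> for \<open>l\<close> to one
  for \<open>l * z\<close> inside the same eigenspace of \<open>Z\<close>. Recording the eigenvalue
  of \<open>Z\<close> allows a later comparison with eigenvalues of \<open>Y\<close> lying over
  another eigenvalue of \<open>Z\<close>.\<close>

lemma exists_p_eigenvalues: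
  assumes p: "prime p" and X: "X \<in> carrier (GL m)" and Y: "Y \<in> carrier (GL m)" and Z: "Z \<in> carrier (GL m)"
    and YX: "Y * X = X * Y * Z" and ZX: "Z * X = X * Z" and ZY: "Z * Y = Y * Z"
    and Zp: "Z [^]\<^bsub>GL m\<^esub> p = 1\<^sub>m m" and Yn: "Y [^]\<^bsub>GL m\<^esub> (n::nat) = scal m c" "n > 0" "c \<noteq> 0"
    and v: "v \<in> carrier_vec m" "v \<noteq> 0\<^sub>v m" "Z *\<^sub>v v = z \<cdot>\<^sub>v v" and z: "z \<noteq> 1"
  shows "\<exists>E. card E = p \<and> (\<forall>w\<in>E. \<exists>u. u \<in> carrier_vec m \<and> u \<noteq> 0\<^sub>v m \<and> Y *\<^sub>v u = w \<cdot>\<^sub>v u \<and> Z *\<^sub>v u = z \<cdot>\<^sub>v u)"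
proof -
  note mats = GL_carrier_mat[OF X] GL_carrier_mat[OF Y] GL_carrier_mat[OF Z]
  obtain l u where u: "u \<in> carrier_vec m" "u \<noteq> 0\<^sub>v m" "Y *\<^sub>v u = l \<cdot>\<^sub>v u" "Z *\<^sub>v u = z \<cdot>\<^sub>v u"
    using eigenvector_in_eigenspace[OF Y Yn v(1,2) Z ZY v(3)] by blast
  \<comment> \<open>Invertibility of \<open>Y\<close> enters here; without it the orbit of
    \<open>l\<close> could collapse to 0.\<close>
  have "l \<noteq> 0" using GL_mult_vec_nonzero[OF Y u(1,2)] u by auto
  have ev: "\<exists>u. u \<in> carrier_vec m \<and> u \<noteq> 0\<^sub>v m \<and> Y *\<^sub>v u = (l * z ^ k) \<cdot>\<^sub>v u \<and> Z *\<^sub>v u = z \<cdot>\<^sub>v u" for k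
  proof (induction k)
    case (Suc k)
    then obtain u where u: "u \<in> carrier_vec m" "u \<noteq> 0\<^sub>v m" "Y *\<^sub>v u = (l * z ^ k) \<cdot>\<^sub>v u" "Z *\<^sub>v u = z \<cdot>\<^sub>v u"
      by blast
    have "Y *\<^sub>v (X *\<^sub>v u) = (X * Y * Z) *\<^sub>v u"
      using mats u by (simp add: YX[symmetric] assoc_mult_mat_vec[of _ m m _ m])
    also have "\<dots> = X *\<^sub>v (Y *\<^sub>v (Z *\<^sub>v u))" using mats u by (simp add: assoc_mult_mat_vec[of _ m m _ m])
    also have "\<dots> = (l * z ^ Suc k) \<cdot>\<^sub>v (X *\<^sub>v u)"
      using mats u by (simp add: mult_mat_vec[of _ m m] smult_smult_assoc mult_ac)
    finally have 1: "Y *\<^sub>v (X *\<^sub>v u) = (l * z ^ Suc k) \<cdot>\<^sub>v (X *\<^sub>v u)" .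
    have "Z *\<^sub>v (X *\<^sub>v u) = (X * Z) *\<^sub>v u"
      using mats u by (simp add: ZX[symmetric] assoc_mult_mat_vec[of _ m m _ m])
    also have "\<dots> = X *\<^sub>v (Z *\<^sub>v u)"
      using mats u by (simp add: assoc_mult_mat_vec[of _ m m _ m])
    also have "\<dots> = z \<cdot>\<^sub>v (X *\<^sub>v u)" using mats u by (simp add: mult_mat_vec[of _ m m])
    finally show ?case using 1 GL_mult_vec_nonzero[OF X u(1,2)] mats u by (intro exI[of _ "X *\<^sub>v u"]) auto
  qed (use u in auto)
  have zp: "z ^ p = 1"
  proof -
    have "(Z [^]\<^bsub>GL m\<^esub> k) *\<^sub>v u = z ^ k \<cdot>\<^sub>v u" for k :: nat
    proof (induction k)
      case (Suc k)
      have "(Z [^]\<^bsub>GL m\<^esub> Suc k) *\<^sub>v u = (Z [^]\<^bsub>GL m\<^esub> k) *\<^sub>v (Z *\<^sub>v u)"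
        using mats u GL_carrier_mat[OF GL_pow_closed[OF Z, of k]] by (simp add: assoc_mult_mat_vec[of _ m m _ m])
      then show ?case using u Suc GL_carrier_mat[OF GL_pow_closed[OF Z, of k]]
        by (simp add: mult_mat_vec[of _ m m] smult_smult_assoc mult_ac)
    qed (use u in simp)
    from this[of p] have "1 \<cdot>\<^sub>v u = z ^ p \<cdot>\<^sub>v u" using Zp u by simp
    moreover obtain i where "i < m" "u $ i \<noteq> 0"
      using u(1,2) by (metis carrier_vecD eq_vecI index_zero_vec)
    ultimately have "(1 \<cdot>\<^sub>v u) $ i = (z ^ p \<cdot>\<^sub>v u) $ i" by simp
    then show ?thesis using \<open>u $ i \<noteq> 0\<close> \<open>i < m\<close> u(1) by simp
  qed
  \<comment> \<open>As \<open>p\<close> is prime and \<open>z\<close> is not 1, \<open>z\<close> has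
    order exactly \<open>p\<close>, so the orbit has full length.\<close>
  have "inj_on (\<lambda>k. l * z ^ k) {..<p}"
  proof (rule linorder_inj_onI)
    fix i j assume "i < j" "j \<in> {..<p}"
    then have "0 < j - i" "j - i < p" by auto
    then have "z ^ (j - i) \<noteq> 1" using root_unity_prime_eq_one[OF p zp, of "j - i"] z by blast
    moreover have "z ^ j = z ^ i * z ^ (j - i)" using \<open>i < j\<close> by (simp add: power_add[symmetric])
    moreover have "z \<noteq> 0" using zp p by (auto simp: power_0_left)
    ultimately show "l * z ^ i \<noteq> l * z ^ j" using \<open>l \<noteq> 0\<close> by simp
  qed auto
  then have "card ((\<lambda>k. l * z ^ k) ` {..<p}) = p" by (simp add: card_image)
  with ev show ?thesis by (intro exI[of _ "(\<lambda>k. l * z ^ k) ` {..<p}"]) blast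
qed

lemma heisenberg_degree_bound:
  assumes p: "prime p" and X: "X \<in> carrier (GL m)" and Y: "Y \<in> carrier (GL m)" and Z: "Z \<in> carrier (GL m)"
    and YX: "Y * X = X * Y * Z" and ZX: "Z * X = X * Z" and ZY: "Z * Y = Y * Z"
    and Zp: "Z [^]\<^bsub>GL m\<^esub> p = 1\<^sub>m m" and Yn: "Y [^]\<^bsub>GL m\<^esub> (n::nat) = scal m c" "n > 0" "c \<noteq> 0"
    and Z1: "Z \<noteq> 1\<^sub>m m"
  shows "p \<le> m"
proof -
  obtain z v where v: "v \<in> carrier_vec m" "v \<noteq> 0\<^sub>v m" "Z *\<^sub>v v = z \<cdot>\<^sub>v v" "z \<noteq> 1"
    using eq_scal_if_unique_eigenvalue[OF Z Zp, of 1] Z1 prime_gt_0_nat[OF p] by auto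
  obtain E where "card E = p" "\<forall>w\<in>E. \<exists>u. u \<in> carrier_vec m \<and> u \<noteq> 0\<^sub>v m \<and> Y *\<^sub>v u = w \<cdot>\<^sub>v u \<and> Z *\<^sub>v u = z \<cdot>\<^sub>v u"
    using exists_p_eigenvalues[OF p X Y Z YX ZX ZY Zp Yn v] by blast
  then show ?thesis using card_eigenvalues_le[OF GL_carrier_mat[OF Y], of E] by blast
qed

lemma metacyclic_degree_bound:
  assumes p: "prime p" and A: "A \<in> carrier (GL m)" and B: "B \<in> carrier (GL m)"
    and AB: "A * B = B * A [^]\<^bsub>GL m\<^esub> Suc p" and Ap: "A [^]\<^bsub>GL m\<^esub> (p\<^sup>2) = 1\<^sub>m m"
    and ns: "\<And>c. A [^]\<^bsub>GL m\<^esub> p \<noteq> scal m c"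
  shows "Suc p \<le> m"
proof -
  interpret group "GL m" by (rule group_GL)
  let ?Z = "A [^]\<^bsub>GL m\<^esub> p"
  have p0: "p > 0" "p\<^sup>2 > 0" using prime_gt_0_nat[OF p] by simp_all
  note mats = GL_carrier_mat[OF A] GL_carrier_mat[OF B] GL_carrier_mat[OF GL_pow_closed[OF A]]
  have Z: "?Z \<in> carrier (GL m)" using A by simp
  have ZA: "?Z * A = A * ?Z" using group_commutes_pow[of A A p] A by simp
  have Zp: "?Z [^]\<^bsub>GL m\<^esub> p = 1\<^sub>m m" using Ap A by (simp add: nat_pow_pow power2_eq_square)
  have YX: "A * B = B * A * ?Z" using AB mats ZA by (simp add: assoc_mult_mat[of _ m m _ m _ m])
  have ZB: "?Z * B = B * ?Z"
    using comm_pow_left[of A B ?Z p] YX ZA A B Z Zp mats by (simp add: carrier_matD[OF mats(3)])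
  have An: "A [^]\<^bsub>GL m\<^esub> p\<^sup>2 = scal m 1" using Ap by simp
  obtain z1 v1 where v1: "v1 \<in> carrier_vec m" "v1 \<noteq> 0\<^sub>v m" "?Z *\<^sub>v v1 = z1 \<cdot>\<^sub>v v1" "z1 \<noteq> 1"
    using eq_scal_if_unique_eigenvalue[OF Z Zp p0(1), of 1] ns[of 1] by auto
  \<comment> \<open>\<open>z2\<close> may be 1, so over it only a single further eigenvalue of
    \<open>A\<close> is guaranteed.\<close>
  obtain z2 v2 where v2: "v2 \<in> carrier_vec m" "v2 \<noteq> 0\<^sub>v m" "?Z *\<^sub>v v2 = z2 \<cdot>\<^sub>v v2" "z2 \<noteq> z1"
    using eq_scal_if_unique_eigenvalue[OF Z Zp p0(1), of z1] ns[of z1] by auto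
  \<comment> \<open>The orbit lemma is applied with \<open>X = B\<close>, \<open>Y = A\<close> and
    \<open>Z\<close> the p-th power of \<open>A\<close>.\<close>
  obtain E where E: "card E = p" "\<forall>w\<in>E. \<exists>u. u \<in> carrier_vec m \<and> u \<noteq> 0\<^sub>v m \<and> A *\<^sub>v u = w \<cdot>\<^sub>v u \<and> ?Z *\<^sub>v u = z1 \<cdot>\<^sub>v u"
    using exists_p_eigenvalues[OF p B A Z YX ZB ZA Zp An p0(2) _ v1] by auto
  obtain w u where u: "u \<in> carrier_vec m" "u \<noteq> 0\<^sub>v m" "A *\<^sub>v u = w \<cdot>\<^sub>v u" "?Z *\<^sub>v u = z2 \<cdot>\<^sub>v u"
    using eigenvector_in_eigenspace[OF A An p0(2) _ v2(1,2) Z ZA v2(3)] by auto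
  \<comment> \<open>The p-th power of an eigenvalue of \<open>A\<close> is the eigenvalue of
    \<open>?Z\<close> on the same vector; hence eigenvalues of \<open>A\<close> over
    \<open>z1\<close> and over \<open>z2\<close> are distinct.\<close>
  have pow: "z = w ^ p" if uw: "u \<in> carrier_vec m" "u \<noteq> 0\<^sub>v m" "A *\<^sub>v u = w \<cdot>\<^sub>v u" "?Z *\<^sub>v u = z \<cdot>\<^sub>v u" for u w z
  proof -
    have "(A [^]\<^bsub>GL m\<^esub> k) *\<^sub>v u = w ^ k \<cdot>\<^sub>v u" for k :: nat
    proof (induction k)
      case (Suc k)
      have "(A [^]\<^bsub>GL m\<^esub> Suc k) *\<^sub>v u = (A [^]\<^bsub>GL m\<^esub> k) *\<^sub>v (A *\<^sub>v u)"
        using mats uw(1) by (simp add: assoc_mult_mat_vec[of _ m m _ m])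
      then show ?case using uw(1,3) Suc mats(3)[of k]
        by (simp add: mult_mat_vec[of _ m m] smult_smult_assoc mult_ac)
    qed (use uw in simp)
    from this[of p] have "z \<cdot>\<^sub>v u = w ^ p \<cdot>\<^sub>v u" using uw by simp
    moreover obtain i where "i < m" "u $ i \<noteq> 0"
      using uw(1,2) by (metis carrier_vecD eq_vecI index_zero_vec)
    ultimately have "(z \<cdot>\<^sub>v u) $ i = (w ^ p \<cdot>\<^sub>v u) $ i" by simp
    then show ?thesis using \<open>u $ i \<noteq> 0\<close> \<open>i < m\<close> uw(1) by simp
  qed
  have "w \<notin> E"
  proof
    assume "w \<in> E"
    then have "z1 = w ^ p" using E pow by blast
    then show False using pow[OF u] v2(4) by simp
  qed
  moreover have "finite E" using E(1) p0 card_ge_0_finite by auto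
  ultimately have "card (insert w E) = Suc p" using E(1) by simp
  moreover have "card (insert w E) \<le> m"
    using E(2) u by (intro card_eigenvalues_le[OF GL_carrier_mat[OF A]]) blast
  ultimately show ?thesis by simp
qed

section \<open>Lower bounds and reducibility\<close>

locale faithful_proj = group G for G (structure) +
  fixes m :: nat and \<rho> :: "'a \<Rightarrow> complex mat"
  assumes faithful: "faithful_proj_rep G m \<rho>"
begin

lemma rep_in_GL: "g \<in> carrier G \<Longrightarrow> \<rho> g \<in> carrier (GL m)"
  using faithful by (simp add: faithful_proj_rep_def proj_rep_def carrier_GL_iff)

lemma rep_carrier_mat: "g \<in> carrier G \<Longrightarrow> \<rho> g \<in> carrier_mat m m"
  using rep_in_GL by (rule GL_carrier_mat)

lemma rep_one: "\<rho> \<one> = 1\<^sub>m m"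
  using faithful by (simp add: faithful_proj_rep_def proj_rep_def)

lemma degree_pos: "0 < m"
  using faithful by (simp add: faithful_proj_rep_def proj_rep_def)

lemma rep_mult: "g \<in> carrier G \<Longrightarrow> h \<in> carrier G \<Longrightarrow> \<exists>c. c \<noteq> 0 \<and> \<rho> g * \<rho> h = c \<cdot>\<^sub>m \<rho> (g \<otimes> h)"
  using faithful unfolding faithful_proj_rep_def proj_rep_def by blast

lemma rep_mult': "g \<in> carrier G \<Longrightarrow> h \<in> carrier G \<Longrightarrow> \<exists>c. c \<noteq> 0 \<and> \<rho> (g \<otimes> h) = c \<cdot>\<^sub>m (\<rho> g * \<rho> h)"
proof -
  assume "g \<in> carrier G" "h \<in> carrier G"
  then obtain c where c: "c \<noteq> 0" "\<rho> g * \<rho> h = c \<cdot>\<^sub>m \<rho> (g \<otimes> h)" using rep_mult by blast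
  then have "\<rho> (g \<otimes> h) = inverse c \<cdot>\<^sub>m (\<rho> g * \<rho> h)" by (intro eq_matI) auto
  with c show ?thesis by (intro exI[of _ "inverse c"]) simp
qed

lemma rep_pow:
  assumes g: "g \<in> carrier G"
  shows "\<exists>c. c \<noteq> 0 \<and> \<rho> (g [^] (n::nat)) = c \<cdot>\<^sub>m (\<rho> g [^]\<^bsub>GL m\<^esub> n)"
proof (induction n)
  case 0
  then show ?case by (intro exI[of _ 1]) (auto simp: rep_one intro!: eq_matI)
next
  case (Suc n)
  then obtain c where c: "c \<noteq> 0" "\<rho> (g [^] n) = c \<cdot>\<^sub>m (\<rho> g [^]\<^bsub>GL m\<^esub> n)" by blast
  obtain d where d: "d \<noteq> 0" "\<rho> (g [^] n \<otimes> g) = d \<cdot>\<^sub>m (\<rho> (g [^] n) * \<rho> g)"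
    using rep_mult'[of "g [^] n" g] g by auto
  have "\<rho> (g [^] Suc n) = (d * c) \<cdot>\<^sub>m (\<rho> g [^]\<^bsub>GL m\<^esub> Suc n)"
    using d(2) rep_carrier_mat[OF g] GL_carrier_mat[OF GL_pow_closed[OF rep_in_GL[OF g], of n]]
    by (simp add: c(2) mult_smult_assoc_mat[of _ m m]) (auto intro!: eq_matI)
  with c d show ?case by (intro exI[of _ "d * c"]) simp
qed

lemma rep_pow_scal:
  assumes g: "g \<in> carrier G" and 1: "g [^] (n::nat) = \<one>" and c: "c \<noteq> 0"
  shows "\<exists>d. d \<noteq> 0 \<and> (c \<cdot>\<^sub>m \<rho> g) [^]\<^bsub>GL m\<^esub> n = scal m d"
proof -
  obtain e where e: "e \<noteq> 0" "\<rho> (g [^] n) = e \<cdot>\<^sub>m (\<rho> g [^]\<^bsub>GL m\<^esub> n)" using rep_pow[OF g] by blast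
  have "\<rho> g [^]\<^bsub>GL m\<^esub> n = inverse e \<cdot>\<^sub>m (e \<cdot>\<^sub>m (\<rho> g [^]\<^bsub>GL m\<^esub> n))"
    using e(1) by (intro eq_matI) auto
  also have "e \<cdot>\<^sub>m (\<rho> g [^]\<^bsub>GL m\<^esub> n) = 1\<^sub>m m" using e(2) 1 rep_one by simp
  finally have "(c \<cdot>\<^sub>m \<rho> g) [^]\<^bsub>GL m\<^esub> n = scal m (c ^ n * inverse e)"
    unfolding GL_smult_pow[OF rep_in_GL[OF g] c] by (auto simp: scal_def intro!: eq_matI)
  then show ?thesis using e c by (intro exI[of _ "c ^ n * inverse e"]) simp
qed

lemma eq_one_if_scal: "g \<in> carrier G \<Longrightarrow> \<rho> g = scal m c \<Longrightarrow> g = \<one>"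
  using faithful by (auto simp: faithful_proj_rep_def scal_def)

lemma eq_one_if_smult_scal:
  assumes "g \<in> carrier G" "c \<noteq> 0" "c \<cdot>\<^sub>m \<rho> g = scal m d"
  shows "g = \<one>"
proof -
  have "\<rho> g = inverse c \<cdot>\<^sub>m (c \<cdot>\<^sub>m \<rho> g)" using assms(2) by (intro eq_matI) auto
  also have "\<dots> = scal m (inverse c * d)" unfolding assms(3) by (auto simp: scal_def intro!: eq_matI)
  finally show ?thesis using eq_one_if_scal assms(1) by blast
qed

text \<open>Faithfulness in the form needed after rescaling: a power of a multiple of
  \<open>\<rho> g\<close> is a nonzero multiple of the matrix of a power of
  \<open>g\<close>.\<close>

lemma eq_one_if_smult_pow_scal:
  assumes g: "g \<in> carrier G" and c: "c \<noteq> 0" and eq: "(c \<cdot>\<^sub>m \<rho> g) [^]\<^bsub>GL m\<^esub> (n::nat) = scal m d"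
  shows "g [^] n = \<one>"
proof -
  obtain e where e: "e \<noteq> 0" "\<rho> (g [^] n) = e \<cdot>\<^sub>m (\<rho> g [^]\<^bsub>GL m\<^esub> n)" using rep_pow[OF g] by blast
  have "(c ^ n * inverse e) \<cdot>\<^sub>m \<rho> (g [^] n) = c ^ n \<cdot>\<^sub>m (\<rho> g [^]\<^bsub>GL m\<^esub> n)"
    unfolding e(2) using e(1) by (intro eq_matI) auto
  also have "\<dots> = scal m d" using eq GL_smult_pow[OF rep_in_GL[OF g] c] by simp
  finally show ?thesis using g c e by (intro eq_one_if_smult_scal) auto
qed

end

lemma commutes_smult:
  fixes A :: "complex mat"
  assumes "A \<in> carrier_mat m m" "B \<in> carrier_mat m m" "A * B = B * A"
  shows "A * (c \<cdot>\<^sub>m B) = (c \<cdot>\<^sub>m B) * A"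
  using assms by (simp add: mult_smult_assoc_mat[of _ m m] mult_smult_distrib[where n=m and nc=m])

text \<open>Schur's lemma: an eigenspace of \<open>Z\<close> is invariant and nonzero, hence
  everything. The eigenvector comes from the assumption that some power of \<open>Z\<close> is
  scalar.\<close>

lemma eq_scal_if_commutes_irreducible:
  assumes irr: "irreducible_proj_rep G m \<rho>" and Z: "Z \<in> carrier (GL m)" and m: "0 < m"
    and comm: "\<And>g. g \<in> carrier G \<Longrightarrow> Z * \<rho> g = \<rho> g * Z"
    and Zn: "Z [^]\<^bsub>GL m\<^esub> (n::nat) = scal m c" "n > 0" "c \<noteq> 0"
  shows "\<exists>z. Z = scal m z"
proof -
  have Zm: "Z \<in> carrier_mat m m" using Z by (rule GL_carrier_mat)
  have rm: "\<rho> g \<in> carrier_mat m m" if "g \<in> carrier G" for g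
    using irr that by (auto simp: irreducible_proj_rep_def proj_rep_def)
  have e0: "unit_vec m 0 \<noteq> (0\<^sub>v m :: complex vec)"
    using m by (metis index_unit_vec(1) index_zero_vec(1) zero_neq_one)
  \<comment> \<open>The simultaneous eigenvector lemma is used with the identity as second matrix,
    starting from a unit vector.\<close>
  obtain z u where u: "u \<in> carrier_vec m" "u \<noteq> 0\<^sub>v m" "Z *\<^sub>v u = z \<cdot>\<^sub>v u"
    using eigenvector_in_eigenspace[OF Z Zn unit_vec_carrier e0, of "1\<^sub>m m" 1] Z scal_in_GL[of 1 m] Zm by auto
  let ?W = "{v \<in> carrier_vec m. Z *\<^sub>v v = z \<cdot>\<^sub>v v}"
  have "invariant_subspace m \<rho> (carrier G) ?W"
    unfolding invariant_subspace_def
  proof (intro conjI ballI allI)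
    show "0\<^sub>v m \<in> ?W" using Zm by (auto intro!: eq_vecI simp: scalar_prod_def)
  next
    fix v w assume "v \<in> ?W" "w \<in> ?W"
    then show "v + w \<in> ?W" using Zm by (simp add: mult_add_distrib_mat_vec[of _ m m] smult_add_distrib_vec[of _ m])
  next
    fix c v assume "v \<in> ?W"
    then show "c \<cdot>\<^sub>v v \<in> ?W" using Zm by (simp add: mult_mat_vec[of _ m m] smult_smult_assoc mult.commute)
  next
    fix g v assume g: "g \<in> carrier G" and v: "v \<in> ?W"
    have "Z *\<^sub>v (\<rho> g *\<^sub>v v) = (\<rho> g * Z) *\<^sub>v v"
      using Zm rm[OF g] v by (simp add: comm[OF g, symmetric] assoc_mult_mat_vec[of _ m m _ m])
    also have "\<dots> = z \<cdot>\<^sub>v (\<rho> g *\<^sub>v v)"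
      using Zm rm[OF g] v by (simp add: assoc_mult_mat_vec[of _ m m _ m] mult_mat_vec[of _ m m])
    finally show "\<rho> g *\<^sub>v v \<in> ?W" using rm[OF g] v by auto
  qed auto
  moreover have "?W \<noteq> {0\<^sub>v m}" using u by auto
  ultimately have "?W = carrier_vec m" using irr by (auto simp: irreducible_proj_rep_def)
  then have W: "Z *\<^sub>v v = z \<cdot>\<^sub>v v" if "v \<in> carrier_vec m" for v using that by blast
  have "Z = scal m z"
  proof (rule mat_col_eqI)
    fix j assume "j < dim_col (scal m z)"
    then have j: "j < m" by (simp add: scal_def)
    have "col Z j = Z *\<^sub>v col (1\<^sub>m m) j"
      using col_mult2[OF Zm one_carrier_mat j] Zm by simp
    also have "\<dots> = col (scal m z) j"
      using j by (subst W) (auto simp: scal_def)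
    finally show "col Z j = col (scal m z) j" .
  qed (use Zm in \<open>auto simp: scal_def\<close>)
  then show ?thesis by blast
qed


text \<open>Binomial theorem modulo \<open>p ^ 3\<close>, with the higher terms collected in
  \<open>q\<close>.\<close>

lemma Suc_power_expansion: "\<exists>q. Suc p ^ n = 1 + n * p + (n choose 2) * p\<^sup>2 + q * p ^ 3"
proof (induction n)
  case (Suc n)
  then obtain q where q: "Suc p ^ n = 1 + n * p + (n choose 2) * p\<^sup>2 + q * p ^ 3" by blast
  have "Suc p ^ Suc n = 1 + Suc n * p + (Suc n choose 2) * p\<^sup>2 + (q * p + q + (n choose 2)) * p ^ 3"
    unfolding power_Suc q by (simp add: numeral_2_eq_2 numeral_3_eq_3 algebra_simps)
  then show ?case by blast
qed (auto simp: binomial_eq_0 intro: exI[of _ 0])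

section \<open>Consequences of a relation \<open>a b = b a^s\<close> in an arbitrary group\<close>

context group
begin

text \<open>For the lifted matrices it is not yet known that the commutator \<open>A^p\<close> is
  central, so the class-two formulas above cannot be used.\<close>

lemma pow_left_metacyclic:
  assumes ab: "a \<otimes> b = b \<otimes> a [^] (s::nat)" and G: "a \<in> carrier G" "b \<in> carrier G"
  shows "a [^] (n::nat) \<otimes> b = b \<otimes> a [^] (s * n)"
proof (induction n)
  case (Suc n)
  have "a [^] Suc n \<otimes> b = a [^] n \<otimes> (a \<otimes> b)" using G by (simp add: m_assoc)
  also have "\<dots> = (a [^] n \<otimes> b) \<otimes> a [^] s" using G by (simp add: ab m_assoc)
  also have "\<dots> = b \<otimes> a [^] (s * n + s)" using G by (simp add: Suc m_assoc nat_pow_mult)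
  finally show ?case by (simp add: add.commute)
qed (use G in simp)

text \<open>Conjugation by \<open>b\<close> raises \<open>a\<close> to the power \<open>s\<close>;
  \<open>n\<close> conjugations raise it to the power \<open>s ^ n\<close>.\<close>

lemma pow_right_metacyclic:
  assumes ab: "a \<otimes> b = b \<otimes> a [^] (s::nat)" and G: "a \<in> carrier G" "b \<in> carrier G"
  shows "a \<otimes> b [^] (n::nat) = b [^] n \<otimes> a [^] (s ^ n)"
proof (induction n)
  case (Suc n)
  have "a \<otimes> b [^] Suc n = (a \<otimes> b [^] n) \<otimes> b" using G by (simp add: m_assoc)
  also have "\<dots> = b [^] n \<otimes> (a [^] (s ^ n) \<otimes> b)" using G by (simp add: Suc m_assoc)
  also have "\<dots> = b [^] Suc n \<otimes> a [^] (s ^ Suc n)"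
    using G by (simp add: pow_left_metacyclic[OF ab G] m_assoc)
  finally show ?case .
qed (use G in simp)

text \<open>The first commutation makes the order of \<open>a\<close> divide \<open>p ^ 3\<close>,
  the second makes it divide \<open>Suc p ^ p - 1\<close>; these combine to
  \<open>p\<^sup>2\<close>.\<close>

lemma metacyclic_lift_pow_odd:
  assumes p: "prime p" "odd p" and ab: "a \<otimes> b = b \<otimes> a [^] Suc p" and G: "a \<in> carrier G" "b \<in> carrier G"
    and c1: "a [^] (p\<^sup>2) \<otimes> b = b \<otimes> a [^] (p\<^sup>2)" and c2: "a \<otimes> b [^] p = b [^] p \<otimes> a"
  shows "a [^] (p\<^sup>2) = \<one>"
proof -
  have "b \<otimes> a [^] (p\<^sup>2) = b \<otimes> a [^] (p\<^sup>2) \<otimes> a [^] (p ^ 3)"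
    using pow_left_metacyclic[OF ab G, of "p\<^sup>2"] c1 G
    by (simp add: m_assoc nat_pow_mult power2_eq_square power3_eq_cube mult.assoc del: nat_pow_Suc Group.nat_pow_Suc)
  then have "a [^] (p ^ 3) = \<one>" using G by simp
  then have d3: "ord a dvd p ^ 3" using G pow_eq_id by blast
  obtain q where q: "Suc p ^ p = 1 + p * p + (p choose 2) * p\<^sup>2 + q * p ^ 3"
    using Suc_power_expansion by blast
  have "p dvd (p choose 2)"
    using p prime_odd_nat[of p] prime_ge_2_nat[OF p(1)] by (intro dvd_choose_prime) (auto simp: le_less)
  then obtain k where k: "p choose 2 = p * k" by auto
  have "a = a [^] (Suc p ^ p)" using pow_right_metacyclic[OF ab G, of p] c2 G by simp
  \<comment> \<open>As \<open>p choose 2\<close> is a multiple of \<open>p\<close>, every term after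
    \<open>p\<^sup>2\<close> is a multiple of \<open>p ^ 3\<close>.\<close>
  also have "Suc p ^ p = Suc (p\<^sup>2 + (k + q) * p ^ 3)"
    unfolding q k by (simp add: power2_eq_square power3_eq_cube algebra_simps)
  finally have "a [^] (p\<^sup>2 + (k + q) * p ^ 3) = \<one>" using G by simp
  then have "ord a dvd p\<^sup>2 + (k + q) * p ^ 3" using G pow_eq_id by blast
  then have "ord a dvd p\<^sup>2" using d3 by (simp add: dvd_add_left_iff)
  then show ?thesis using G pow_eq_id by blast
qed

text \<open>Moving the square of \<open>a\<close> past \<open>b\<close> turns it into the sixth
  power; since the square commutes with \<open>b\<close>, the fourth power is trivial.\<close>

lemma metacyclic_lift_pow_two:
  assumes ab: "a \<otimes> b = b \<otimes> a [^] Suc 2" and G: "a \<in> carrier G" "b \<in> carrier G"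
    and c: "a [^] (2::nat) \<otimes> b = b \<otimes> a [^] (2::nat)"
  shows "a [^] (2\<^sup>2::nat) = \<one>"
proof -
  have "b \<otimes> a [^] (2::nat) = b \<otimes> a [^] (6::nat)"
    using pow_left_metacyclic[OF ab G, of 2] c by simp
  then have "a [^] (2::nat) = a [^] (6::nat)" using G by simp
  also have "\<dots> = a [^] (2::nat) \<otimes> a [^] (4::nat)" using G by (simp add: nat_pow_mult)
  finally have "a [^] (4::nat) = \<one>" using G by (metis l_cancel_one' nat_pow_closed)
  then show ?thesis by simp
qed

end

text \<open>The first alternative for \<open>b [^] p\<close> is the group of exponent
  \<open>p^2\<close>, the second is the quaternion group.\<close>

locale faithful_metacyclic = metacyclic_pp G p a b + faithful_proj G m \<rho> for G (structure) and p a b m \<rho> +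
  assumes b_pow_p: "odd p \<and> b [^] p = \<one> \<or> p = 2 \<and> b [^] p = a [^] p"
begin

lemma exists_exact_lift:
  "\<exists>c. c \<noteq> 0 \<and> (c \<cdot>\<^sub>m \<rho> a) * \<rho> b = \<rho> b * (c \<cdot>\<^sub>m \<rho> a) [^]\<^bsub>GL m\<^esub> Suc p \<and> (c \<cdot>\<^sub>m \<rho> a) [^]\<^bsub>GL m\<^esub> (p\<^sup>2) = 1\<^sub>m m"
proof -
  interpret GL: group "GL m" by (rule group_GL)
  note mats = rep_carrier_mat[OF a_closed] rep_carrier_mat[OF b_closed]
  have pm: "\<rho> a [^]\<^bsub>GL m\<^esub> (n::nat) \<in> carrier_mat m m" for n
    using GL_carrier_mat[OF GL_pow_closed[OF rep_in_GL[OF a_closed]]] .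
  obtain c1 where c1: "c1 \<noteq> 0" "\<rho> a * \<rho> b = c1 \<cdot>\<^sub>m \<rho> (a \<otimes> b)" using rep_mult[OF a_closed b_closed] by blast
  obtain c2 where c2: "c2 \<noteq> 0" "\<rho> (b \<otimes> a [^] Suc p) = c2 \<cdot>\<^sub>m (\<rho> b * \<rho> (a [^] Suc p))"
    using rep_mult'[OF b_closed, of "a [^] Suc p"] by auto
  obtain c3 where c3: "c3 \<noteq> 0" "\<rho> (a [^] Suc p) = c3 \<cdot>\<^sub>m (\<rho> a [^]\<^bsub>GL m\<^esub> Suc p)"
    using rep_pow[OF a_closed] by blast
  \<comment> \<open>The scalars collected so far are the defect of the relation; the choice makes
    \<open>c * (c1 * c2 * c3)\<close> equal to \<open>c ^ Suc p\<close>, the factor produced by the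
    power on the right-hand side.\<close>
  obtain c where c: "c ^ p = c1 * c2 * c3" using exists_root prime_gt_0_nat[OF prime_p] by blast
  have c0: "c \<noteq> 0" using c c1 c2 c3 prime_gt_0_nat[OF prime_p] by (auto simp: power_0_left)
  define A where "A = c \<cdot>\<^sub>m \<rho> a"
  define B where "B = \<rho> b"
  have A: "A \<in> carrier (GL m)" unfolding A_def by (rule GL_smult[OF rep_in_GL[OF a_closed] c0])
  have B: "B \<in> carrier (GL m)" unfolding B_def by (rule rep_in_GL[OF b_closed])
  have AB: "A * B = B * A [^]\<^bsub>GL m\<^esub> Suc p"
  proof -
    have "A * B = c \<cdot>\<^sub>m (c1 \<cdot>\<^sub>m (c2 \<cdot>\<^sub>m (\<rho> b * (c3 \<cdot>\<^sub>m (\<rho> a [^]\<^bsub>GL m\<^esub> Suc p)))))"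
      using mats by (simp only: A_def B_def mult_smult_assoc_mat[of _ m m] c1 a_b c2 c3)
    also have "\<dots> = \<rho> b * (c ^ Suc p \<cdot>\<^sub>m (\<rho> a [^]\<^bsub>GL m\<^esub> Suc p))"
      using mats pm[of "Suc p"] c
      by (simp only: mult_smult_distrib[where n=m and nc=m] power_Suc) (auto simp: mult_ac intro!: eq_matI)
    finally show ?thesis unfolding A_def B_def GL_smult_pow[OF rep_in_GL[OF a_closed] c0] .
  qed
  obtain d where d: "d \<noteq> 0" "A [^]\<^bsub>GL m\<^esub> (p\<^sup>2) = scal m d"
    using rep_pow_scal[OF a_closed a_pow_p2 c0] unfolding A_def by blast
  have "A [^]\<^bsub>GL m\<^esub> (p\<^sup>2) = 1\<^sub>m m"
  proof (cases "p = 2")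
    case False
    then have b1: "odd p" "b [^] p = \<one>" using b_pow_p by auto
    obtain e where e: "B [^]\<^bsub>GL m\<^esub> p = scal m e"
    proof -
      have "1 \<cdot>\<^sub>m \<rho> b = \<rho> b" by (intro eq_matI) auto
      then show ?thesis using rep_pow_scal[OF b_closed b1(2), of 1] that unfolding B_def by auto
    qed
    show ?thesis
      using GL.metacyclic_lift_pow_odd[OF prime_p b1(1) _ A B] AB d e GL_carrier_mat[OF A] GL_carrier_mat[OF B]
      by simp
  next
    case True
    then have b2: "b [^] p = a [^] p" using b_pow_p by auto
    obtain e f where ef: "e \<noteq> 0" "f \<noteq> 0" "\<rho> (a [^] p) = e \<cdot>\<^sub>m (\<rho> a [^]\<^bsub>GL m\<^esub> p)"
      "\<rho> (b [^] p) = f \<cdot>\<^sub>m (B [^]\<^bsub>GL m\<^esub> p)"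
      using rep_pow[OF a_closed] rep_pow[OF b_closed] unfolding B_def by blast
    have "\<rho> a [^]\<^bsub>GL m\<^esub> p = inverse e \<cdot>\<^sub>m (e \<cdot>\<^sub>m (\<rho> a [^]\<^bsub>GL m\<^esub> p))"
      using ef(1) by (intro eq_matI) auto
    also have "\<dots> = inverse e \<cdot>\<^sub>m (f \<cdot>\<^sub>m (B [^]\<^bsub>GL m\<^esub> p))" using ef b2 by simp
    \<comment> \<open>For \<open>p = 2\<close> the power of \<open>A\<close> is a multiple of a
      power of \<open>B\<close> and therefore commutes with \<open>B\<close>.\<close>
    finally have "A [^]\<^bsub>GL m\<^esub> p = (c ^ p * inverse e * f) \<cdot>\<^sub>m (B [^]\<^bsub>GL m\<^esub> p)"
      unfolding A_def GL_smult_pow[OF rep_in_GL[OF a_closed] c0] by (auto intro!: eq_matI)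
    moreover have "B [^]\<^bsub>GL m\<^esub> p * B = B * B [^]\<^bsub>GL m\<^esub> p"
      using GL.group_commutes_pow[of B B p] B by simp
    ultimately have "A [^]\<^bsub>GL m\<^esub> p * B = B * A [^]\<^bsub>GL m\<^esub> p"
      using commutes_smult[of B m "B [^]\<^bsub>GL m\<^esub> p"] GL_carrier_mat[OF B] GL_carrier_mat[OF GL_pow_closed[OF B, of p]]
      by simp
    then show ?thesis using GL.metacyclic_lift_pow_two[OF _ A B] AB True by simp
  qed
  with AB c0 show ?thesis unfolding A_def B_def by blast
qed

lemma degree_gt: "Suc p \<le> m"
proof -
  obtain c where c: "c \<noteq> 0" "(c \<cdot>\<^sub>m \<rho> a) * \<rho> b = \<rho> b * (c \<cdot>\<^sub>m \<rho> a) [^]\<^bsub>GL m\<^esub> Suc p"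
    "(c \<cdot>\<^sub>m \<rho> a) [^]\<^bsub>GL m\<^esub> (p\<^sup>2) = 1\<^sub>m m" using exists_exact_lift by blast
  show ?thesis
  proof (rule metacyclic_degree_bound[OF prime_p GL_smult[OF rep_in_GL[OF a_closed] c(1)] rep_in_GL[OF b_closed] c(2,3)])
    show "(c \<cdot>\<^sub>m \<rho> a) [^]\<^bsub>GL m\<^esub> p \<noteq> scal m d" for d
      using eq_one_if_smult_pow_scal[OF a_closed c(1)] a_pow_p by blast
  qed
qed

lemma not_irreducible: "\<not> irreducible_proj_rep G m \<rho>"
proof
  assume irr: "irreducible_proj_rep G m \<rho>"
  interpret GL: group "GL m" by (rule group_GL)
  obtain c where c: "c \<noteq> 0" "(c \<cdot>\<^sub>m \<rho> a) * \<rho> b = \<rho> b * (c \<cdot>\<^sub>m \<rho> a) [^]\<^bsub>GL m\<^esub> Suc p"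
    "(c \<cdot>\<^sub>m \<rho> a) [^]\<^bsub>GL m\<^esub> (p\<^sup>2) = 1\<^sub>m m" using exists_exact_lift by blast
  let ?A = "c \<cdot>\<^sub>m \<rho> a"
  let ?Z = "?A [^]\<^bsub>GL m\<^esub> p"
  have A: "?A \<in> carrier (GL m)" using GL_smult[OF rep_in_GL[OF a_closed] c(1)] .
  have Z: "?Z \<in> carrier (GL m)" using A by simp
  note mats = rep_carrier_mat GL_carrier_mat[OF A] GL_carrier_mat[OF Z]
  have Zp: "?Z [^]\<^bsub>GL m\<^esub> p = scal m 1" using c(3) A by (simp add: GL.nat_pow_pow power2_eq_square)
  have ZA: "?Z * ?A = ?A * ?Z" using GL.group_commutes_pow[of ?A ?A p] A by simp
  have Za: "?Z * \<rho> a = \<rho> a * ?Z"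
  proof -
    have "inverse c \<cdot>\<^sub>m ?A = \<rho> a" using c(1) by (intro eq_matI) auto
    then show ?thesis using commutes_smult[OF mats(3,2) ZA, of "inverse c"] by simp
  qed
  \<comment> \<open>Passing \<open>\<rho> b\<close> changes the exponent from \<open>p\<close> to
    \<open>p + p\<^sup>2\<close>, which is no change because the lift has trivial power
    \<open>p\<^sup>2\<close>.\<close>
  have "?Z * \<rho> b = \<rho> b * ?A [^]\<^bsub>GL m\<^esub> (p + p\<^sup>2)"
    using GL.pow_left_metacyclic[of ?A "\<rho> b" "Suc p" p] c(2) A rep_in_GL[OF b_closed]
    by (simp add: power2_eq_square del: GL.nat_pow_Suc Group.nat_pow_Suc)
  also have "?A [^]\<^bsub>GL m\<^esub> (p + p\<^sup>2) = ?Z"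
    using GL.nat_pow_mult[OF A, of p "p\<^sup>2"] c(3) mats(3) by (simp add: carrier_matD[OF mats(3)])
  finally have Zb: "?Z * \<rho> b = \<rho> b * ?Z" .
  \<comment> \<open>Commuting with \<open>?Z\<close> passes to products since \<open>\<rho>\<close>
    is multiplicative up to scalars; by the normal form, \<open>a\<close> and \<open>b\<close>
    suffice.\<close>
  have mult: "?Z * \<rho> (g \<otimes> h) = \<rho> (g \<otimes> h) * ?Z"
    if gh: "g \<in> carrier G" "h \<in> carrier G" "?Z * \<rho> g = \<rho> g * ?Z" "?Z * \<rho> h = \<rho> h * ?Z" for g h
  proof -
    obtain d where d: "\<rho> (g \<otimes> h) = d \<cdot>\<^sub>m (\<rho> g * \<rho> h)" using rep_mult'[OF gh(1,2)] by blast
    have "?Z * (\<rho> g * \<rho> h) = (?Z * \<rho> g) * \<rho> h"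
      using mats(1)[OF gh(1)] mats(1)[OF gh(2)] mats(3) by (simp only: assoc_mult_mat[of _ m m _ m _ m])
    also have "\<dots> = \<rho> g * (?Z * \<rho> h)"
      unfolding gh(3) using mats(1)[OF gh(1)] mats(1)[OF gh(2)] mats(3) by (simp only: assoc_mult_mat[of _ m m _ m _ m])
    also have "\<dots> = (\<rho> g * \<rho> h) * ?Z"
      unfolding gh(4) using mats(1)[OF gh(1)] mats(1)[OF gh(2)] mats(3) by (simp only: assoc_mult_mat[of _ m m _ m _ m])
    finally show ?thesis
      unfolding d using mats(1)[OF gh(1)] mats(1)[OF gh(2)] mats(3) by (intro commutes_smult) auto
  qed
  have pow: "?Z * \<rho> (g [^] (n::nat)) = \<rho> (g [^] n) * ?Z" if "g \<in> carrier G" "?Z * \<rho> g = \<rho> g * ?Z" for g n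
    using that mats(3) by (induction n) (auto simp: rep_one mult carrier_matD[OF mats(3)])
  have "?Z * \<rho> g = \<rho> g * ?Z" if "g \<in> carrier G" for g
  proof -
    have "g \<in> (\<lambda>(i, k). b [^] i \<otimes> a [^] k) ` ({..<p} \<times> {..<p\<^sup>2})"
      using that bij_normal_form by (simp add: bij_betw_def)
    then obtain i k :: nat where "g = b [^] i \<otimes> a [^] k" by auto
    then show ?thesis using mult pow Za Zb by simp
  qed
  then obtain z where "?Z = scal m z"
    using eq_scal_if_commutes_irreducible[OF irr Z degree_pos _ Zp prime_gt_0_nat[OF prime_p]] by auto
  then show False using eq_one_if_smult_pow_scal[OF a_closed c(1)] a_pow_p by blast
qed

end

section \<open>The lower bound for groups of exponent \<open>p\<close>\<close>

context faithful_proj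
begin

lemma rep_pow_scal':
  assumes g: "g \<in> carrier G" and 1: "g [^] (n::nat) = \<one>"
  shows "\<exists>d. d \<noteq> 0 \<and> \<rho> g [^]\<^bsub>GL m\<^esub> n = scal m d"
proof -
  have "1 \<cdot>\<^sub>m \<rho> g = \<rho> g" by (intro eq_matI) auto
  then show ?thesis using rep_pow_scal[OF assms, of 1] by simp
qed

text \<open>Matrices of commuting elements commute up to a scalar \<open>k\<close>. Here
  \<open>k\<close> is a p-th root of unity other than 1, and the scalar matrix \<open>k\<close>
  serves as the central element of a Heisenberg relation.\<close>

lemma prime_le_degree_if_not_commuting:
  assumes p: "prime p" and g: "g \<in> carrier G" "g [^] p = \<one>" and h: "h \<in> carrier G" "h [^] p = \<one>"
    and gh: "g \<otimes> h = h \<otimes> g" and ne: "\<rho> g * \<rho> h \<noteq> \<rho> h * \<rho> g"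
  shows "p \<le> m"
proof -
  interpret GL: group "GL m" by (rule group_GL)
  note mats = rep_carrier_mat[OF g(1)] rep_carrier_mat[OF h(1)]
  obtain k1 where k1: "k1 \<noteq> 0" "\<rho> g * \<rho> h = k1 \<cdot>\<^sub>m \<rho> (h \<otimes> g)" using rep_mult[OF g(1) h(1)] gh by auto
  obtain k2 where k2: "k2 \<noteq> 0" "\<rho> (h \<otimes> g) = k2 \<cdot>\<^sub>m (\<rho> h * \<rho> g)" using rep_mult'[OF h(1) g(1)] by auto
  define k where "k = k1 * k2"
  have k0: "k \<noteq> 0" using k1 k2 by (simp add: k_def)
  have eq: "\<rho> g * \<rho> h = k \<cdot>\<^sub>m (\<rho> h * \<rho> g)" unfolding k1(2) k2(2) k_def by (intro eq_matI) auto
  have K: "scal m k \<in> carrier (GL m)" using k0 by simp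
  have eq': "\<rho> g * \<rho> h = \<rho> h * \<rho> g * scal m k" unfolding eq using mats by simp
  obtain d where d: "d \<noteq> 0" "\<rho> h [^]\<^bsub>GL m\<^esub> p = scal m d" using rep_pow_scal'[OF h] by blast
  obtain e where e: "e \<noteq> 0" "\<rho> g [^]\<^bsub>GL m\<^esub> p = scal m e" using rep_pow_scal'[OF g] by blast
  \<comment> \<open>Moving \<open>\<rho> g\<close> past the p-th power of \<open>\<rho> h\<close>,
    which is scalar, creates the factor \<open>k ^ p\<close>; so that factor is 1.\<close>
  have "\<rho> g * scal m d = scal m d * \<rho> g * scal m (k ^ p)"
    using GL.comm_pow_right[of "\<rho> g" "\<rho> h" "scal m k" p] eq' mats rep_in_GL[OF g(1)] rep_in_GL[OF h(1)] K d(2)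
    by (simp only: mult_GL scal_pow) (simp add: scal_mult_scal)
  then have "scal m d * \<rho> g * scal m (k ^ p) = scal m d * \<rho> g" using mats by simp
  moreover have "scal m d * \<rho> g \<in> carrier (GL m)"
    using GL_mult_closed[OF scal_in_GL[OF d(1)] rep_in_GL[OF g(1)]] .
  moreover have "scal m (k ^ p) \<in> carrier (GL m)" using k0 by simp
  ultimately have "scal m (k ^ p) = 1\<^sub>m m" using GL.l_cancel_one[of "scal m d * \<rho> g" "scal m (k ^ p)"] by simp
  then have Kp: "scal m k [^]\<^bsub>GL m\<^esub> p = 1\<^sub>m m" by (simp add: scal_pow)
  have K1: "scal m k \<noteq> 1\<^sub>m m"
  proof
    assume "scal m k = 1\<^sub>m m"
    then have "\<rho> g * \<rho> h = \<rho> h * \<rho> g" using eq' mats by (simp add: right_mult_one_mat[of _ m m])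
    with ne show False by simp
  qed
  show ?thesis
    using heisenberg_degree_bound[OF p rep_in_GL[OF h(1)] rep_in_GL[OF g(1)] K eq' _ _ Kp e(2) prime_gt_0_nat[OF p] e(1) K1] mats
    by simp
qed

end

text \<open>In degree below \<open>p\<close> the matrix of \<open>z\<close> must commute with those
  of \<open>x\<close> and \<open>y\<close>, by the previous lemma; then the Heisenberg bound applies
  and contradicts the assumption.\<close>

lemma (in heisenberg_pp) degree_ge:
  assumes "faithful_proj_rep G m \<rho>"
  shows "p \<le> m"
proof (rule ccontr)
  interpret faithful_proj G m \<rho> by unfold_locales (rule assms)
  interpret GL: group "GL m" by (rule group_GL)
  assume lt: "\<not> p \<le> m"
  note mats = rep_carrier_mat[OF x_closed] rep_carrier_mat[OF y_closed] rep_carrier_mat[OF z_closed]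
  have zx: "\<rho> z * \<rho> x = \<rho> x * \<rho> z"
    using prime_le_degree_if_not_commuting[OF prime_p z_closed z_pow_p x_closed x_pow_p z_x] lt by blast
  have zy: "\<rho> z * \<rho> y = \<rho> y * \<rho> z"
    using prime_le_degree_if_not_commuting[OF prime_p z_closed z_pow_p y_closed y_pow_p z_y] lt by blast
  obtain c1 where c1: "c1 \<noteq> 0" "\<rho> y * \<rho> x = c1 \<cdot>\<^sub>m \<rho> (x \<otimes> y \<otimes> z)" using rep_mult[OF y_closed x_closed] y_x by auto
  obtain c2 where c2: "c2 \<noteq> 0" "\<rho> (x \<otimes> y \<otimes> z) = c2 \<cdot>\<^sub>m (\<rho> (x \<otimes> y) * \<rho> z)" using rep_mult'[of "x \<otimes> y" z] by auto
  obtain c3 where c3: "c3 \<noteq> 0" "\<rho> (x \<otimes> y) = c3 \<cdot>\<^sub>m (\<rho> x * \<rho> y)" using rep_mult'[OF x_closed y_closed] by auto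
  define c where "c = c1 * c2 * c3"
  have c0: "c \<noteq> 0" using c1 c2 c3 by (simp add: c_def)
  \<comment> \<open>Absorbing the cocycle values into \<open>Z\<close> makes the commutator relation
    of the matrices exact.\<close>
  define Z where "Z = c \<cdot>\<^sub>m \<rho> z"
  have Z: "Z \<in> carrier (GL m)" unfolding Z_def using GL_smult[OF rep_in_GL[OF z_closed] c0] .
  have YX: "\<rho> y * \<rho> x = \<rho> x * \<rho> y * Z"
  proof -
    have "\<rho> y * \<rho> x = c \<cdot>\<^sub>m (\<rho> x * \<rho> y * \<rho> z)"
      unfolding c1(2) c2(2) c3(2) c_def using mats
      by (simp only: mult_smult_assoc_mat[of _ m m] mult_carrier_mat[of _ m m]) (auto intro!: eq_matI)
    then show ?thesis unfolding Z_def mult_smult_distrib[OF mult_carrier_mat[OF mats(1,2)] mats(3)] .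
  qed
  have ZX: "Z * \<rho> x = \<rho> x * Z" unfolding Z_def using commutes_smult[OF mats(1,3) zx[symmetric]] by simp
  have ZY: "Z * \<rho> y = \<rho> y * Z" unfolding Z_def using commutes_smult[OF mats(2,3) zy[symmetric]] by simp
  obtain d where d: "d \<noteq> 0" "\<rho> x [^]\<^bsub>GL m\<^esub> p = scal m d" using rep_pow_scal'[OF x_closed x_pow_p] by blast
  obtain e where e: "e \<noteq> 0" "\<rho> y [^]\<^bsub>GL m\<^esub> p = scal m e" using rep_pow_scal'[OF y_closed y_pow_p] by blast
  have "\<rho> y * scal m d = scal m d * \<rho> y * Z [^]\<^bsub>GL m\<^esub> p"
    using GL.comm_pow_right[of "\<rho> y" "\<rho> x" Z p] YX ZX rep_in_GL[OF x_closed] rep_in_GL[OF y_closed] Z d(2)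
    by (simp only: mult_GL)
  then have "scal m d * \<rho> y * Z [^]\<^bsub>GL m\<^esub> p = scal m d * \<rho> y" using mats by simp
  moreover have "scal m d * \<rho> y \<in> carrier (GL m)"
    using GL_mult_closed[OF scal_in_GL[OF d(1)] rep_in_GL[OF y_closed]] .
  ultimately have Zp: "Z [^]\<^bsub>GL m\<^esub> p = 1\<^sub>m m"
    using GL.l_cancel_one[of "scal m d * \<rho> y" "Z [^]\<^bsub>GL m\<^esub> p"] Z by simp
  have "Z \<noteq> 1\<^sub>m m"
    using eq_one_if_smult_scal[OF z_closed c0, of 1] z_neq_one unfolding Z_def by auto
  then have "p \<le> m"
    using heisenberg_degree_bound[OF prime_p rep_in_GL[OF x_closed] rep_in_GL[OF y_closed] Z YX ZX ZY Zp e(2) prime_gt_0_nat[OF prime_p] e(1)] by blast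
  with lt show False by simp
qed

section \<open>Construction of representations\<close>

definition monomial_mat :: "nat \<Rightarrow> (nat \<Rightarrow> nat) \<Rightarrow> (nat \<Rightarrow> complex) \<Rightarrow> complex mat" where
  "monomial_mat n \<pi> f = mat n n (\<lambda>(r, s). if r = \<pi> s then f s else 0)"

lemma monomial_mat_carrier [simp]: "monomial_mat n \<pi> f \<in> carrier_mat n n"
  by (simp add: monomial_mat_def)

lemma monomial_mat_index: "r < n \<Longrightarrow> s < n \<Longrightarrow> monomial_mat n \<pi> f $$ (r, s) = (if r = \<pi> s then f s else 0)"
  by (simp add: monomial_mat_def)

lemma monomial_mat_mult:
  assumes "\<And>s. s < n \<Longrightarrow> \<pi>' s < n"
  shows "monomial_mat n \<pi> f * monomial_mat n \<pi>' f' = monomial_mat n (\<lambda>s. \<pi> (\<pi>' s)) (\<lambda>s. f (\<pi>' s) * f' s)"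
proof (rule eq_matI)
  fix r s assume "r < dim_row (monomial_mat n (\<lambda>s. \<pi> (\<pi>' s)) (\<lambda>s. f (\<pi>' s) * f' s))"
    "s < dim_col (monomial_mat n (\<lambda>s. \<pi> (\<pi>' s)) (\<lambda>s. f (\<pi>' s) * f' s))"
  then have rs: "r < n" "s < n" by (simp_all add: monomial_mat_def)
  have "(monomial_mat n \<pi> f * monomial_mat n \<pi>' f') $$ (r, s)
      = (\<Sum>t<n. (if r = \<pi> t then f t else 0) * (if t = \<pi>' s then f' s else 0))"
    using rs by (simp add: monomial_mat_def scalar_prod_def lessThan_atLeast0)
  also have "\<dots> = (\<Sum>t<n. if t = \<pi>' s then (if r = \<pi> t then f t else 0) * f' s else 0)"
    by (intro sum.cong) auto
  also have "\<dots> = (if r = \<pi> (\<pi>' s) then f (\<pi>' s) else 0) * f' s"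
    using assms[OF rs(2)] by simp
  finally show "(monomial_mat n \<pi> f * monomial_mat n \<pi>' f') $$ (r, s)
      = monomial_mat n (\<lambda>s. \<pi> (\<pi>' s)) (\<lambda>s. f (\<pi>' s) * f' s) $$ (r, s)"
    using rs by (simp add: monomial_mat_index)
qed (simp_all add: monomial_mat_def)

lemma monomial_mat_cong:
  assumes "\<And>s. s < n \<Longrightarrow> \<pi> s = \<pi>' s" "\<And>s. s < n \<Longrightarrow> f s = f' s"
  shows "monomial_mat n \<pi> f = monomial_mat n \<pi>' f'"
  using assms by (intro eq_matI) (auto simp: monomial_mat_def)

lemma monomial_mat_mult_unit_vec:
  assumes "s < n" "\<pi> s < n"
  shows "monomial_mat n \<pi> f *\<^sub>v unit_vec n s = f s \<cdot>\<^sub>v unit_vec n (\<pi> s)"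
proof (rule eq_vecI)
  fix r assume "r < dim_vec (f s \<cdot>\<^sub>v unit_vec n (\<pi> s))"
  then have "r < n" by simp
  then have "(monomial_mat n \<pi> f *\<^sub>v unit_vec n s) $ r = (\<Sum>t<n. (if r = \<pi> t then f t else 0) * (if t = s then 1 else 0))"
    using assms by (simp add: monomial_mat_def scalar_prod_def lessThan_atLeast0 unit_vec_def)
  also have "\<dots> = (\<Sum>t<n. if t = s then (if r = \<pi> t then f t else 0) else 0)" by (intro sum.cong) auto
  also have "\<dots> = (f s \<cdot>\<^sub>v unit_vec n (\<pi> s)) $ r" using assms \<open>r < n\<close> by (simp add: unit_vec_def)
  finally show "(monomial_mat n \<pi> f *\<^sub>v unit_vec n s) $ r = (f s \<cdot>\<^sub>v unit_vec n (\<pi> s)) $ r" .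
qed (simp add: monomial_mat_def)

lemma diagonal_mat_mult_vec:
  assumes "v \<in> carrier_vec n" "\<And>s. s < n \<Longrightarrow> \<pi> s = s"
  shows "monomial_mat n \<pi> f *\<^sub>v v = vec n (\<lambda>r. f r * v $ r)"
proof (rule eq_vecI)
  fix r assume "r < dim_vec (vec n (\<lambda>r. f r * v $ r))"
  then have "r < n" by simp
  then have "(monomial_mat n \<pi> f *\<^sub>v v) $ r = (\<Sum>t<n. (if r = t then f t else 0) * v $ t)"
    using assms by (simp add: monomial_mat_def scalar_prod_def lessThan_atLeast0)
  also have "\<dots> = (\<Sum>t<n. if t = r then f t * v $ t else 0)" by (intro sum.cong) auto
  finally show "(monomial_mat n \<pi> f *\<^sub>v v) $ r = vec n (\<lambda>r. f r * v $ r) $ r" using \<open>r < n\<close> by simp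
qed (simp add: monomial_mat_def)

lemma cis_root_eq_one_iff:
  assumes "n > 0"
  shows "cis (2 * pi / real n) ^ k = 1 \<longleftrightarrow> n dvd k"
proof
  assume "cis (2 * pi / real n) ^ k = 1"
  then have "cos (real k * (2 * pi / real n)) = 1" by (simp add: Complex.DeMoivre complex_eq_iff)
  then obtain x :: int where "real k * (2 * pi / real n) = 2 * real_of_int x * pi"
    by (auto simp: cos_one_2pi_int)
  then have "real k = real_of_int x * real n" using assms by (simp add: field_simps)
  then have "int k = x * int n" by (metis of_int_eq_iff of_int_mult of_int_of_nat_eq)
  then have "int n dvd int k" by simp
  then show "n dvd k" by simp
next
  assume "n dvd k"
  then obtain l where "k = n * l" by auto
  moreover have "cis (2 * pi / real n) ^ n = 1" using assms by (simp add: Complex.DeMoivre)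
  ultimately show "cis (2 * pi / real n) ^ k = 1" by (simp add: power_mult)
qed

lemma cis_root_power_cong:
  assumes "n > 0" "k mod n = l mod n"
  shows "cis (2 * pi / real n) ^ k = cis (2 * pi / real n) ^ l"
proof -
  have "cis (2 * pi / real n) ^ k = cis (2 * pi / real n) ^ (k mod n)" for k
  proof -
    have "cis (2 * pi / real n) ^ k = cis (2 * pi / real n) ^ (n * (k div n) + k mod n)" by simp
    also have "\<dots> = cis (2 * pi / real n) ^ (k mod n)"
      using cis_root_eq_one_iff[OF assms(1), of "n * (k div n)"] by (simp only: power_add) simp
    finally show ?thesis .
  qed
  from this[of k] this[of l] show ?thesis using assms(2) by simp
qed

text \<open>Invertibility need not be supplied: a multiple of the matrix of the inverse element is a
  two-sided inverse.\<close>

lemma proj_repI: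
  assumes G: "group G" and m: "0 < m" and mat: "\<And>g. g \<in> carrier G \<Longrightarrow> \<rho> g \<in> carrier_mat m m"
    and one: "\<rho> \<one>\<^bsub>G\<^esub> = 1\<^sub>m m"
    and mult: "\<And>g h. g \<in> carrier G \<Longrightarrow> h \<in> carrier G \<Longrightarrow> \<exists>c. c \<noteq> 0 \<and> \<rho> g * \<rho> h = c \<cdot>\<^sub>m \<rho> (g \<otimes>\<^bsub>G\<^esub> h)"
  shows "proj_rep G m \<rho>"
proof -
  interpret group G by (rule G)
  have "invertible_mat (\<rho> g)" if g: "g \<in> carrier G" for g
  proof -
    obtain c where c: "c \<noteq> 0" "\<rho> g * \<rho> (inv\<^bsub>G\<^esub> g) = c \<cdot>\<^sub>m 1\<^sub>m m" using mult[of g "inv\<^bsub>G\<^esub> g"] g one by auto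
    obtain d where d: "d \<noteq> 0" "\<rho> (inv\<^bsub>G\<^esub> g) * \<rho> g = d \<cdot>\<^sub>m 1\<^sub>m m" using mult[of "inv\<^bsub>G\<^esub> g" g] g one by auto
    note mats = mat[OF g] mat[OF inv_closed[OF g]]
    \<comment> \<open>The left and right products with the matrix of the inverse are scalars
      \<open>d\<close> and \<open>c\<close>; evaluating the triple product in two ways shows that
      they agree.\<close>
    have "d \<cdot>\<^sub>m \<rho> g = \<rho> g * (\<rho> (inv\<^bsub>G\<^esub> g) * \<rho> g)"
      unfolding d using mats by (simp add: mult_smult_distrib[where n=m and nc=m])
    also have "\<dots> = c \<cdot>\<^sub>m \<rho> g"
      using mats by (simp add: assoc_mult_mat[of _ m m _ m _ m, symmetric] c mult_smult_assoc_mat[of _ m m])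
    finally have "\<rho> (inv\<^bsub>G\<^esub> g) * (d \<cdot>\<^sub>m \<rho> g) = \<rho> (inv\<^bsub>G\<^esub> g) * (c \<cdot>\<^sub>m \<rho> g)" by simp
    then have "d \<cdot>\<^sub>m (d \<cdot>\<^sub>m 1\<^sub>m m) = c \<cdot>\<^sub>m (d \<cdot>\<^sub>m (1\<^sub>m m :: complex mat))"
      using mats by (simp add: mult_smult_distrib[where n=m and nc=m] d)
    then have "(d \<cdot>\<^sub>m (d \<cdot>\<^sub>m 1\<^sub>m m)) $$ (0, 0) = (c \<cdot>\<^sub>m (d \<cdot>\<^sub>m (1\<^sub>m m :: complex mat))) $$ (0, 0)" by simp
    then have "d = c" using m d(1) by simp
    then have "\<rho> g * (inverse c \<cdot>\<^sub>m \<rho> (inv\<^bsub>G\<^esub> g)) = 1\<^sub>m m" "(inverse c \<cdot>\<^sub>m \<rho> (inv\<^bsub>G\<^esub> g)) * \<rho> g = 1\<^sub>m m"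
      using mats c d by (simp_all add: mult_smult_distrib[where n=m and nc=m] mult_smult_assoc_mat[of _ m m])
        (auto intro!: eq_matI)
    then show ?thesis using mats
      by (auto simp: invertible_mat_def inverts_mat_def square_mat.simps intro!: exI[of _ "inverse c \<cdot>\<^sub>m \<rho> (inv\<^bsub>G\<^esub> g)"])
  qed
  moreover from mult obtain \<alpha> where "\<forall>g\<in>carrier G. \<forall>h\<in>carrier G. \<alpha> g h \<noteq> 0 \<and> \<rho> g * \<rho> h = \<alpha> g h \<cdot>\<^sub>m \<rho> (g \<otimes>\<^bsub>G\<^esub> h)"
    by metis
  ultimately show ?thesis using m mat one by (auto simp: proj_rep_def)
qed

lemma tau_eqI:
  assumes "faithful_proj_rep G n \<rho>" "\<And>m \<rho>. faithful_proj_rep G m \<rho> \<Longrightarrow> n \<le> m"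
  shows "tau G = n"
  unfolding tau_def using assms by (intro Least_equality) auto

lemma tau_irr_eqI:
  assumes "faithful_proj_rep G n \<rho>" "irreducible_proj_rep G n \<rho>" "\<And>m \<rho>. faithful_proj_rep G m \<rho> \<Longrightarrow> n \<le> m"
  shows "tau_irr G = n"
  unfolding tau_irr_def using assms by (intro Least_equality) auto

section \<open>A faithful representation of degree \<open>p + 1\<close>\<close>

context metacyclic_pp
begin

definition normal_form :: "'a \<Rightarrow> nat \<times> nat" where
  "normal_form g = inv_into ({..<p} \<times> {..<p\<^sup>2}) (\<lambda>(i, k). b [^] i \<otimes> a [^] k) g"

text \<open>Coordinates below \<open>p\<close> carry the representation induced from a faithful
  character of the cyclic group of \<open>a\<close>: \<open>b\<close> shifts them and
  \<open>a\<close> has exponent \<open>1 + p * s\<close> at \<open>s\<close>, because that is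
  \<open>(1 + p)^s\<close> modulo \<open>p^2\<close>. Coordinate \<open>p\<close> is the trivial
  summand.\<close>

definition rep_of :: "nat \<Rightarrow> nat \<Rightarrow> complex mat" where
  "rep_of i k = monomial_mat (Suc p) (\<lambda>s. if s < p then (s + i) mod p else s)
     (\<lambda>s. if s < p then cis (2 * pi / real (p\<^sup>2)) ^ (k * (1 + p * s)) else 1)"

definition rep :: "'a \<Rightarrow> complex mat" where
  "rep g = (case normal_form g of (i, k) \<Rightarrow> rep_of i k)"

lemma p_pos: "p > 0" "p\<^sup>2 > 0"
  using prime_gt_0_nat[OF prime_p] by simp_all

lemma rep_of_mult: "rep_of i k * rep_of i' k' = rep_of (i + i') (k * (1 + p * i') + k')"
proof -
  let ?e = "cis (2 * pi / real (p\<^sup>2))"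
  have "?e ^ (k * (1 + p * ((s + i') mod p))) * ?e ^ (k' * (1 + p * s)) = ?e ^ ((k * (1 + p * i') + k') * (1 + p * s))" for s
    unfolding power_add[symmetric]
  proof (rule cis_root_power_cong[OF p_pos(2)])
    \<comment> \<open>The wrap-around of the shift is harmless: indices matter modulo
      \<open>p\<close> but enter the exponent multiplied by \<open>p\<close>.\<close>
    have 1: "p * ((s + i') mod p) = (p * (s + i')) mod p\<^sup>2"
      unfolding power2_eq_square by (rule mult_mod_right)
    have "(k * (1 + p * ((s + i') mod p)) + k' * (1 + p * s)) mod p\<^sup>2 = (k * (1 + p * (s + i')) + k' * (1 + p * s)) mod p\<^sup>2"
      unfolding 1 by (metis mod_add_cong mod_add_right_eq mod_mult_right_eq)
    \<comment> \<open>The added multiple of \<open>p\<^sup>2\<close> is the cross term needed to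
      factor the exponent through \<open>(1 + p * i') * (1 + p * s)\<close>.\<close>
    also have "\<dots> = (k * (1 + p * (s + i')) + k' * (1 + p * s) + p\<^sup>2 * (k * i' * s)) mod p\<^sup>2" by simp
    also have "k * (1 + p * (s + i')) + k' * (1 + p * s) + p\<^sup>2 * (k * i' * s) = (k * (1 + p * i') + k') * (1 + p * s)"
      by (simp add: algebra_simps power2_eq_square)
    finally show "(k * (1 + p * ((s + i') mod p)) + k' * (1 + p * s)) mod p\<^sup>2 = (k * (1 + p * i') + k') * (1 + p * s) mod p\<^sup>2" .
  qed
  moreover have "((s + i') mod p + i) mod p = (s + (i + i')) mod p" for s
    unfolding mod_add_left_eq by (simp add: ac_simps)
  ultimately show ?thesis
    unfolding rep_of_def using p_pos(1)
    by (subst monomial_mat_mult) (auto intro!: monomial_mat_cong simp: less_Suc_eq)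
qed

lemma rep_of_mod: "rep_of (i mod p) (k mod p\<^sup>2) = rep_of i k"
proof -
  have "cis (2 * pi / real (p\<^sup>2)) ^ ((k mod p\<^sup>2) * (1 + p * s)) = cis (2 * pi / real (p\<^sup>2)) ^ (k * (1 + p * s))" for s
    by (rule cis_root_power_cong[OF p_pos(2) mod_mult_left_eq])
  then show ?thesis
    unfolding rep_of_def by (intro monomial_mat_cong) (simp_all only: mod_add_right_eq)
qed

lemma normal_form:
  assumes "g \<in> carrier G"
  shows "normal_form g \<in> {..<p} \<times> {..<p\<^sup>2}" "g = b [^] fst (normal_form g) \<otimes> a [^] snd (normal_form g)"
proof -
  have g: "g \<in> (\<lambda>(i, k). b [^] i \<otimes> a [^] k) ` ({..<p} \<times> {..<p\<^sup>2})"
    using bij_normal_form assms by (simp add: bij_betw_def)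
  show "normal_form g \<in> {..<p} \<times> {..<p\<^sup>2}" unfolding normal_form_def by (rule inv_into_into[OF g])
  show "g = b [^] fst (normal_form g) \<otimes> a [^] snd (normal_form g)"
    unfolding normal_form_def using f_inv_into_f[OF g] by (simp add: case_prod_unfold)
qed

lemma normal_form_eq:
  assumes "b [^] p = \<one>"
  shows "normal_form (b [^] (i::nat) \<otimes> a [^] (k::nat)) = (i mod p, k mod p\<^sup>2)"
proof -
  have "b [^] i = b [^] (i mod p)"
    using pow_eq_div2 assms by (metis b_closed mod_mult_div_eq nat_pow_closed nat_pow_mult nat_pow_one nat_pow_pow r_one)
  moreover have "a [^] k = a [^] (k mod p\<^sup>2)"
    using a_pow_p2 by (metis a_closed mod_mult_div_eq nat_pow_closed nat_pow_mult nat_pow_one nat_pow_pow r_one)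
  ultimately have "b [^] i \<otimes> a [^] k = (\<lambda>(i, k). b [^] i \<otimes> a [^] k) (i mod p, k mod p\<^sup>2)" by simp
  then show ?thesis
    unfolding normal_form_def using bij_normal_form p_pos
    by (simp only:) (intro inv_into_f_f, auto simp: bij_betw_def)
qed

text \<open>With \<open>b [^] p = \<one>\<close> both exponents of the normal form can be reduced
  separately. The quaternion group fails this condition and gets its own representation
  below.\<close>

lemma faithful_rep:
  assumes bp: "b [^] p = \<one>"
  shows "faithful_proj_rep G (Suc p) rep"
proof -
  let ?e = "cis (2 * pi / real (p\<^sup>2))"
  have rep: "rep (b [^] i \<otimes> a [^] k) = rep_of i k" for i k :: nat
    unfolding rep_def normal_form_eq[OF bp] by (simp add: rep_of_mod)
  have "proj_rep G (Suc p) rep"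
  proof (rule proj_repI)
    show "rep \<one> = 1\<^sub>m (Suc p)"
      using rep[of 0 0] by (auto simp: rep_of_def monomial_mat_def intro!: eq_matI)
    show "\<exists>c. c \<noteq> 0 \<and> rep g * rep h = c \<cdot>\<^sub>m rep (g \<otimes> h)" if gh: "g \<in> carrier G" "h \<in> carrier G" for g h
    proof -
      obtain i k :: nat where "g = b [^] i \<otimes> a [^] k" using normal_form(2)[OF gh(1)] by blast
      moreover obtain i' k' :: nat where "h = b [^] i' \<otimes> a [^] k'" using normal_form(2)[OF gh(2)] by blast
      ultimately have "rep g * rep h = rep (g \<otimes> h)" by (simp add: rep mult_normal_form rep_of_mult del: nat_pow_Suc Group.nat_pow_Suc)
      then show ?thesis by (intro exI[of _ 1]) (auto intro!: eq_matI)
    qed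
  qed (auto simp: is_group rep_def rep_of_def split: prod.split)
  moreover have "g = \<one>" if g: "g \<in> carrier G" and c: "rep g = c \<cdot>\<^sub>m 1\<^sub>m (Suc p)" for g c
  proof -
    obtain i k where ik: "normal_form g = (i, k)" by (cases "normal_form g")
    then have *: "i < p" "k < p\<^sup>2" "g = b [^] i \<otimes> a [^] k" using normal_form[OF g] by auto
    have R: "rep_of i k = c \<cdot>\<^sub>m 1\<^sub>m (Suc p)" using c rep *(3) by simp
    \<comment> \<open>The trivial summand pins the scalar to 1, so only the identity matrix could be
      scalar; the entry at the origin then determines \<open>i\<close> and \<open>k\<close>.\<close>
    have "c = 1" using arg_cong[OF R, of "\<lambda>M. M $$ (p, p)"] by (simp add: rep_of_def monomial_mat_index)
    then have 00: "(if i = 0 then ?e ^ k else 0) = 1"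
      using arg_cong[OF R, of "\<lambda>M. M $$ (0, 0)"] p_pos(1) *(1) by (auto simp: rep_of_def monomial_mat_index split: if_splits)
    then have "i = 0" "?e ^ k = 1" by (auto split: if_splits)
    then have "k = 0" using cis_root_eq_one_iff[OF p_pos(2), of k] *(2) by (auto dest: dvd_imp_le)
    then show ?thesis using *(3) \<open>i = 0\<close> by simp
  qed
  ultimately show ?thesis by (auto simp: faithful_proj_rep_def)
qed

end

section \<open>A faithful irreducible representation of degree \<open>p\<close>\<close>

context heisenberg_pp
begin

definition normal_form :: "'a \<Rightarrow> nat \<times> nat \<times> nat" where
  "normal_form g = inv_into ({..<p} \<times> {..<p} \<times> {..<p}) (\<lambda>(i, j, k). x [^] i \<otimes> y [^] j \<otimes> z [^] k) g"

text \<open>\<open>Suc p div 2\<close> is the inverse of 2 modulo the odd prime \<open>p\<close>.\<close>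

definition rep_of :: "nat \<Rightarrow> nat \<Rightarrow> nat \<Rightarrow> complex mat" where
  "rep_of i j k = monomial_mat p (\<lambda>s. (s + i) mod p)
     (\<lambda>s. cis (2 * pi / real p) ^ (j * (Suc p div 2) * s\<^sup>2 + k * s))"

definition rep :: "'a \<Rightarrow> complex mat" where
  "rep g = (case normal_form g of (i, j, k) \<Rightarrow> rep_of i j k)"

lemma p_pos: "p > 0"
  using prime_gt_0_nat[OF prime_p] .

text \<open>Shifting \<open>s\<close> in the exponent \<open>j * s^2 / 2\<close> produces the linear
  term \<open>j * i' * s\<close>, exactly the power of \<open>z\<close> created in the group. The
  terms free of \<open>s\<close> form the cocycle.\<close>

lemma rep_of_mult:
  assumes "odd p"
  shows "rep_of i j k * rep_of i' j' k' =
    cis (2 * pi / real p) ^ (j * (Suc p div 2) * i'\<^sup>2 + k * i') \<cdot>\<^sub>m rep_of (i + i') (j + j') (k + k' + j * i')"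
proof -
  let ?e = "cis (2 * pi / real p)" and ?h = "Suc p div 2"
  have h: "2 * ?h = Suc p" using assms by simp
  have "?e ^ (j * ?h * ((s + i') mod p)\<^sup>2 + k * ((s + i') mod p)) * ?e ^ (j' * ?h * s\<^sup>2 + k' * s)
     = ?e ^ (j * ?h * i'\<^sup>2 + k * i') * ?e ^ ((j + j') * ?h * s\<^sup>2 + (k + k' + j * i') * s)" for s
    unfolding power_add[symmetric]
  proof (rule cis_root_power_cong[OF p_pos])
    have "(j * ?h * ((s + i') mod p)\<^sup>2 + k * ((s + i') mod p) + (j' * ?h * s\<^sup>2 + k' * s)) mod p
        = (j * ?h * (s + i')\<^sup>2 + k * (s + i') + (j' * ?h * s\<^sup>2 + k' * s)) mod p"
      by (intro mod_add_cong refl) (metis mod_mult_right_eq power_mod, metis mod_mult_right_eq)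
    also have "j * ?h * (s + i')\<^sup>2 + k * (s + i') + (j' * ?h * s\<^sup>2 + k' * s)
        = j * ?h * i'\<^sup>2 + k * i' + ((j + j') * ?h * s\<^sup>2 + (k + k') * s) + (2 * ?h) * (j * i' * s)"
      by (simp only: power2_eq_square algebra_simps) 
    \<comment> \<open>\<open>2 * ?h\<close> is \<open>p + 1\<close>, so the cross term equals
      \<open>j * i' * s\<close> up to a multiple of \<open>p\<close>.\<close>
    also have "\<dots> = (j * ?h * i'\<^sup>2 + k * i' + ((j + j') * ?h * s\<^sup>2 + (k + k' + j * i') * s)) + p * (j * i' * s)"
      unfolding h by (simp add: algebra_simps)
    finally show "(j * ?h * ((s + i') mod p)\<^sup>2 + k * ((s + i') mod p) + (j' * ?h * s\<^sup>2 + k' * s)) mod p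
        = (j * ?h * i'\<^sup>2 + k * i' + ((j + j') * ?h * s\<^sup>2 + (k + k' + j * i') * s)) mod p" by simp
  qed
  moreover have "((s + i') mod p + i) mod p = (s + (i + i')) mod p" for s
    unfolding mod_add_left_eq by (simp add: ac_simps)
  ultimately show ?thesis
    unfolding rep_of_def using p_pos
    by (subst monomial_mat_mult) (auto intro!: eq_matI simp: monomial_mat_def)
qed

lemma rep_of_mod: "rep_of (i mod p) (j mod p) (k mod p) = rep_of i j k"
  unfolding rep_of_def
proof (intro monomial_mat_cong cis_root_power_cong[OF p_pos])
  fix s
  show "(j mod p * (Suc p div 2) * s\<^sup>2 + k mod p * s) mod p = (j * (Suc p div 2) * s\<^sup>2 + k * s) mod p"
    by (intro mod_add_cong) (metis mod_mult_left_eq mult.assoc, metis mod_mult_left_eq)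
qed (simp add: mod_add_right_eq)

lemma normal_form:
  assumes "g \<in> carrier G"
  shows "\<exists>i j k. normal_form g = (i, j, k) \<and> i < p \<and> j < p \<and> k < p \<and> g = x [^] i \<otimes> y [^] j \<otimes> z [^] k"
proof -
  have g: "g \<in> (\<lambda>(i, j, k). x [^] i \<otimes> y [^] j \<otimes> z [^] k) ` ({..<p} \<times> {..<p} \<times> {..<p})"
    using bij_normal_form assms by (simp add: bij_betw_def)
  obtain i j k where ijk: "normal_form g = (i, j, k)" by (metis prod_cases3)
  then show ?thesis
    using inv_into_into[OF g] f_inv_into_f[OF g] unfolding normal_form_def by auto
qed

lemma rep_normal_form: "rep (x [^] (i::nat) \<otimes> y [^] (j::nat) \<otimes> z [^] (k::nat)) = rep_of i j k"
proof -
  have red: "g [^] n = g [^] (n mod p)" if "g \<in> carrier G" "g [^] p = \<one>" for g and n :: nat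
    using that by (metis mod_mult_div_eq nat_pow_closed nat_pow_mult nat_pow_one nat_pow_pow r_one)
  have "x [^] i \<otimes> y [^] j \<otimes> z [^] k = (\<lambda>(i, j, k). x [^] i \<otimes> y [^] j \<otimes> z [^] k) (i mod p, j mod p, k mod p)"
    using red[OF x_closed x_pow_p, of i] red[OF y_closed y_pow_p, of j] red[OF z_closed z_pow_p, of k] by simp
  then have "normal_form (x [^] i \<otimes> y [^] j \<otimes> z [^] k) = (i mod p, j mod p, k mod p)"
    unfolding normal_form_def using bij_normal_form p_pos
    by (simp only:) (intro inv_into_f_f, auto simp: bij_betw_def)
  then show ?thesis unfolding rep_def by (simp add: rep_of_mod)
qed

lemma faithful_rep:
  assumes p: "odd p"
  shows "faithful_proj_rep G p rep"
proof -
  let ?e = "cis (2 * pi / real p)"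
  have "proj_rep G p rep"
  proof (rule proj_repI)
    show "rep \<one> = 1\<^sub>m p"
      using rep_normal_form[of 0 0 0] by (auto simp: rep_of_def monomial_mat_def intro!: eq_matI)
    show "\<exists>c. c \<noteq> 0 \<and> rep g * rep h = c \<cdot>\<^sub>m rep (g \<otimes> h)" if gh: "g \<in> carrier G" "h \<in> carrier G" for g h
    proof -
      obtain i j k :: nat where "g = x [^] i \<otimes> y [^] j \<otimes> z [^] k" using normal_form[OF gh(1)] by blast
      moreover obtain i' j' k' :: nat where "h = x [^] i' \<otimes> y [^] j' \<otimes> z [^] k'" using normal_form[OF gh(2)] by blast
      ultimately show ?thesis
        by (intro exI[of _ "?e ^ (j * (Suc p div 2) * i'\<^sup>2 + k * i')"])
          (simp add: rep_normal_form mult_normal_form rep_of_mult[OF p])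
    qed
  qed (auto simp: is_group rep_def rep_of_def p_pos split: prod.split)
  moreover have "g = \<one>" if g: "g \<in> carrier G" and c: "rep g = c \<cdot>\<^sub>m 1\<^sub>m p" for g c
  proof -
    obtain i j k where ijk: "i < p" "j < p" "k < p" "g = x [^] i \<otimes> y [^] j \<otimes> z [^] k" using normal_form[OF g] by blast
    have R: "rep_of i j k = c \<cdot>\<^sub>m 1\<^sub>m p" using c rep_normal_form ijk(4) by simp
    have i: "i = 0"
      using arg_cong[OF R, of "\<lambda>M. M $$ (i, 0)"] p_pos ijk(1) by (auto simp: rep_of_def monomial_mat_index split: if_splits)
    have p3: "p > 2" using p prime_ge_2_nat[OF prime_p] by (cases "p = 2") auto
    have f: "?e ^ (j * (Suc p div 2) * s\<^sup>2 + k * s) = c" if "s < p" for s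
      using arg_cong[OF R, of "\<lambda>M. M $$ (s, s)"] that by (simp add: rep_of_def monomial_mat_index i)
    have "c = 1" using f[of 0] p_pos by simp
    then have d: "p dvd j * (Suc p div 2) * s\<^sup>2 + k * s" if "s < p" for s
      using f[OF that] cis_root_eq_one_iff[OF p_pos] by simp
    \<comment> \<open>A quadratic without constant term is determined by its values at 1 and 2; both
      are valid indices because \<open>p > 2\<close>.\<close>
    have d1: "p dvd j * (Suc p div 2) + k" using d[of 1] p3 by simp
    have "p dvd 2 * (j * (Suc p div 2) + k) + j * (2 * (Suc p div 2))"
      using d[of 2] p3 by (simp add: algebra_simps)
    then have "p dvd j * (2 * (Suc p div 2))" using d1 by (meson dvd_add_right_iff dvd_mult)
    also have "j * (2 * (Suc p div 2)) = p * j + j" using p by simp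
    finally have "p dvd j" by (meson dvd_add_right_iff dvd_triv_left)
    then have "p dvd k" using d1 by (meson dvd_add_right_iff dvd_mult2)
    then have "j = 0" "k = 0" using \<open>p dvd j\<close> ijk(2,3) by (auto dest: dvd_imp_le)
    then show ?thesis using ijk(4) i by simp
  qed
  ultimately show ?thesis by (auto simp: faithful_proj_rep_def)
qed

text \<open>Averaging over the powers of \<open>z\<close> isolates a nonzero coordinate of any
  nonzero vector, which puts a unit vector into \<open>W\<close>; the shift \<open>x\<close> then
  reaches all others.\<close>

lemma irreducible_rep:
  assumes p: "odd p"
  shows "irreducible_proj_rep G p rep"
  unfolding irreducible_proj_rep_def
proof (intro conjI allI impI)
  let ?e = "cis (2 * pi / real p)"
  show "proj_rep G p rep" using faithful_rep[OF p] by (simp add: faithful_proj_rep_def)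
  fix W assume "invariant_subspace p rep (carrier G) W"
  then have W: "W \<subseteq> carrier_vec p" "0\<^sub>v p \<in> W" "\<And>v w. v \<in> W \<Longrightarrow> w \<in> W \<Longrightarrow> v + w \<in> W"
    "\<And>c v. v \<in> W \<Longrightarrow> c \<cdot>\<^sub>v v \<in> W" "\<And>g v. g \<in> carrier G \<Longrightarrow> v \<in> W \<Longrightarrow> rep g *\<^sub>v v \<in> W"
    by (auto simp: invariant_subspace_def)
  have inv: "rep_of i j k *\<^sub>v v \<in> W" if "v \<in> W" for i j k v
    using W(5)[of "x [^] i \<otimes> y [^] j \<otimes> z [^] k" v] that by (simp add: rep_normal_form)
  show "W = {0\<^sub>v p} \<or> W = carrier_vec p"
  proof (cases "W = {0\<^sub>v p}")
    case False
    then obtain v where v: "v \<in> W" "v \<noteq> 0\<^sub>v p" using W(2) by blast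
    have vc: "v \<in> carrier_vec p" using v W(1) by blast
    obtain s where s: "s < p" "v $ s \<noteq> 0"
      using v(2) vc by (metis carrier_vecD eq_vecI index_zero_vec)
    let ?q = "\<lambda>r. inverse (?e ^ s) * ?e ^ r"
    \<comment> \<open>Partial sums allow induction using closure of \<open>W\<close> under addition
      and scaling; at \<open>K = p\<close> the coefficient vanishes except at
      \<open>s\<close>.\<close>
    have part: "vec p (\<lambda>r. (\<Sum>k<K. ?q r ^ k) * v $ r) \<in> W" for K
    proof (induction K)
      case 0
      have "vec p (\<lambda>r. (\<Sum>k<0. ?q r ^ k) * v $ r) = 0\<^sub>v p" by (intro eq_vecI) auto
      then show ?case using W(2) by simp
    next
      case (Suc K)
      have "rep_of 0 0 K *\<^sub>v v = vec p (\<lambda>r. (?e ^ r) ^ K * v $ r)"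
        unfolding rep_of_def using vc by (subst diagonal_mat_mult_vec) (auto simp: power_mult[symmetric] mult.commute)
      then have "vec p (\<lambda>r. (?e ^ r) ^ K * v $ r) \<in> W" using inv[OF v(1), of 0 0 K] by simp
      then have "vec p (\<lambda>r. (\<Sum>k<K. ?q r ^ k) * v $ r) + inverse (?e ^ s) ^ K \<cdot>\<^sub>v vec p (\<lambda>r. (?e ^ r) ^ K * v $ r) \<in> W"
        by (intro W(3)[OF Suc W(4)])
      also have "vec p (\<lambda>r. (\<Sum>k<K. ?q r ^ k) * v $ r) + inverse (?e ^ s) ^ K \<cdot>\<^sub>v vec p (\<lambda>r. (?e ^ r) ^ K * v $ r)
          = vec p (\<lambda>r. (\<Sum>k<Suc K. ?q r ^ k) * v $ r)"
        by (intro eq_vecI) (auto simp: power_mult_distrib algebra_simps)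
      finally show ?case .
    qed
    have q: "(\<Sum>k<p. ?q r ^ k) = (if r = s then of_nat p else 0)" if r: "r < p" for r
    proof (cases "r = s")
      case True
      then show ?thesis by simp
    next
      case False
      have "?q r \<noteq> 1"
      proof
        assume "?q r = 1"
        then have eq: "?e ^ r = ?e ^ s" by (simp add: field_simps)
        \<comment> \<open>The difference of maximum and minimum is the distance of \<open>r\<close>
          and \<open>s\<close> in natural arithmetic.\<close>
        have "?e ^ (max r s - min r s) = 1"
        proof (cases "r \<le> s")
          case True
          then have "?e ^ s = ?e ^ r * ?e ^ (s - r)" by (simp add: power_add[symmetric])
          then show ?thesis using eq True by simp
        next
          case False
          then have "?e ^ r = ?e ^ s * ?e ^ (r - s)" by (simp add: power_add[symmetric])
          then show ?thesis using eq False by simp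
        qed
        then have "p dvd max r s - min r s" using cis_root_eq_one_iff[OF p_pos] by blast
        moreover have "0 < max r s - min r s" "max r s - min r s < p" using False r s(1) by auto
        ultimately show False by (auto dest: dvd_imp_le)
      qed
      moreover have "?q r ^ p = 1"
        using cis_root_eq_one_iff[OF p_pos, of "r * p"] cis_root_eq_one_iff[OF p_pos, of "s * p"]
        by (simp add: power_mult_distrib power_inverse power_mult)
      ultimately show ?thesis using False by (simp add: geometric_sum)
    qed
    have "vec p (\<lambda>r. (\<Sum>k<p. ?q r ^ k) * v $ r) = (of_nat p * v $ s) \<cdot>\<^sub>v unit_vec p s"
      by (intro eq_vecI) (auto simp: q unit_vec_def)
    then have "inverse (of_nat p * v $ s) \<cdot>\<^sub>v ((of_nat p * v $ s) \<cdot>\<^sub>v unit_vec p s) \<in> W"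
      using W(4) part[of p] by metis
    moreover have "inverse (of_nat p * v $ s) \<cdot>\<^sub>v ((of_nat p * v $ s) \<cdot>\<^sub>v unit_vec p s) = unit_vec p s"
      using s p_pos by (intro eq_vecI) (auto simp: field_simps)
    ultimately have es: "unit_vec p s \<in> W" by simp
    have et: "unit_vec p t \<in> W" if "t < p" for t
    proof -
      \<comment> \<open>Shifting by \<open>p - s\<close> first avoids a negative shift; the total
        moves index \<open>s\<close> to \<open>t + p\<close>, that is, to \<open>t\<close>.\<close>
      have "rep_of (t + (p - s)) 0 0 *\<^sub>v unit_vec p s = 1 \<cdot>\<^sub>v unit_vec p ((s + (t + (p - s))) mod p)"
        unfolding rep_of_def using s(1) p_pos by (subst monomial_mat_mult_unit_vec) auto
      also have "s + (t + (p - s)) = t + p" using s(1) by simp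
      finally have "rep_of (t + (p - s)) 0 0 *\<^sub>v unit_vec p s = unit_vec p t" using that by simp
      then show ?thesis using inv[OF es] by metis
    qed
    have "w \<in> W" if w: "w \<in> carrier_vec p" for w
    proof -
      have "vec p (\<lambda>r. if r < K then w $ r else 0) \<in> W" for K
      proof (induction K)
        case 0
        have "vec p (\<lambda>r. if r < 0 then w $ r else 0) = 0\<^sub>v p" by (intro eq_vecI) auto
        then show ?case using W(2) by simp
      next
        case (Suc K)
        show ?case
        proof (cases "K < p")
          case True
          have "vec p (\<lambda>r. if r < Suc K then w $ r else 0) = vec p (\<lambda>r. if r < K then w $ r else 0) + w $ K \<cdot>\<^sub>v unit_vec p K"
            using True by (intro eq_vecI) (auto simp: unit_vec_def less_Suc_eq)
          then show ?thesis using W(3)[OF Suc W(4)[OF et[OF True]]] by simp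
        next
          case False
          then have "vec p (\<lambda>r. if r < Suc K then w $ r else 0) = vec p (\<lambda>r. if r < K then w $ r else 0)"
            by (intro eq_vecI) auto
          then show ?thesis using Suc by simp
        qed
      qed
      from this[of p] have "vec p (\<lambda>r. if r < p then w $ r else 0) \<in> W" .
      also have "vec p (\<lambda>r. if r < p then w $ r else 0) = w" using w by (intro eq_vecI) auto
      finally show ?thesis .
    qed
    then show ?thesis using W(1) by blast
  qed simp
qed

end

section \<open>The groups of order eight\<close>

definition mat2 :: "'a \<Rightarrow> 'a \<Rightarrow> 'a \<Rightarrow> 'a \<Rightarrow> 'a mat" where
  "mat2 a b c d = mat_of_rows_list 2 [[a, b], [c, d]]"

lemma mat2_carrier [simp]: "mat2 a b c d \<in> carrier_mat 2 2"
  by (simp add: mat2_def mat_of_rows_list_def numeral_2_eq_2)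

lemma mat2_index [simp]:
  "mat2 a b c d $$ (0, 0) = a" "mat2 a b c d $$ (0, 1) = b" "mat2 a b c d $$ (1, 0) = c" "mat2 a b c d $$ (1, 1) = d"
  "mat2 a b c d $$ (0, Suc 0) = b" "mat2 a b c d $$ (Suc 0, 0) = c" "mat2 a b c d $$ (Suc 0, Suc 0) = d"
  by (simp_all add: mat2_def mat_of_rows_list_def)

lemma mat2_eqI:
  assumes "A \<in> carrier_mat 2 2" "A $$ (0, 0) = a" "A $$ (0, 1) = b" "A $$ (1, 0) = c" "A $$ (1, 1) = d"
  shows "A = mat2 a b c d"
  using assms by (intro eq_matI) (auto simp: less_2_cases_iff carrier_matD[OF mat2_carrier])

lemma mat2_eq_iff [simp]: "mat2 a b c d = mat2 a' b' c' d' \<longleftrightarrow> a = a' \<and> b = b' \<and> c = c' \<and> d = d'"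
  by (metis mat2_index(1-4))

lemma mat2_mult [simp]:
  fixes a :: "'a :: comm_ring_1"
  shows "mat2 a b c d * mat2 a' b' c' d' = mat2 (a * a' + b * c') (a * b' + b * d') (c * a' + d * c') (c * b' + d * d')"
  by (rule mat2_eqI)
    (simp_all add: scalar_prod_def numeral_2_eq_2 carrier_matD[OF mat2_carrier, unfolded numeral_2_eq_2]
      mult_carrier_mat[OF mat2_carrier mat2_carrier, unfolded numeral_2_eq_2])

lemma mat2_smult [simp]:
  fixes a :: "'a :: comm_ring_1"
  shows "k \<cdot>\<^sub>m mat2 a b c d = mat2 (k * a) (k * b) (k * c) (k * d)"
  by (rule mat2_eqI) (simp_all add: carrier_matD[OF mat2_carrier])

lemma one_mat2: "(1\<^sub>m 2 :: 'a :: comm_ring_1 mat) = mat2 1 0 0 1"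
  by (rule mat2_eqI) simp_all

lemma mat2_mult_vec:
  fixes a :: "'a :: comm_ring_1"
  assumes "v \<in> carrier_vec 2"
  shows "mat2 a b c d *\<^sub>v v = vec 2 (\<lambda>i. if i = 0 then a * v $ 0 + b * v $ 1 else c * v $ 0 + d * v $ 1)"
proof (rule eq_vecI)
  fix i assume "i < dim_vec (vec 2 (\<lambda>i. if i = 0 then a * v $ 0 + b * v $ 1 else c * v $ 0 + d * v $ 1))"
  then have "i = 0 \<or> i = 1" by auto
  then show "(mat2 a b c d *\<^sub>v v) $ i = vec 2 (\<lambda>i. if i = 0 then a * v $ 0 + b * v $ 1 else c * v $ 0 + d * v $ 1) $ i"
    using assms
    by (elim disjE) (simp_all add: scalar_prod_def carrier_matD[OF mat2_carrier] numeral_2_eq_2)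
qed (simp add: carrier_matD[OF mat2_carrier])

lemma Collect_eq_image_Times: "{f x y | x y. x \<in> A \<and> y \<in> B} = (\<lambda>(x, y). f x y) ` (A \<times> B)"
  by auto

lemma insert_Times_four_two:
  "{a, b} \<times> {c, d, e, f} = {(a, c), (a, d), (a, e), (a, f), (b, c), (b, d), (b, e), (b, f)}"
  "{c, d, e, f} \<times> {a, b} = {(c, a), (d, a), (e, a), (f, a), (c, b), (d, b), (e, b), (f, b)}"
  by auto

section \<open>The quaternion group\<close>

lemma Q8_simps: "qI = mat2 \<i> 0 0 (- \<i>)" "qJ = mat2 0 1 (-1) 0"
  by (simp_all add: qI_def qJ_def mat2_def)

lemma carrier_Q8:
  "carrier Q8 = {mat2 1 0 0 1, mat2 \<i> 0 0 (- \<i>), mat2 0 1 (-1) 0, mat2 0 \<i> \<i> 0,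
    mat2 (-1) 0 0 (-1), mat2 (- \<i>) 0 0 \<i>, mat2 0 (-1) 1 0, mat2 0 (- \<i>) (- \<i>) 0}"
proof -
  have "carrier Q8 = (\<lambda>(s, M). s \<cdot>\<^sub>m M) ` ({1, -1} \<times> {1\<^sub>m 2, qI, qJ, qI * qJ})"
    by (simp only: Q8_def partial_object.select_convs Collect_eq_image_Times)
  then show ?thesis unfolding insert_Times_four_two by (simp add: Q8_simps one_mat2)
qed

lemma card_Q8: "card (carrier Q8) = 8"
proof -
  let ?xs = "[mat2 1 0 0 1, mat2 \<i> 0 0 (- \<i>), mat2 0 1 (-1) 0, mat2 0 \<i> \<i> 0,
    mat2 (-1) 0 0 (-1), mat2 (- \<i>) 0 0 \<i>, mat2 0 (-1) 1 0, mat2 0 (- \<i>) (- \<i>) 0]"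
  have i: "\<i> \<noteq> - \<i>" "- \<i> \<noteq> \<i>" by (simp_all add: complex_eq_iff)
  have "carrier Q8 = set ?xs" by (simp only: carrier_Q8 list.set)
  moreover have "distinct ?xs" by (simp add: i)
  ultimately show ?thesis using distinct_card[of ?xs] by simp
qed

lemma mult_Q8: "A \<otimes>\<^bsub>Q8\<^esub> B = A * B"
  by (simp add: Q8_def)

text \<open>The targets \<open>Q8\<close> and \<open>D8\<close> are concrete records not shown to be
  groups; a right identity with a preimage is enough.\<close>

lemma iso_hom_one:
  assumes G: "group G" and \<phi>: "\<phi> \<in> iso G H" and e: "e \<in> carrier H" "\<And>h. h \<in> carrier H \<Longrightarrow> h \<otimes>\<^bsub>H\<^esub> e = h"
  shows "\<phi> \<one>\<^bsub>G\<^esub> = e"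
proof -
  interpret group G by (rule G)
  have surj: "\<phi> ` carrier G = carrier H" and hom: "\<phi> \<in> hom G H"
    using \<phi> by (simp_all add: iso_def bij_betw_def)
  have "e \<in> \<phi> ` carrier G" using e(1) by (simp only: surj)
  then obtain g where g: "g \<in> carrier G" "\<phi> g = e" by (auto elim: imageE)
  have "\<phi> \<one>\<^bsub>G\<^esub> \<in> carrier H" using imageI[OF one_closed, of \<phi>] by (simp only: surj)
  then have "\<phi> \<one>\<^bsub>G\<^esub> = \<phi> \<one>\<^bsub>G\<^esub> \<otimes>\<^bsub>H\<^esub> e" using e(2) by simp
  also have "\<dots> = \<phi> (\<one>\<^bsub>G\<^esub> \<otimes>\<^bsub>G\<^esub> g)" using hom_mult[OF hom one_closed g(1)] g by simp
  finally show ?thesis using g by simp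
qed

text \<open>\<open>a\<close> and \<open>b\<close> are the preimages of \<open>qI\<close> and
  \<open>qJ\<close>: both square to -1, and \<open>qI\<close> anticommutes with \<open>qJ\<close>,
  which amounts to the metacyclic relation as the cube of \<open>qI\<close> is
  \<open>- qI\<close>.\<close>

lemma Q8_metacyclic:
  assumes G: "group G" and iso: "G \<cong> Q8"
  shows "\<exists>a b. metacyclic_pp G 2 a b \<and> b [^]\<^bsub>G\<^esub> (2::nat) = a [^]\<^bsub>G\<^esub> (2::nat)"
proof -
  interpret group G by (rule G)
  obtain \<phi> where \<phi>: "\<phi> \<in> iso G Q8" using iso by (auto simp: is_iso_def)
  have surj: "\<phi> ` carrier G = carrier Q8" and inj: "inj_on \<phi> (carrier G)" and hom: "\<phi> \<in> hom G Q8"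
    using \<phi> by (auto simp: iso_def bij_betw_def)
  have mult: "\<phi> (g \<otimes>\<^bsub>G\<^esub> h) = \<phi> g * \<phi> h" if "g \<in> carrier G" "h \<in> carrier G" for g h
    using hom_mult[OF hom that] by (simp add: mult_Q8)
  have one: "\<phi> \<one>\<^bsub>G\<^esub> = mat2 1 0 0 1"
    by (rule iso_hom_one[OF G \<phi>]) (auto simp: carrier_Q8 mult_Q8)
  obtain a b where ab: "a \<in> carrier G" "\<phi> a = mat2 \<i> 0 0 (- \<i>)" "b \<in> carrier G" "\<phi> b = mat2 0 1 (-1) 0"
  proof -
    have "mat2 \<i> 0 0 (- \<i>) \<in> \<phi> ` carrier G" "mat2 0 1 (-1) 0 \<in> \<phi> ` carrier G"
      unfolding surj by (simp_all add: carrier_Q8)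
    then show ?thesis using that by (metis imageE)
  qed
  have eqI: "g = h" if "g \<in> carrier G" "h \<in> carrier G" "\<phi> g = \<phi> h" for g h
    using inj that by (auto simp: inj_on_def)
  have pow2: "g [^]\<^bsub>G\<^esub> (2::nat) = g \<otimes>\<^bsub>G\<^esub> g" if "g \<in> carrier G" for g
    using that by (simp add: numeral_2_eq_2)
  have "metacyclic_pp G 2 a b"
  proof
    have "a [^]\<^bsub>G\<^esub> (2\<^sup>2 :: nat) = (a [^]\<^bsub>G\<^esub> (2::nat)) [^]\<^bsub>G\<^esub> (2::nat)"
      using ab by (simp add: nat_pow_pow)
    also have "\<dots> = \<one>\<^bsub>G\<^esub>"
      by (rule eqI) (use ab in \<open>simp_all add: pow2 mult one\<close>)
    finally show "a [^]\<^bsub>G\<^esub> (2\<^sup>2 :: nat) = \<one>\<^bsub>G\<^esub>" .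
    show "a [^]\<^bsub>G\<^esub> (2::nat) \<noteq> \<one>\<^bsub>G\<^esub>"
    proof
      assume "a [^]\<^bsub>G\<^esub> (2::nat) = \<one>\<^bsub>G\<^esub>"
      then have "\<phi> a * \<phi> a = mat2 1 0 0 1" using ab mult one pow2 by metis
      then show False by (simp add: ab)
    qed
    have "a [^]\<^bsub>G\<^esub> Suc 2 = a \<otimes>\<^bsub>G\<^esub> a \<otimes>\<^bsub>G\<^esub> a"
      by (simp only: Group.nat_pow_Suc pow2[OF ab(1)])
    then show "a \<otimes>\<^bsub>G\<^esub> b = b \<otimes>\<^bsub>G\<^esub> a [^]\<^bsub>G\<^esub> Suc 2"
      by (simp only:) (rule eqI, use ab in \<open>simp_all add: mult\<close>)
    show "Coset.order G = 2 ^ 3"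
      using card_image[OF inj] unfolding surj by (simp add: Coset.order_def card_Q8)
  qed (use ab in auto)
  moreover have "b [^]\<^bsub>G\<^esub> (2::nat) = a [^]\<^bsub>G\<^esub> (2::nat)"
    by (rule eqI) (use ab in \<open>simp_all add: mult pow2\<close>)
  ultimately show ?thesis by blast
qed

text \<open>Direct sum of the defining representation and the trivial one; the corner entry 1
  prevents the central element -1 from being scalar.\<close>

lemma Q8_faithful_rep:
  assumes G: "group G" and iso: "G \<cong> Q8"
  shows "\<exists>\<rho>. faithful_proj_rep G 3 \<rho>"
proof -
  interpret group G by (rule G)
  obtain \<phi> where \<phi>: "\<phi> \<in> iso G Q8" using iso by (auto simp: is_iso_def)
  have surj: "\<phi> ` carrier G = carrier Q8" and inj: "inj_on \<phi> (carrier G)" and hom: "\<phi> \<in> hom G Q8"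
    using \<phi> by (auto simp: iso_def bij_betw_def)
  have mult: "\<phi> (g \<otimes>\<^bsub>G\<^esub> h) = \<phi> g * \<phi> h" if "g \<in> carrier G" "h \<in> carrier G" for g h
    using hom_mult[OF hom that] by (simp add: mult_Q8)
  have one: "\<phi> \<one>\<^bsub>G\<^esub> = 1\<^sub>m 2"
    unfolding one_mat2 by (rule iso_hom_one[OF G \<phi>]) (auto simp: carrier_Q8 mult_Q8)
  have mat: "\<phi> g \<in> carrier_mat 2 2" if "g \<in> carrier G" for g
  proof -
    have "\<phi> g \<in> carrier Q8" using that surj by blast
    then show ?thesis unfolding carrier_Q8 by auto
  qed
  define \<rho> where "\<rho> g = four_block_mat (\<phi> g) (0\<^sub>m 2 1) (0\<^sub>m 1 2) (1\<^sub>m 1)" for g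
  have "proj_rep G 3 \<rho>"
  proof (rule proj_repI[OF G])
    show "\<rho> g \<in> carrier_mat 3 3" if "g \<in> carrier G" for g
      using four_block_carrier_mat[OF mat[OF that], of "1\<^sub>m 1" 1 1] by (simp add: \<rho>_def)
    show "\<rho> \<one>\<^bsub>G\<^esub> = 1\<^sub>m 3"
      unfolding \<rho>_def one by (auto intro!: eq_matI)
    show "\<exists>c. c \<noteq> 0 \<and> \<rho> g * \<rho> h = c \<cdot>\<^sub>m \<rho> (g \<otimes>\<^bsub>G\<^esub> h)" if "g \<in> carrier G" "h \<in> carrier G" for g h
    proof -
      have "\<rho> g * \<rho> h = \<rho> (g \<otimes>\<^bsub>G\<^esub> h)"
        unfolding \<rho>_def mult[OF that]
        using mat[OF that(1)] mat[OF that(2)]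
        by (subst mult_four_block_mat[of _ 2 2 _ 1 _ 1 _ _ 2 _ 1]) auto
      then show ?thesis by (intro exI[of _ 1]) (auto intro!: eq_matI)
    qed
  qed simp
  moreover have "g = \<one>\<^bsub>G\<^esub>" if g: "g \<in> carrier G" and c: "\<rho> g = c \<cdot>\<^sub>m 1\<^sub>m 3" for g c
  proof -
    have "c = 1" using arg_cong[OF c, of "\<lambda>M. M $$ (2, 2)"] mat[OF g] by (simp add: \<rho>_def)
    have "\<phi> g = 1\<^sub>m 2"
    proof (rule eq_matI)
      fix i j assume "i < dim_row (1\<^sub>m 2 :: complex mat)" "j < dim_col (1\<^sub>m 2 :: complex mat)"
      then show "\<phi> g $$ (i, j) = 1\<^sub>m 2 $$ (i, j)"
        using arg_cong[OF c, of "\<lambda>M. M $$ (i, j)"] mat[OF g] \<open>c = 1\<close> by (simp add: \<rho>_def)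
    qed (use mat[OF g] in auto)
    then show ?thesis using inj g one by (auto simp: inj_on_def)
  qed
  ultimately show ?thesis by (auto simp: faithful_proj_rep_def)
qed

section \<open>The dihedral group of order 8\<close>

text \<open>Projectively, a rotation by an angle \<open>t\<close> lifts to a matrix with eigenvalue ratio \<open>exp(it)\<close>; the
  factor \<open>u\<close> is \<open>exp(it)\<close> read off from the first column.\<close>

definition dihedral_lift :: "int mat \<Rightarrow> complex mat" where
  "dihedral_lift M = (let u = Complex (of_int (M $$ (0, 0))) (of_int (M $$ (1, 0))) in
     if M $$ (0, 0) = M $$ (1, 1) \<and> M $$ (0, 1) = - M $$ (1, 0) then mat2 1 0 0 u else mat2 0 1 u 0)"

lemma dihedral_lift_carrier [simp]: "dihedral_lift M \<in> carrier_mat 2 2"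
  by (simp add: dihedral_lift_def Let_def)

lemma D8_simps: "dR = mat2 0 (-1) 1 0" "dS = mat2 1 0 0 (-1)"
  by (simp_all add: dR_def dS_def mat2_def)

lemma carrier_D8:
  "carrier D8 = {mat2 1 0 0 1, mat2 0 (-1) 1 0, mat2 (-1) 0 0 (-1), mat2 0 1 (-1) 0,
    mat2 1 0 0 (-1), mat2 0 1 1 0, mat2 (-1) 0 0 1, mat2 0 (-1) (-1) 0}"
proof -
  have "carrier D8 = (\<lambda>(M, E). M * E) ` ({1\<^sub>m 2, dR, dR * dR, dR * dR * dR} \<times> {1\<^sub>m 2, dS})"
    by (simp only: D8_def partial_object.select_convs Collect_eq_image_Times)
  then show ?thesis unfolding insert_Times_four_two by (simp add: D8_simps one_mat2)
qed

lemma mult_D8: "A \<otimes>\<^bsub>D8\<^esub> B = A * B"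
  by (simp add: D8_def)

lemma dihedral_lift_mult:
  assumes "M \<in> carrier D8" "N \<in> carrier D8"
  shows "\<exists>c. c \<noteq> 0 \<and> dihedral_lift M * dihedral_lift N = c \<cdot>\<^sub>m dihedral_lift (M * N)"
proof -
  let ?u = "Complex (of_int (N $$ (0, 0))) (of_int (N $$ (1, 0)))"
  \<comment> \<open>Left multiplication by a rotation is exact. A reflection swaps the coordinates
    and turns \<open>diag(1, u)\<close> into \<open>diag(u, 1)\<close>, which is \<open>u\<close>
    times the lift of the inverse rotation; hence the factor read off from \<open>N\<close>.\<close>
  let ?c = "if M $$ (0, 0) = M $$ (1, 1) \<and> M $$ (0, 1) = - M $$ (1, 0) then 1 else ?u"
  have "?c \<noteq> 0 \<and> dihedral_lift M * dihedral_lift N = ?c \<cdot>\<^sub>m dihedral_lift (M * N)"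
    using assms unfolding carrier_D8 insert_iff empty_iff
    by (elim disjE FalseE) (simp_all add: dihedral_lift_def complex_eq_iff)
  then show ?thesis by blast
qed

text \<open>The half turn lifts to \<open>diag(1, -1)\<close>, which is not scalar although the half
  turn is central; this gives faithfulness. The quarter turn separates the two coordinates and a
  reflection exchanges them, which gives irreducibility.\<close>

lemma D8_rep:
  assumes G: "group G" and iso: "G \<cong> D8"
  shows "\<exists>\<rho>. faithful_proj_rep G 2 \<rho> \<and> irreducible_proj_rep G 2 \<rho>"
proof -
  interpret group G by (rule G)
  obtain \<phi> where \<phi>: "\<phi> \<in> iso G D8" using iso by (auto simp: is_iso_def)
  have surj: "\<phi> ` carrier G = carrier D8" and inj: "inj_on \<phi> (carrier G)" and hom: "\<phi> \<in> hom G D8"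
    using \<phi> by (auto simp: iso_def bij_betw_def)
  have mult: "\<phi> (g \<otimes>\<^bsub>G\<^esub> h) = \<phi> g * \<phi> h" if "g \<in> carrier G" "h \<in> carrier G" for g h
    using hom_mult[OF hom that] by (simp add: mult_D8)
  have one: "\<phi> \<one>\<^bsub>G\<^esub> = mat2 1 0 0 1"
    by (rule iso_hom_one[OF G \<phi>]) (auto simp: carrier_D8 mult_D8)
  have img: "\<phi> g \<in> carrier D8" if "g \<in> carrier G" for g using that surj by blast
  define \<rho> where "\<rho> g = dihedral_lift (\<phi> g)" for g
  have proj: "proj_rep G 2 \<rho>"
  proof (rule proj_repI[OF G])
    show "\<rho> \<one>\<^bsub>G\<^esub> = 1\<^sub>m 2" by (simp add: \<rho>_def one one_mat2 dihedral_lift_def complex_eq_iff)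
  qed (auto simp: \<rho>_def mult img intro!: dihedral_lift_mult)
  have "g = \<one>\<^bsub>G\<^esub>" if g: "g \<in> carrier G" and c: "\<rho> g = c \<cdot>\<^sub>m 1\<^sub>m 2" for g c
  proof -
    have "dihedral_lift (\<phi> g) = mat2 c 0 0 c" using c by (simp add: \<rho>_def one_mat2)
    then have "\<phi> g = mat2 1 0 0 1"
      using img[OF g] unfolding carrier_D8 insert_iff empty_iff
      by (elim disjE FalseE) (auto simp: dihedral_lift_def complex_eq_iff)
    then show ?thesis using inj g one by (auto simp: inj_on_def)
  qed
  with proj have "faithful_proj_rep G 2 \<rho>" by (auto simp: faithful_proj_rep_def)
  moreover have "irreducible_proj_rep G 2 \<rho>"
    unfolding irreducible_proj_rep_def
  proof (intro conjI allI impI proj)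
    fix W assume "invariant_subspace 2 \<rho> (carrier G) W"
    then have W: "W \<subseteq> carrier_vec 2" "0\<^sub>v 2 \<in> W" "\<And>v w. v \<in> W \<Longrightarrow> w \<in> W \<Longrightarrow> v + w \<in> W"
      "\<And>c v. v \<in> W \<Longrightarrow> c \<cdot>\<^sub>v v \<in> W" "\<And>g v. g \<in> carrier G \<Longrightarrow> v \<in> W \<Longrightarrow> \<rho> g *\<^sub>v v \<in> W"
      by (auto simp: invariant_subspace_def)
    have lift: "dihedral_lift M *\<^sub>v v \<in> W" if "M \<in> carrier D8" "v \<in> W" for M v
      using W(5) that surj unfolding \<rho>_def by (metis imageE)
    define V where "V x y = vec 2 (\<lambda>i. if i = 0 then x else y)" for x y :: complex
    have VV: "V x y + V x' y' = V (x + x') (y + y')" "c \<cdot>\<^sub>v V x y = V (c * x) (c * y)" for x y x' y' c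
      unfolding V_def by (auto intro!: eq_vecI)
    have Vex: "\<exists>x y. v = V x y" if "v \<in> carrier_vec 2" for v
      using that by (intro exI[of _ "v $ 0"] exI[of _ "v $ 1"]) (auto simp: V_def less_2_cases_iff intro!: eq_vecI)
    have VM: "mat2 a b c d *\<^sub>v V x y = V (a * x + b * y) (c * x + d * y)" for a b c d x y
      unfolding V_def by (subst mat2_mult_vec) (auto intro!: eq_vecI)
    have D: "V x (\<i> * y) \<in> W" if "V x y \<in> W" for x y
      using lift[of "mat2 0 (-1) 1 0" "V x y"] that
      by (simp add: carrier_D8 dihedral_lift_def VM Complex_eq)
    have S: "V y x \<in> W" if "V x y \<in> W" for x y
      using lift[of "mat2 1 0 0 (-1)" "V x y"] that
      by (simp add: carrier_D8 dihedral_lift_def VM Complex_eq)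
    \<comment> \<open>Subtracting a vector from its image under the quarter turn
      \<open>diag(1, i)\<close> cancels the first coordinate and multiplies the second by
      \<open>\<i> - 1\<close>.\<close>
    have e: "V 0 1 \<in> W" if v: "V x y \<in> W" and y: "y \<noteq> 0" for x y
    proof -
      let ?c = "(\<i> - 1) * y"
      have "\<i> - 1 \<noteq> 0" by (simp add: complex_eq_iff)
      then have "?c \<noteq> 0" using y by simp
      then have "inverse ?c * ?c = 1" by (rule left_inverse)
      moreover have "\<i> * y + (-1) * y = ?c" by (simp add: algebra_simps)
      ultimately have 1: "inverse ?c * (\<i> * y + (-1) * y) = 1" by (simp only:)
      have 0: "inverse ?c * (x + (-1) * x) = 0" by simp
      have "inverse ?c \<cdot>\<^sub>v (V x (\<i> * y) + (-1) \<cdot>\<^sub>v V x y) \<in> W"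
        by (intro W(3,4) D v)
      then show ?thesis by (simp only: VV 0 1)
    qed
    show "W = {0\<^sub>v 2} \<or> W = carrier_vec 2"
    proof (cases "W = {0\<^sub>v 2}")
      case False
      then obtain v where v: "v \<in> W" "v \<noteq> 0\<^sub>v 2" using W(2) by blast
      obtain x y where xy: "v = V x y" using Vex v W(1) by blast
      have "V 0 0 = 0\<^sub>v 2" unfolding V_def by (auto intro!: eq_vecI)
      then have "x \<noteq> 0 \<or> y \<noteq> 0" using v xy by auto
      then have e1: "V 0 1 \<in> W" using e S v xy by blast
      have "V x y \<in> W" for x y
        using W(3)[OF W(4)[OF S[OF e1], of x] W(4)[OF e1, of y]] by (simp add: VV)
      then show ?thesis using Vex W(1) by blast
    qed simp
  qed
  ultimately show ?thesis by blast
qed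

text \<open>In degree 1 every matrix is scalar, so only the trivial group could be represented
  faithfully.\<close>

lemma degree_ge_two:
  assumes f: "faithful_proj_rep G m \<rho>" and g: "g \<in> carrier G" "g \<noteq> \<one>\<^bsub>G\<^esub>"
  shows "2 \<le> m"
proof (rule ccontr)
  assume "\<not> 2 \<le> m"
  moreover have "0 < m" using f by (simp add: faithful_proj_rep_def proj_rep_def)
  ultimately have m: "m = 1" by simp
  have "\<rho> g \<in> carrier_mat 1 1" using f g m by (simp add: faithful_proj_rep_def proj_rep_def)
  then have "\<rho> g = (\<rho> g $$ (0, 0)) \<cdot>\<^sub>m 1\<^sub>m m" using m by (intro eq_matI) auto
  then show False using f g by (auto simp: faithful_proj_rep_def)
qed

section \<open>Assembling the four cases\<close>

lemma (in group) noncommuting_pair: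
  assumes "\<not> comm_group G"
  obtains x y where "x \<in> carrier G" "y \<in> carrier G" "x \<otimes> y \<noteq> y \<otimes> x"
  using assms group_comm_groupI by metis

text \<open>The order of a finite group is an admissible exponent, so the least one is
  attained.\<close>

lemma grp_exponentD:
  fixes n k :: nat
  assumes G: "group G" and fin: "finite (carrier G)" and n: "grp_exponent G = n"
  shows "x \<in> carrier G \<Longrightarrow> x [^]\<^bsub>G\<^esub> n = \<one>\<^bsub>G\<^esub>"
    and "0 < k \<Longrightarrow> k < n \<Longrightarrow> \<exists>x\<in>carrier G. x [^]\<^bsub>G\<^esub> k \<noteq> \<one>\<^bsub>G\<^esub>"
proof -
  interpret group G by (rule G)
  let ?P = "\<lambda>n::nat. 0 < n \<and> (\<forall>x\<in>carrier G. x [^]\<^bsub>G\<^esub> n = \<one>\<^bsub>G\<^esub>)"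
  have "?P (Coset.order G)" using fin pow_order_eq_1 by (simp add: order_gt_0_iff_finite)
  then have "?P (LEAST n. ?P n)" by (rule LeastI)
  then show "x \<in> carrier G \<Longrightarrow> x [^]\<^bsub>G\<^esub> n = \<one>\<^bsub>G\<^esub>"
    using n unfolding grp_exponent_def by blast
  show "0 < k \<Longrightarrow> k < n \<Longrightarrow> \<exists>x\<in>carrier G. x [^]\<^bsub>G\<^esub> k \<noteq> \<one>\<^bsub>G\<^esub>"
    using not_less_Least[of k ?P] n unfolding grp_exponent_def by blast
qed

theorem theorem6p5:
  fixes p :: nat
    and G1 :: "('a, 'e) monoid_scheme"
    and G2 :: "('a, 'e) monoid_scheme"
    and G3 :: "('a, 'e) monoid_scheme"
    and G4 :: "('a, 'e) monoid_scheme"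
  assumes "prime p" and "odd p"
  shows
   "(group G1 \<and> card (carrier G1) = p ^ 3 \<and> \<not> comm_group G1 \<and> grp_exponent G1 = p ^ 2 \<longrightarrow>
        \<not> (\<exists>m \<rho>. faithful_proj_rep G1 m \<rho> \<and> irreducible_proj_rep G1 m \<rho>) \<and>
        tau G1 = p + 1)
    \<and> (group G2 \<and> card (carrier G2) = p ^ 3 \<and> \<not> comm_group G2 \<and> grp_exponent G2 = p \<longrightarrow>
        tau_irr G2 = p \<and> tau G2 = p)
    \<and> (group G3 \<and> G3 \<cong> Q8 \<longrightarrow>
        \<not> (\<exists>m \<rho>. faithful_proj_rep G3 m \<rho> \<and> irreducible_proj_rep G3 m \<rho>) \<and>
        tau G3 = 3)
    \<and> (group G4 \<and> G4 \<cong> D8 \<longrightarrow>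
        tau_irr G4 = 2 \<and> tau G4 = 2)"
proof (intro conjI impI)
  have fin: "finite (carrier G)" if "card (carrier G) = p ^ 3" for G :: "('a, 'e) monoid_scheme"
    using that prime_gt_0_nat[OF assms(1)] by (metis card_gt_0_iff zero_less_power)
  {
    assume *: "group G1 \<and> card (carrier G1) = p ^ 3 \<and> \<not> comm_group G1 \<and> grp_exponent G1 = p ^ 2"
    then interpret group G1 by blast
    note exp = grp_exponentD[OF is_group fin, of "p\<^sup>2"]
    \<comment> \<open>Minimality of the exponent, tested at \<open>p\<close>, supplies an element
      whose p-th power is nontrivial.\<close>
    have "0 < p" "p < p\<^sup>2" using prime_gt_1_nat[OF assms(1)] by (auto simp: power2_eq_square)
    then obtain a where a: "a \<in> carrier G1" "a [^]\<^bsub>G1\<^esub> p \<noteq> \<one>\<^bsub>G1\<^esub>" using exp(2) * by blast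
    obtain x y where xy: "x \<in> carrier G1" "y \<in> carrier G1" "x \<otimes>\<^bsub>G1\<^esub> y \<noteq> y \<otimes>\<^bsub>G1\<^esub> x"
      using * group.noncommuting_pair[of G1] by blast
    have ord: "Coset.order G1 = p ^ 3" using * by (simp add: Coset.order_def)
    have "\<exists>b. b [^]\<^bsub>G1\<^esub> p = \<one>\<^bsub>G1\<^esub> \<and> metacyclic_pp G1 p a b"
      by (rule exponent_prime_sq_generators[OF assms ord xy(3,1,2) _ a]) (use exp(1) * in auto)
    then obtain b where b: "b [^]\<^bsub>G1\<^esub> p = \<one>\<^bsub>G1\<^esub>" "metacyclic_pp G1 p a b" by blast
    have fm: "faithful_metacyclic G1 p a b m \<rho>" if "faithful_proj_rep G1 m \<rho>" for m \<rho>
      using b assms(2) that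
      by (simp add: faithful_metacyclic_def faithful_metacyclic_axioms_def faithful_proj_def faithful_proj_axioms_def is_group)
    show "\<not> (\<exists>m \<rho>. faithful_proj_rep G1 m \<rho> \<and> irreducible_proj_rep G1 m \<rho>)"
      using faithful_metacyclic.not_irreducible[OF fm] by blast
    show "tau G1 = p + 1"
      using tau_eqI[OF metacyclic_pp.faithful_rep[OF b(2,1)] faithful_metacyclic.degree_gt[OF fm]] by simp
  }
  {
    assume *: "group G2 \<and> card (carrier G2) = p ^ 3 \<and> \<not> comm_group G2 \<and> grp_exponent G2 = p"
    then interpret group G2 by blast
    obtain x y where xy: "x \<in> carrier G2" "y \<in> carrier G2" "x \<otimes>\<^bsub>G2\<^esub> y \<noteq> y \<otimes>\<^bsub>G2\<^esub> x"
      using * group.noncommuting_pair[of G2] by blast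
    have ord: "Coset.order G2 = p ^ 3" using * by (simp add: Coset.order_def)
    have "\<exists>z. heisenberg_pp G2 p x y z"
      by (rule exponent_prime_generators[OF assms(1) ord xy(3,1,2)])
        (use grp_exponentD(1)[OF is_group fin, of p] * in auto)
    then obtain z where "heisenberg_pp G2 p x y z" by blast
    then interpret heisenberg_pp G2 p x y z .
    show "tau_irr G2 = p"
      by (rule tau_irr_eqI[OF faithful_rep[OF assms(2)] irreducible_rep[OF assms(2)] degree_ge])
    show "tau G2 = p"
      by (rule tau_eqI[OF faithful_rep[OF assms(2)] degree_ge])
  }
  {
    assume *: "group G3 \<and> G3 \<cong> Q8"
    then obtain a b where ab: "metacyclic_pp G3 2 a b" "b [^]\<^bsub>G3\<^esub> (2::nat) = a [^]\<^bsub>G3\<^esub> (2::nat)"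
      using Q8_metacyclic by blast
    have fm: "faithful_metacyclic G3 2 a b m \<rho>" if "faithful_proj_rep G3 m \<rho>" for m \<rho>
      using ab that *
      by (simp add: faithful_metacyclic_def faithful_metacyclic_axioms_def faithful_proj_def faithful_proj_axioms_def)
    show "\<not> (\<exists>m \<rho>. faithful_proj_rep G3 m \<rho> \<and> irreducible_proj_rep G3 m \<rho>)"
      using faithful_metacyclic.not_irreducible[OF fm] by blast
    obtain \<rho> where "faithful_proj_rep G3 3 \<rho>" using Q8_faithful_rep * by blast
    then show "tau G3 = 3"
      using faithful_metacyclic.degree_gt[OF fm] by (intro tau_eqI) auto
  }
  {
    assume *: "group G4 \<and> G4 \<cong> D8"
    then obtain \<rho> where \<rho>: "faithful_proj_rep G4 2 \<rho>" "irreducible_proj_rep G4 2 \<rho>" using D8_rep by blast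
    obtain \<phi> where "\<phi> \<in> iso G4 D8" using * by (auto simp: is_iso_def)
    then have surj: "\<phi> ` carrier G4 = carrier D8" by (auto simp: iso_def bij_betw_def)
    \<comment> \<open>Two distinct elements are enough for the lower bound, since one of them must
      be nontrivial.\<close>
    have "mat2 1 0 0 1 \<in> \<phi> ` carrier G4" "mat2 0 1 1 0 \<in> \<phi> ` carrier G4"
      unfolding surj by (simp_all add: carrier_D8)
    then obtain g h where gh: "g \<in> carrier G4" "h \<in> carrier G4" "\<phi> g = mat2 1 0 0 1" "\<phi> h = mat2 0 1 1 0"
      by (metis imageE)
    then have "g \<noteq> h" by auto
    then have ge: "2 \<le> m" if "faithful_proj_rep G4 m \<rho>" for m \<rho>
      using degree_ge_two[OF that] gh(1,2) by metis
    show "tau_irr G4 = 2" by (rule tau_irr_eqI[OF \<rho> ge])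
    show "tau G4 = 2" by (rule tau_eqI[OF \<rho>(1) ge])
  }
qed

end
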